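(* Let $d\ge1$. For $\alpha>0$ and $0<K_1\le K_2$, say that a potential $V:\mathbb R^d\to\mathbb R$ satisfies $N(\alpha,K_1,K_2)$ if $$-K_2(1+|x|)^{-\alpha}\le V(x)\le -K_1(1+|x|)^{-\alpha},\qquad x\in\mathbb R^d.$$ Say that estimate (E) holds for $V$ (with a given $\alpha$) if there exist positive constants $C_1,\dots,C_8$ such that for all $x,y\in\mathbb R^d$ and $t>0$, writing $m:=1+\min\{|x|,|y|\}$, $$C_1t^{-d/2}\exp\left(-\frac{C_2|x-y|^2}{t}\right)\exp\left(\max\left\{\frac{C_3t}{m^{\alpha}},\ C_3t-\frac{C_4m^2}{t}\right\}\right)\le p(t,x,y)$$ and $$p(t,x,y)\le C_5t^{-d/2}\exp\left(-\frac{C_6|x-y|^2}{t}\right)\exp\left(\max\left\{\frac{C_7t}{m^{\alpha}},\ C_7t-\frac{C_8m^2}{t}\right\}\right).$$ Then the following statements hold. (1) If $V$ satisfies $N(\alpha,K_1,K_2)$ for some $\alpha\in(0,2)$ and some $K_1,K_2>0$, then (E) holds. (2) For every $\alpha\in[2,+\infty)$ there exists a constant $K_*>0$ such that, if $V$ satisfies $N(\alpha,K_1,K_2)$ with $K_1\ge K_*$, then (E) holds. (3) Suppose $d\ge3$. For every $\alpha\in(2,+\infty)$ there exists $K^*>0$ such that, if $V$ satisfies $N(\alpha,K_1,K_2)$ with $K_2\le K^*$, then there exist positive constants $c_1,c_2,c_3,c_4$ such that for all $x,y\in\mathbb R^d$ and $t>0$, $$c_1t^{-d/2}\exp\left(-\frac{c_2|x-y|^2}{t}\right)\le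 p(t,x,y)\le c_3t^{-d/2}\exp\left(-\frac{c_4|x-y|^2}{t}\right).$$
   Context: Let $V:\mathbb R^d\to\mathbb R$ be (measurable,) locally bounded and bounded from below, and let $\mathcal L^V=-\frac12\Delta+V$ on $\mathbb R^d$. Let $\{B_t\}_{t\ge0}$ be the standard $\mathbb R^d$-valued Brownian motion and $\mathbb E_x$ the expectation when it starts at $x$. The Schrödinger semigroup of $\mathcal L^V$ is given by the Feynman-Kac formula $T_t^Vf(x)=\mathbb E_x\left[f(B_t)\exp\left(-\int_0^tV(B_s)\,ds\right)\right]$, $f\in C_b(\mathbb R^d)$. The heat kernel $p(t,x,y)$ is its jointly continuous density with respect to Lebesgue measure: $T_t^Vf(x)=\int_{\mathbb R^d}p(t,x,y)f(y)\,dy$ for $f\in C_b(\mathbb R^d)$, $t>0$, $x\in\mathbb R^d$. *)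

theory Defs
  imports "HOL-Probability.Probability"
begin

text \<open>
  Standard Brownian motion on \<open>\<real>\<^sup>d\<close> (\<open>d = CARD('n)\<close>) under the probability measure \<open>M\<close>, started
  at \<open>x\<close>; only the times \<open>t \<ge> 0\<close> are meaningful.  Independence of an infinite family
  means independence of all its finite subfamilies, so \<open>independent_increments\<close> is the usual
  condition on finitely many times \<open>0 \<le> t\<^sub>0 < \<dots> < t\<^sub>n\<close>.
\<close>

locale brownian_motion = prob_space M
  for M :: "'w measure" and B :: "real \<Rightarrow> 'w \<Rightarrow> real ^ 'n" and x :: "real ^ 'n" +
  assumes measurable_process: "\<And>t. 0 \<le> t \<Longrightarrow> B t \<in> borel_measurable M"
    and start: "AE \<omega> in M. B 0 \<omega> = x"
    and continuous_paths: "\<And>\<omega>. \<omega> \<in> space M \<Longrightarrow> continuous_on {0..} (\<lambda>t. B t \<omega>)"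
    and independent_increments:
      "\<And>\<tau> :: nat \<Rightarrow> real. 0 \<le> \<tau> 0 \<Longrightarrow> strict_mono \<tau> \<Longrightarrow>
        indep_vars (\<lambda>_. borel) (\<lambda>k \<omega>. B (\<tau> (Suc k)) \<omega> - B (\<tau> k) \<omega>) UNIV"
    and gaussian_increments:
      "\<And>s t. 0 \<le> s \<Longrightarrow> s < t \<Longrightarrow>
        distributed M lborel (\<lambda>\<omega>. B t \<omega> - B s \<omega>)
          (\<lambda>z. ennreal (\<Prod>i\<in>UNIV. normal_density 0 (sqrt (t - s)) (z $ i)))"

text \<open>\<open>P x\<close> is the law under which the process starts at \<open>x\<close>; its integral is \<open>\<bbbE>\<^sub>x\<close>.\<close>

definition brownian_family ::
    "(real ^ 'n \<Rightarrow> 'w measure) \<Rightarrow> (real \<Rightarrow> 'w \<Rightarrow> real ^ 'n) \<Rightarrow> bool" where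
  "brownian_family P B \<longleftrightarrow> (\<forall>x. brownian_motion (P x) B x)"

definition admissible_potential :: "(real ^ 'n \<Rightarrow> real) \<Rightarrow> bool" where
  "admissible_potential V \<longleftrightarrow>
     V \<in> borel_measurable borel \<and> (\<forall>r. bounded (V ` cball 0 r)) \<and> bdd_below (range V)"

definition schroedinger_semigroup ::
    "(real ^ 'n \<Rightarrow> 'w measure) \<Rightarrow> (real \<Rightarrow> 'w \<Rightarrow> real ^ 'n) \<Rightarrow> (real ^ 'n \<Rightarrow> real) \<Rightarrow>
     real \<Rightarrow> (real ^ 'n \<Rightarrow> real) \<Rightarrow> real ^ 'n \<Rightarrow> real" where
  "schroedinger_semigroup P B V t f x =
     (\<integral>\<omega>. f (B t \<omega>) * exp (- (LINT s:{0..t}|lborel. V (B s \<omega>))) \<partial>P x)"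

definition heat_kernel ::
    "(real ^ 'n \<Rightarrow> 'w measure) \<Rightarrow> (real \<Rightarrow> 'w \<Rightarrow> real ^ 'n) \<Rightarrow> (real ^ 'n \<Rightarrow> real) \<Rightarrow>
     (real \<Rightarrow> real ^ 'n \<Rightarrow> real ^ 'n \<Rightarrow> real) \<Rightarrow> bool" where
  "heat_kernel P B V p \<longleftrightarrow>
     continuous_on ({0<..} \<times> UNIV \<times> UNIV) (\<lambda>(t, x, y). p t x y) \<and>
     (\<forall>f t x. continuous_on UNIV f \<and> bounded (range f) \<and> 0 < t \<longrightarrow>
        has_bochner_integral lborel (\<lambda>y. p t x y * f y) (schroedinger_semigroup P B V t f x))"

definition potential_N :: "real \<Rightarrow> real \<Rightarrow> real \<Rightarrow> (real ^ 'n \<Rightarrow> real) \<Rightarrow> bool" where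
  "potential_N \<alpha> K1 K2 V \<longleftrightarrow>
     0 < \<alpha> \<and> 0 < K1 \<and> K1 \<le> K2 \<and>
     (\<forall>x. - K2 * (1 + norm x) powr (- \<alpha>) \<le> V x \<and> V x \<le> - K1 * (1 + norm x) powr (- \<alpha>))"

definition estimate_E :: "real \<Rightarrow> (real \<Rightarrow> real ^ 'n \<Rightarrow> real ^ 'n \<Rightarrow> real) \<Rightarrow> bool" where
  "estimate_E \<alpha> p \<longleftrightarrow>
     (\<exists>C1>0. \<exists>C2>0. \<exists>C3>0. \<exists>C4>0. \<exists>C5>0. \<exists>C6>0. \<exists>C7>0. \<exists>C8>0.
        \<forall>x y. \<forall>t>0. let m = 1 + min (norm x) (norm y) in
          C1 * t powr (- real CARD('n) / 2) * exp (- (C2 * (norm (x - y))\<^sup>2 / t)) *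
            exp (max (C3 * t / m powr \<alpha>) (C3 * t - C4 * m\<^sup>2 / t)) \<le> p t x y \<and>
          p t x y \<le> C5 * t powr (- real CARD('n) / 2) * exp (- (C6 * (norm (x - y))\<^sup>2 / t)) *
            exp (max (C7 * t / m powr \<alpha>) (C7 * t - C8 * m\<^sup>2 / t)))"

definition two_sided_gaussian :: "(real \<Rightarrow> real ^ 'n \<Rightarrow> real ^ 'n \<Rightarrow> real) \<Rightarrow> bool" where
  "two_sided_gaussian p \<longleftrightarrow>
     (\<exists>c1>0. \<exists>c2>0. \<exists>c3>0. \<exists>c4>0. \<forall>x y. \<forall>t>0.
        c1 * t powr (- real CARD('n) / 2) * exp (- (c2 * (norm (x - y))\<^sup>2 / t)) \<le> p t x y \<and>
        p t x y \<le> c3 * t powr (- real CARD('n) / 2) * exp (- (c4 * (norm (x - y))\<^sup>2 / t)))"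

end

theory Submission
  imports Defs
begin

text \<open>
With \<open>w(x) = (1 + |x|)\<^sup>-\<^sup>\<alpha>\<close>, the hypothesis on \<open>V\<close> says \<open>K\<^sub>1 w \<le> - V \<le> K\<^sub>2 w\<close>.  The Feynman-Kac
functional is monotone in the potential, so the kernel lies between those of the continuous
potentials \<open>- K\<^sub>1 w\<close> and \<open>- K\<^sub>2 w\<close>.  For a continuous \<open>g \<ge> 0\<close> the time integral along a path is a
limit of Riemann sums, and independence of increments turns the expectation of the discretised
functional into an iterate of one positive operator, \<open>f \<mapsto> e\<^sup>h\<^sup>g \<cdot> (heat flow for time h)\<close>
(\<open>fk_step\<close>, \<open>fk_iter_eq_expectation\<close>, \<open>fk_iter_tendsto\<close>).  Every estimate is therefore proved for
iterates \<open>(fk_step (t/n) g)\<^sup>n f\<close> with constants that do not depend on \<open>n\<close>, and is carried to the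
heat kernel by testing against bump functions and using continuity (\<open>heat_kernel_le\<close>,
\<open>heat_kernel_ge\<close>).

Upper half of (E).  The trivial bound \<open>p \<le> e\<^sup>K\<^sup>t p\<^sub>0\<close>, with \<open>p\<^sub>0\<close> the Gaussian kernel, suffices when
\<open>m \<lesssim> t\<close>.  Otherwise \<open>g \<le> C m\<^sup>-\<^sup>\<alpha> + K 1\<^sub>A\<close> with \<open>A\<close> the ball of radius \<open>m/2\<close> about the origin.  One
Duhamel expansion in \<open>K 1\<^sub>A\<close> costs a factor at most \<open>K t e\<^sup>K\<^sup>t\<close>, and reaching \<open>A\<close> from a point at
distance at least \<open>m/4\<close> costs \<open>exp (- m\<^sup>2 / (64 t))\<close>, which absorbs that factor
(\<open>fk_iter_far_core_le\<close>, \<open>heat_kernel_upper_estimate\<close>).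

Lower half of (E).  Fix a ball of radius \<open>R\<close> about \<open>a\<close>.  During a time of order \<open>R\<^sup>2\<close> the heat flow
returns to the ball with a probability bounded below, and the potential contributes a factor of
order \<open>R\<^sup>2 K\<^sub>1 (1 + |a| + R)\<^sup>-\<^sup>\<alpha>\<close>.  When this number exceeds a constant depending on the dimension
only, each such time block gains a factor \<open>e\<close>.  Travelling from \<open>x\<close> to the ball, staying there,
and travelling on to \<open>y\<close>, each for time \<open>t/3\<close>, gives
\<open>p(t,x,y) \<ge> c t\<^sup>-\<^sup>d\<^sup>/\<^sup>2 exp (- 3 (|x - a|\<^sup>2 + |y - a|\<^sup>2) / t + t / (12 R\<^sup>2))\<close> (\<open>heat_kernel_ge_staying\<close>).
For \<open>\<alpha> < 2\<close> the choices \<open>R = S m\<^sup>\<alpha>\<^sup>/\<^sup>2\<close> about the endpoint closer to the origin and \<open>R = S\<close> about the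
origin itself, with \<open>S\<close> large, give the two terms of the maximum.  For \<open>\<alpha> \<ge> 2\<close> a large \<open>K\<^sub>1\<close> makes
\<open>R = 1\<close> admissible at the origin, and the term \<open>t / m\<^sup>\<alpha>\<close> is either bounded or dominated by the
other one.

Small potentials, \<open>d \<ge> 3\<close>.  For \<open>2 < \<beta> < 3\<close> the average of \<open>(1 + |z|)\<^sup>-\<^sup>\<beta>\<close> under a Gaussian law of
variance \<open>v\<close> is at most \<open>C (1 + v)\<^sup>-\<^sup>\<beta>\<^sup>/\<^sup>2\<close>, uniformly in its mean.  A Brownian bridge of length \<open>t\<close> has
variance \<open>s (t - s) / t\<close> at time \<open>s\<close>, and \<open>\<beta>/2 > 1\<close>, so the expected integral of \<open>w\<close> along the
bridge is bounded uniformly in \<open>t\<close> and the endpoints.  For a small coupling constant the Duhamel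
expansion then closes up, as in Khasminskii's lemma, and \<open>p \<le> 2 p\<^sub>0\<close> (\<open>fk_iter_le_twice_heat\<close>).
\<close>

section \<open>Gaussian kernels and the heat flow\<close>

definition gauss :: "real \<Rightarrow> real ^ 'n \<Rightarrow> real" where
  "gauss s z = (2 * pi * s) powr (- real CARD('n) / 2) * exp (- (norm z)\<^sup>2 / (2 * s))"

lemma gauss_nonneg [simp]: "0 \<le> gauss s z"
  by (simp add: gauss_def)

lemma gauss_measurable [measurable]: "gauss s \<in> borel_measurable borel"
  unfolding gauss_def[abs_def] by measurable

lemma gauss_minus_commute: "gauss s (y - z) = gauss s (z - y)"
  by (simp add: gauss_def norm_minus_commute)

lemma gauss_eq:
  fixes z :: "real ^ 'n"
  assumes "0 < t"
  shows "gauss t z = (2 * pi) powr (- real CARD('n) / 2) * t powr (- real CARD('n) / 2) * exp (- (1 / 2 * (norm z)\<^sup>2 / t))"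
  using assms by (simp add: gauss_def powr_mult)

lemma gauss_continuous [continuous_intros]: "continuous_on S (\<lambda>y. gauss s (y - x))"
proof (cases "s = 0")
  case False
  then show ?thesis unfolding gauss_def by (intro continuous_intros) auto
qed (simp add: gauss_def)

text \<open>
Doubling the time leaves a spare Gaussian factor; it pays for excursions to distant sets.
\<close>

lemma gauss_double:
  fixes z :: "real ^ 'n"
  assumes "0 < s"
  shows "gauss s z = 2 powr (real CARD('n) / 2) * exp (- (norm z)\<^sup>2 / (4 * s)) * gauss (2 * s) z"
proof -
  have "(2 * pi * (2 * s)) powr (- real CARD('n) / 2) = 2 powr (- real CARD('n) / 2) * (2 * pi * s) powr (- real CARD('n) / 2)"
    using assms by (subst powr_mult[symmetric]) (auto simp: mult_ac)
  moreover have "(2::real) powr (real CARD('n) / 2) * 2 powr (- real CARD('n) / 2) = 1"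
    by (simp add: powr_add[symmetric])
  ultimately have 1: "2 powr (real CARD('n) / 2) * (2 * pi * (2 * s)) powr (- real CARD('n) / 2) = (2 * pi * s) powr (- real CARD('n) / 2)"
    by (simp only: mult.assoc[symmetric] mult_1)
  have 2: "exp (- (norm z)\<^sup>2 / (4 * s)) * exp (- (norm z)\<^sup>2 / (2 * (2 * s))) = exp (- (norm z)\<^sup>2 / (2 * s))"
    unfolding exp_add[symmetric] using assms by (intro arg_cong[where f=exp]) (simp add: field_simps)
  show ?thesis unfolding gauss_def 1[symmetric] 2[symmetric] by (simp only: mult_ac)
qed

lemma gauss_le:
  fixes z :: "real ^ 'n"
  assumes "0 < t" "t \<le> s" "s \<le> 2 * t"
  shows "gauss s z \<le> t powr (- real CARD('n) / 2) * exp (- (1 / 4 * (norm z)\<^sup>2 / t))"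
proof -
  have "t * 1 \<le> s * (2 * pi)" using assms pi_gt3 by (intro mult_mono) auto
  then have "(2 * pi * s) powr (- real CARD('n) / 2) \<le> t powr (- real CARD('n) / 2)"
    using assms by (intro powr_mono2') (auto simp: mult_ac)
  moreover have "1 / 4 * (norm z)\<^sup>2 / t \<le> (norm z)\<^sup>2 / (2 * s)"
  proof -
    have "(norm z)\<^sup>2 / (4 * t) \<le> (norm z)\<^sup>2 / (2 * s)" using assms by (intro divide_left_mono) auto
    then show ?thesis by simp
  qed
  ultimately show ?thesis unfolding gauss_def by (intro mult_mono) auto
qed

lemma prod_normal_density:
  fixes z :: "real ^ 'n"
  assumes "0 < s"
  shows "(\<Prod>i\<in>UNIV. normal_density 0 (sqrt s) (z $ i)) = gauss s z"
proof -
  have "(\<Prod>i\<in>UNIV. normal_density 0 (sqrt s) (z $ i))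
      = (\<Prod>i\<in>(UNIV::'n set). (2 * pi * s) powr (-1/2) * exp (- (z $ i)\<^sup>2 / (2 * s)))"
  proof (rule prod.cong)
    fix i
    have "(2 * pi * s) powr (-1/2) = 1 / sqrt (2 * pi * s)"
      using assms powr_minus_divide[of "2 * pi * s" "1/2"] by (simp add: powr_half_sqrt)
    then show "normal_density 0 (sqrt s) (z $ i) = (2 * pi * s) powr (-1/2) * exp (- (z $ i)\<^sup>2 / (2 * s))"
      using assms unfolding normal_density_def by simp
  qed simp
  also have "\<dots> = ((2 * pi * s) powr (-1/2)) ^ CARD('n) * exp (\<Sum>i\<in>(UNIV::'n set). - (z $ i)\<^sup>2 / (2 * s))"
    by (simp add: prod.distrib exp_sum)
  also have "((2 * pi * s) powr (-1/2)) ^ CARD('n) = (2 * pi * s) powr (- real CARD('n) / 2)"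
    using assms by (simp add: powr_realpow[symmetric] powr_powr)
  also have "(\<Sum>i\<in>(UNIV::'n set). - (z $ i)\<^sup>2 / (2 * s)) = - (norm z)\<^sup>2 / (2 * s)"
    unfolding power2_norm_eq_inner inner_vec_def
    by (simp add: sum_divide_distrib sum_negf power2_eq_square)
  finally show ?thesis by (simp add: gauss_def)
qed

text \<open>
The bridge decomposition.  Conditioned on its endpoints \<open>x\<close> and \<open>y\<close>, Brownian motion run for time
\<open>s + r\<close> is Gaussian at time \<open>s\<close>, with mean on the segment from \<open>x\<close> to \<open>y\<close> and variance
\<open>s r / (s + r)\<close>; completing the square shows this.  Both the semigroup law and the uniform bounds
for small potentials rest on it.
\<close>

lemma gauss_product:
  fixes x y z :: "real ^ 'n"
  assumes "0 < s" "0 < r"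
  shows "gauss s (z - x) * gauss r (y - z)
    = gauss (s + r) (y - x) * gauss (s * r / (s + r)) (z - ((r / (s + r)) *\<^sub>R x + (s / (s + r)) *\<^sub>R y))"
proof -
  define a b where "a = z - x" and "b = y - z"
  have sr: "s + r \<noteq> 0" using assms by simp
  have 1: "z - ((r / (s + r)) *\<^sub>R x + (s / (s + r)) *\<^sub>R y) = (r / (s + r)) *\<^sub>R a - (s / (s + r)) *\<^sub>R b"
  proof -
    have "(r / (s + r)) *\<^sub>R z + (s / (s + r)) *\<^sub>R z = z"
      using sr by (simp add: scaleR_add_left[symmetric] add_divide_distrib[symmetric] add.commute)
    then show ?thesis by (simp add: a_def b_def algebra_simps)
  qed
  have 2: "y - x = a + b" by (simp add: a_def b_def)
  have "(norm a)\<^sup>2 / (2 * s) + (norm b)\<^sup>2 / (2 * r)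
      = (norm (a + b))\<^sup>2 / (2 * (s + r))
        + (norm ((r / (s + r)) *\<^sub>R a - (s / (s + r)) *\<^sub>R b))\<^sup>2 / (2 * (s * r / (s + r)))"
  proof -
    define A B C where "A = a \<bullet> a" and "B = b \<bullet> b" and "C = a \<bullet> b"
    have e1: "(norm (a + b))\<^sup>2 = A + 2 * C + B"
      by (simp add: A_def B_def C_def power2_norm_eq_inner inner_add inner_commute)
    have e2: "(norm ((r / (s + r)) *\<^sub>R a - (s / (s + r)) *\<^sub>R b))\<^sup>2 = (r\<^sup>2 * A - 2 * r * s * C + s\<^sup>2 * B) / (s + r)\<^sup>2"
    proof -
      define k where "k = inverse (s + r)"
      have "(norm ((r / (s + r)) *\<^sub>R a - (s / (s + r)) *\<^sub>R b))\<^sup>2 = (norm ((r * k) *\<^sub>R a - (s * k) *\<^sub>R b))\<^sup>2"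
        by (simp add: k_def divide_inverse)
      also have "\<dots> = (r\<^sup>2 * A - 2 * r * s * C + s\<^sup>2 * B) * k\<^sup>2"
        unfolding power2_norm_eq_inner
        by (simp add: A_def B_def C_def inner_diff inner_commute[of b a] power2_eq_square algebra_simps)
      finally show ?thesis by (simp add: k_def divide_inverse power_inverse)
    qed
    have e3: "(norm a)\<^sup>2 = A" "(norm b)\<^sup>2 = B"
      by (simp_all add: A_def B_def power2_norm_eq_inner)
    have e4: "A / (2 * s) + B / (2 * r) = (A + 2 * C + B) / (2 * (s + r))
        + ((r\<^sup>2 * A - 2 * r * s * C + s\<^sup>2 * B) / (s + r)\<^sup>2) / (2 * (s * r / (s + r)))"
    proof -
      define T where "T = s + r"
      have T: "T \<noteq> 0" using sr by (simp add: T_def)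
      have "((r\<^sup>2 * A - 2 * r * s * C + s\<^sup>2 * B) / T\<^sup>2) / (2 * (s * r / T))
          = (r\<^sup>2 * A - 2 * r * s * C + s\<^sup>2 * B) / (2 * T * (s * r))"
        using T by (simp add: power2_eq_square)
      moreover have "(A + 2 * C + B) / (2 * T) = ((A + 2 * C + B) * (s * r)) / (2 * T * (s * r))"
        using assms by simp
      ultimately have "(A + 2 * C + B) / (2 * (s + r))
        + ((r\<^sup>2 * A - 2 * r * s * C + s\<^sup>2 * B) / (s + r)\<^sup>2) / (2 * (s * r / (s + r)))
        = ((A + 2 * C + B) * (s * r) + (r\<^sup>2 * A - 2 * r * s * C + s\<^sup>2 * B)) / (2 * (s + r) * (s * r))"
        unfolding T_def by (simp only: add_divide_distrib)
      also have "(A + 2 * C + B) * (s * r) + (r\<^sup>2 * A - 2 * r * s * C + s\<^sup>2 * B) = (s + r) * (A * r + B * s)"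
        by (simp add: algebra_simps power2_eq_square)
      also have "(s + r) * (A * r + B * s) / (2 * (s + r) * (s * r)) = (A * r + B * s) / (2 * (s * r))"
        using mult_divide_mult_cancel_left[OF sr, of "A * r + B * s" "2 * (s * r)"] by (simp only: mult_ac)
      also have "\<dots> = A / (2 * s) + B / (2 * r)"
        using assms by (simp add: field_simps)
      finally show ?thesis ..
    qed
    show ?thesis unfolding e1 e2 e3 by (rule e4)
  qed
  then have 3: "exp (- (norm a)\<^sup>2 / (2 * s)) * exp (- (norm b)\<^sup>2 / (2 * r))
      = exp (- (norm (a + b))\<^sup>2 / (2 * (s + r)))
        * exp (- (norm ((r / (s + r)) *\<^sub>R a - (s / (s + r)) *\<^sub>R b))\<^sup>2 / (2 * (s * r / (s + r))))"
    unfolding exp_add[symmetric] by (intro arg_cong[where f=exp]) linarith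
  have 4: "(2 * pi * s) powr q * (2 * pi * r) powr q = (2 * pi * (s + r)) powr q * (2 * pi * (s * r / (s + r))) powr q" for q
  proof -
    have "(2 * pi * s) * (2 * pi * r) = (2 * pi * (s + r)) * (2 * pi * (s * r / (s + r)))"
      using sr by simp
    then show ?thesis using assms by (metis powr_mult)
  qed
  define q where "q = - real CARD('n) / 2"
  have swap: "(c1 * e1) * (c2 * e2) = (c1 * c2) * (e1 * e2)" for c1 c2 e1 e2 :: real
    by (simp only: mult_ac)
  show ?thesis
    unfolding 1 2 a_def[symmetric] b_def[symmetric] gauss_def q_def[symmetric]
    unfolding swap 3 4[of q] ..
qed

lemma nn_integral_lborel_vec_prod:
  fixes f :: "'n::finite \<Rightarrow> real \<Rightarrow> ennreal"
  assumes [measurable]: "\<And>i. f i \<in> borel_measurable borel"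
  shows "(\<integral>\<^sup>+z. (\<Prod>i\<in>UNIV. f i (z $ i)) \<partial>lborel) = (\<Prod>i\<in>UNIV. \<integral>\<^sup>+u. f i u \<partial>lborel)"
proof -
  \<comment> \<open>\<open>SOME\<close> recovers the coordinate from the standard basis vector.\<close>
  define g :: "real ^ 'n \<Rightarrow> real \<Rightarrow> ennreal" where "g b = f (SOME i. b = axis i 1)" for b
  have ax: "(SOME k. axis i (1::real) = axis k 1) = i" for i :: 'n
    by (rule some_equality) (auto simp: axis_eq_axis)
  have B: "(Basis :: (real ^ 'n) set) = range (\<lambda>i. axis i 1)" by (auto simp: Basis_vec_def)
  have inj: "inj (\<lambda>i. axis i (1::real) :: real ^ 'n)" by (auto simp: inj_on_def axis_eq_axis)
  have "(\<integral>\<^sup>+z. (\<Prod>b\<in>Basis. g b (z \<bullet> b)) \<partial>lborel) = (\<Prod>b\<in>Basis. \<integral>\<^sup>+u. g b u \<partial>lborel)"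
    by (rule nn_integral_lborel_prod) (auto simp: g_def)
  then show ?thesis
    unfolding B prod.reindex[OF inj] by (simp add: g_def ax inner_axis)
qed

lemma nn_integral_gauss_prod:
  fixes m :: "real ^ 'n"
  assumes "0 < v" and [measurable]: "\<phi> \<in> borel_measurable borel"
  shows "(\<integral>\<^sup>+z. ennreal (gauss v (z - m)) * (\<Prod>i\<in>UNIV. \<phi> (z $ i)) \<partial>lborel)
    = (\<Prod>i\<in>UNIV. \<integral>\<^sup>+u. ennreal (normal_density (m $ i) (sqrt v) u) * \<phi> u \<partial>lborel)"
proof -
  have "ennreal (gauss v (z - m)) * (\<Prod>i\<in>UNIV. \<phi> (z $ i))
      = (\<Prod>i\<in>UNIV. ennreal (normal_density (m $ i) (sqrt v) (z $ i)) * \<phi> (z $ i))" for z :: "real ^ 'n"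
  proof -
    have "gauss v (z - m) = (\<Prod>i\<in>UNIV. normal_density (m $ i) (sqrt v) (z $ i))"
      unfolding prod_normal_density[OF assms(1), symmetric] by (simp add: normal_density_def)
    then show ?thesis by (simp add: prod.distrib prod_ennreal)
  qed
  then show ?thesis
    using nn_integral_lborel_vec_prod[of "\<lambda>i u. ennreal (normal_density (m $ i) (sqrt v) u) * \<phi> u"] by simp
qed

lemma nn_integral_gauss: "0 < v \<Longrightarrow> (\<integral>\<^sup>+z. ennreal (gauss v (z - m)) \<partial>lborel) = 1"
  for m :: "real ^ 'n"
proof -
  assume v: "0 < v"
  have "(\<integral>\<^sup>+u. ennreal (normal_density a (sqrt v) u) \<partial>lborel) = 1" for a
    using v prob_space.emeasure_space_1[OF prob_space_normal_density[of "sqrt v" a]]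
    by (simp add: emeasure_density)
  with nn_integral_gauss_prod[OF v, of "\<lambda>_. 1" m] show ?thesis by simp
qed

text \<open>
The value at time \<open>0\<close> is set to be \<open>f\<close>, so that the semigroup law holds for all nonnegative times
and sums over discrete times need no separate first term.  Values in \<open>ennreal\<close> dispense with
integrability conditions.
\<close>

definition heat :: "real \<Rightarrow> (real ^ 'n \<Rightarrow> ennreal) \<Rightarrow> real ^ 'n \<Rightarrow> ennreal" where
  "heat s f x = (if s = 0 then f x else \<integral>\<^sup>+y. ennreal (gauss s (y - x)) * f y \<partial>lborel)"

lemma heat_0 [simp]: "heat 0 f = f"
  by (simp add: heat_def fun_eq_iff)

lemma heat_pos: "0 < s \<Longrightarrow> heat s f x = (\<integral>\<^sup>+y. ennreal (gauss s (y - x)) * f y \<partial>lborel)"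
  by (simp add: heat_def)

lemma heat_measurable [measurable]:
  assumes [measurable]: "f \<in> borel_measurable borel"
  shows "heat s f \<in> borel_measurable borel"
proof (cases "s = 0")
  case False
  have "(\<lambda>x. \<integral>\<^sup>+y. ennreal (gauss s (y - x)) * f y \<partial>lborel) \<in> borel_measurable borel"
    by measurable
  with False show ?thesis by (simp add: heat_def[abs_def])
qed simp

lemma heat_mono: "(\<And>y. f y \<le> g y) \<Longrightarrow> heat s f x \<le> heat s g x"
  by (auto simp: heat_def intro!: nn_integral_mono mult_left_mono)

lemma heat_cong: "s = s' \<Longrightarrow> (\<And>y. f y = g y) \<Longrightarrow> heat s f x = heat s' g x"
  by presburger

lemma heat_as_kernel:
  assumes "0 < s" "0 \<le> c" and [measurable]: "f \<in> borel_measurable borel"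
  shows "ennreal c * heat s f x = (\<integral>\<^sup>+y. ennreal (c * gauss s (y - x)) * f y \<partial>lborel)"
  using assms by (simp add: heat_pos nn_integral_cmult[symmetric] ennreal_mult mult.assoc)

lemma heat_add:
  assumes [measurable]: "f \<in> borel_measurable borel" "g \<in> borel_measurable borel"
  shows "heat s (\<lambda>y. f y + g y) x = heat s f x + heat s g x"
  by (simp add: heat_def distrib_left nn_integral_add)

lemma heat_cmult:
  assumes [measurable]: "f \<in> borel_measurable borel"
  shows "heat s (\<lambda>y. c * f y) x = c * heat s f x"
  by (simp add: heat_def mult.left_commute[of _ c] nn_integral_cmult)

lemma heat_sum:
  assumes "finite I" "\<And>i. i \<in> I \<Longrightarrow> f i \<in> borel_measurable borel"
  shows "heat s (\<lambda>y. \<Sum>i\<in>I. f i y) x = (\<Sum>i\<in>I. heat s (f i) x)"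
  using assms
proof (induction I rule: finite_induct)
  case empty
  then show ?case by (simp add: heat_def)
next
  case (insert a I)
  have [measurable]: "f a \<in> borel_measurable borel" "(\<lambda>y. \<Sum>i\<in>I. f i y) \<in> borel_measurable borel"
    using insert.prems by (auto intro!: borel_measurable_sum)
  show ?case using insert by (simp add: heat_add)
qed

text \<open>
After Fubini and the bridge decomposition a weight inserted at an intermediate time becomes its
average over the bridge.
\<close>

lemma heat_weight_heat:
  fixes f :: "real ^ 'n \<Rightarrow> ennreal"
  assumes s: "0 < s" "0 < r" and [measurable]: "f \<in> borel_measurable borel" "\<phi> \<in> borel_measurable borel"
  shows "heat s (\<lambda>z. \<phi> z * heat r f z) x = (\<integral>\<^sup>+y. ennreal (gauss (s + r) (y - x)) * f y *
     (\<integral>\<^sup>+z. ennreal (gauss (s * r / (s + r)) (z - ((r / (s + r)) *\<^sub>R x + (s / (s + r)) *\<^sub>R y))) * \<phi> z \<partial>lborel) \<partial>lborel)"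
proof -
  have "heat s (\<lambda>z. \<phi> z * heat r f z) x
      = (\<integral>\<^sup>+z. \<integral>\<^sup>+y. ennreal (gauss s (z - x)) * \<phi> z * (ennreal (gauss r (y - z)) * f y) \<partial>lborel \<partial>lborel)"
    using s by (simp add: heat_def mult.assoc nn_integral_cmult)
  also have "\<dots> = (\<integral>\<^sup>+y. \<integral>\<^sup>+z. ennreal (gauss s (z - x)) * \<phi> z * (ennreal (gauss r (y - z)) * f y) \<partial>lborel \<partial>lborel)"
    by (rule lborel_pair.Fubini') measurable
  also have "\<dots> = (\<integral>\<^sup>+y. ennreal (gauss (s + r) (y - x)) * f y *
     (\<integral>\<^sup>+z. ennreal (gauss (s * r / (s + r)) (z - ((r / (s + r)) *\<^sub>R x + (s / (s + r)) *\<^sub>R y))) * \<phi> z \<partial>lborel) \<partial>lborel)"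
  proof (rule nn_integral_cong)
    fix y :: "real ^ 'n"
    have "ennreal (gauss s (z - x)) * \<phi> z * (ennreal (gauss r (y - z)) * f y)
      = ennreal (gauss (s + r) (y - x)) * f y *
        (ennreal (gauss (s * r / (s + r)) (z - ((r / (s + r)) *\<^sub>R x + (s / (s + r)) *\<^sub>R y))) * \<phi> z)" for z
    proof -
      have swap: "(a * p) * (b * q) = (a * b) * (p * q)" "(a * q) * (b * p) = (a * b) * (p * q)" for a b p q :: ennreal
        by (simp_all only: mult_ac)
      have "ennreal (gauss s (z - x)) * ennreal (gauss r (y - z)) = ennreal (gauss (s + r) (y - x)) *
          ennreal (gauss (s * r / (s + r)) (z - ((r / (s + r)) *\<^sub>R x + (s / (s + r)) *\<^sub>R y)))"
        by (simp only: ennreal_mult[symmetric] gauss_nonneg gauss_product[OF s])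
      then show ?thesis unfolding swap(1)[of _ "\<phi> z"] swap(2)[of _ "f y"] by simp
    qed

    then show "(\<integral>\<^sup>+z. ennreal (gauss s (z - x)) * \<phi> z * (ennreal (gauss r (y - z)) * f y) \<partial>lborel)
      = ennreal (gauss (s + r) (y - x)) * f y *
     (\<integral>\<^sup>+z. ennreal (gauss (s * r / (s + r)) (z - ((r / (s + r)) *\<^sub>R x + (s / (s + r)) *\<^sub>R y))) * \<phi> z \<partial>lborel)"
      by (simp add: nn_integral_cmult)
  qed
  finally show ?thesis .
qed

lemma heat_heat:
  assumes s: "0 \<le> s" "0 \<le> r" and [measurable]: "f \<in> borel_measurable borel"
  shows "heat s (heat r f) x = heat (s + r) f x"
proof (cases "s = 0 \<or> r = 0")
  case True
  then show ?thesis by auto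
next
  case False
  with s have s: "0 < s" "0 < r" by auto
  then have "0 < s * r / (s + r)" by simp
  with heat_weight_heat[OF s, of f "\<lambda>_. 1" x] s show ?thesis
    by (simp add: nn_integral_gauss heat_pos)
qed

section \<open>Discrete Feynman-Kac iterates\<close>

text \<open>
One step of the splitting scheme for \<open>exp (t (\<Delta>/2 + g))\<close> with step length \<open>h\<close>.
\<close>

definition fk_step :: "real \<Rightarrow> (real ^ 'n \<Rightarrow> real) \<Rightarrow> (real ^ 'n \<Rightarrow> ennreal) \<Rightarrow> real ^ 'n \<Rightarrow> ennreal" where
  "fk_step h g f x = ennreal (exp (h * g x)) * heat h f x"

lemma fk_iter_Suc:
  "(fk_step h g ^^ Suc n) f x = ennreal (exp (h * g x)) * heat h ((fk_step h g ^^ n) f) x"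
  by (simp add: fk_step_def)

lemma fk_step_measurable [measurable]:
  assumes [measurable]: "f \<in> borel_measurable borel" "g \<in> borel_measurable borel"
  shows "fk_step h g f \<in> borel_measurable borel"
  unfolding fk_step_def[abs_def] by measurable

lemma fk_iter_measurable [measurable]:
  assumes [measurable]: "f \<in> borel_measurable borel" "g \<in> borel_measurable borel"
  shows "(fk_step h g ^^ n) f \<in> borel_measurable borel"
  by (induction n) auto

lemma fk_step_mono:
  assumes "\<And>y. f y \<le> f' y" "0 \<le> h" "\<And>y. g y \<le> g' y"
  shows "fk_step h g f x \<le> fk_step h g' f' x"
  unfolding fk_step_def using assms by (intro mult_mono heat_mono ennreal_leI) (auto intro: mult_left_mono)

lemma fk_iter_mono:
  assumes "\<And>y. f y \<le> f' y" "0 \<le> h" "\<And>y. g y \<le> g' y"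
  shows "(fk_step h g ^^ n) f x \<le> (fk_step h g' ^^ n) f' x"
  using assms by (induction n arbitrary: x) (auto intro: fk_step_mono)

text \<open>
A constant in the potential factors out, so a potential of known size off a small set may be
reduced to one supported in that set.
\<close>

lemma fk_iter_add_const:
  fixes f :: "real ^ 'n \<Rightarrow> ennreal"
  assumes [measurable]: "f \<in> borel_measurable borel" "g \<in> borel_measurable borel"
  shows "(fk_step h (\<lambda>y. c + g y) ^^ n) f x = ennreal (exp (c * (real n * h))) * (fk_step h g ^^ n) f x"
proof (induction n arbitrary: x)
  case 0
  then show ?case by simp
next
  case (Suc n)
  have "(fk_step h (\<lambda>y. c + g y) ^^ Suc n) f x
      = ennreal (exp (h * (c + g x))) * (ennreal (exp (c * (real n * h))) * heat h ((fk_step h g ^^ n) f) x)"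
    unfolding fk_iter_Suc by (simp add: heat_cmult Suc cong: heat_cong)
  also have "\<dots> = ennreal (exp (h * (c + g x)) * exp (c * (real n * h))) * heat h ((fk_step h g ^^ n) f) x"
    by (simp add: ennreal_mult mult.assoc)
  also have "exp (h * (c + g x)) * exp (c * (real n * h)) = exp (c * (real (Suc n) * h)) * exp (h * g x)"
    by (simp add: exp_add[symmetric] algebra_simps)
  finally show ?case unfolding fk_iter_Suc by (simp add: ennreal_mult mult.assoc)
qed

lemma heat_le_fk_iter:
  assumes "0 \<le> h" "\<And>y. 0 \<le> g y" and [measurable]: "f \<in> borel_measurable borel"
  shows "heat (real n * h) f x \<le> (fk_step h g ^^ n) f x"
proof (induction n arbitrary: x)
  case 0
  then show ?case by simp
next
  case (Suc n)
  have "heat (real (Suc n) * h) f x = 1 * heat h (heat (real n * h) f) x"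
    using assms by (simp add: heat_heat algebra_simps)
  also have "\<dots> \<le> ennreal (exp (h * g x)) * heat h ((fk_step h g ^^ n) f) x"
    using Suc assms by (intro mult_mono heat_mono) auto
  finally show ?case unfolding fk_iter_Suc .
qed

lemma fk_iter_le_exp_heat:
  assumes "0 \<le> h" "\<And>y. g y \<le> K" and [measurable]: "f \<in> borel_measurable borel" "g \<in> borel_measurable borel"
  shows "(fk_step h g ^^ n) f x \<le> ennreal (exp (K * (real n * h))) * heat (real n * h) f x"
proof -
  have 0: "(fk_step h (\<lambda>y. 0) ^^ n) f x = heat (real n * h) f x" for n x
  proof (induction n arbitrary: x)
    case (Suc n)
    then show ?case using assms unfolding fk_iter_Suc
      by (simp add: heat_heat algebra_simps cong: heat_cong)
  qed simp
  have "(fk_step h g ^^ n) f x \<le> (fk_step h (\<lambda>y. K + 0) ^^ n) f x"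
    using assms by (intro fk_iter_mono) auto
  then show ?thesis using fk_iter_add_const[where f=f and g="\<lambda>_. 0" and h=h and c=K and n=n and x=x] by (simp add: 0)
qed

text \<open>
Discrete Duhamel formula: split according to the first step \<open>k\<close> at which the potential acts, using
\<open>e\<^sup>h\<^sup>g \<le> 1 + h e\<^sup>h\<^sup>K g\<close>.  Before step \<open>k\<close> the flow is free, and from step \<open>k\<close> on the full iterate
appears, ready for an a priori bound or an induction hypothesis.
\<close>

lemma fk_iter_duhamel_le:
  assumes "0 \<le> h" "\<And>y. 0 \<le> g y" "\<And>y. g y \<le> K" "0 \<le> K"
    and [measurable]: "f \<in> borel_measurable borel" "g \<in> borel_measurable borel"
  shows "(fk_step h g ^^ n) f x \<le> heat (real n * h) f x
    + (\<Sum>k<n. heat (real k * h)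
        (\<lambda>z. ennreal (h * exp (h * K) * g z) * heat h ((fk_step h g ^^ (n - Suc k)) f) z) x)"
proof (induction n arbitrary: x)
  case 0
  then show ?case by simp
next
  case (Suc n)
  define Q where "Q j = (\<lambda>z. ennreal (h * exp (h * K) * g z) * heat h ((fk_step h g ^^ j) f) z)" for j
  have [measurable]: "Q j \<in> borel_measurable borel" for j unfolding Q_def by measurable
  have e: "exp (h * g x) \<le> 1 + h * exp (h * K) * g x"
  proof -
    have "1 - exp (- (h * g x)) \<le> h * g x" using exp_ge_add_one_self[of "- (h * g x)"] by simp
    then have "exp (h * g x) * (1 - exp (- (h * g x))) \<le> exp (h * g x) * (h * g x)"
      by (intro mult_left_mono) auto
    also have "\<dots> \<le> exp (h * K) * (h * g x)"
      using assms by (intro mult_right_mono) (auto intro: mult_left_mono)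
    finally show ?thesis by (simp add: algebra_simps exp_minus)
  qed
  have "(fk_step h g ^^ Suc n) f x \<le> ennreal (1 + h * exp (h * K) * g x) * heat h ((fk_step h g ^^ n) f) x"
    using e unfolding fk_iter_Suc by (intro mult_right_mono ennreal_leI) auto
  also have "\<dots> = heat h ((fk_step h g ^^ n) f) x + Q n x"
    using assms by (simp add: Q_def distrib_right ennreal_plus del: ennreal_plus[symmetric])
  also have "heat h ((fk_step h g ^^ n) f) x
      \<le> heat h (\<lambda>y. heat (real n * h) f y + (\<Sum>k<n. heat (real k * h) (Q (n - Suc k)) y)) x"
    using Suc unfolding Q_def by (intro heat_mono) auto
  also have "\<dots> = heat (real (Suc n) * h) f x + (\<Sum>k<n. heat (real (Suc k) * h) (Q (n - Suc k)) x)"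
    using assms by (simp add: heat_add heat_sum heat_heat algebra_simps)
  also have "heat (real (Suc n) * h) f x + (\<Sum>k<n. heat (real (Suc k) * h) (Q (n - Suc k)) x) + Q n x
      = heat (real (Suc n) * h) f x + (\<Sum>k<Suc n. heat (real k * h) (Q (Suc n - Suc k)) x)"
    unfolding sum.lessThan_Suc_shift by (simp add: ac_simps)
  finally show ?case unfolding Q_def by (simp add: add_right_mono)
qed

text \<open>
The lower counterpart keeps only the terms in which the potential acts exactly once; this first
order gain is all that the lower bounds need, because it is amplified by iteration.
\<close>

lemma fk_iter_ge_duhamel:
  assumes "0 \<le> h" "\<And>y. 0 \<le> g y"
    and [measurable]: "f \<in> borel_measurable borel" "g \<in> borel_measurable borel"
  shows "(\<Sum>k<n. heat (real k * h) (\<lambda>z. ennreal (h * g z) * heat (real (n - k) * h) f z) x)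
    \<le> (fk_step h g ^^ n) f x"
proof (induction n arbitrary: x)
  case 0
  then show ?case by simp
next
  case (Suc n)
  define Q where "Q j = (\<lambda>z. ennreal (h * g z) * heat (real j * h) f z)" for j
  have [measurable]: "Q j \<in> borel_measurable borel" for j unfolding Q_def by measurable
  have "(\<Sum>k<Suc n. heat (real k * h) (Q (Suc n - k)) x)
      = Q (Suc n) x + (\<Sum>k<n. heat h (heat (real k * h) (Q (n - k))) x)"
    unfolding sum.lessThan_Suc_shift using assms by (simp add: heat_heat algebra_simps)
  also have "(\<Sum>k<n. heat h (heat (real k * h) (Q (n - k))) x)
      = heat h (\<lambda>y. \<Sum>k<n. heat (real k * h) (Q (n - k)) y) x"
    by (simp add: heat_sum)
  also have "\<dots> \<le> heat h ((fk_step h g ^^ n) f) x"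
    using Suc unfolding Q_def by (intro heat_mono) auto
  also have "Q (Suc n) x \<le> ennreal (h * g x) * heat h ((fk_step h g ^^ n) f) x"
  proof -
    have "heat (real (Suc n) * h) f x = heat h (heat (real n * h) f) x"
      using assms by (simp add: heat_heat algebra_simps)
    also have "\<dots> \<le> heat h ((fk_step h g ^^ n) f) x"
      using assms by (intro heat_mono heat_le_fk_iter) auto
    finally show ?thesis unfolding Q_def by (intro mult_left_mono) auto
  qed
  also have "ennreal (h * g x) * heat h ((fk_step h g ^^ n) f) x + heat h ((fk_step h g ^^ n) f) x
      = ennreal (1 + h * g x) * heat h ((fk_step h g ^^ n) f) x"
    using assms by (simp add: distrib_right add.commute)
  also have "\<dots> \<le> (fk_step h g ^^ Suc n) f x"
    using exp_ge_add_one_self[of "h * g x"] unfolding fk_iter_Suc by (intro mult_right_mono ennreal_leI) auto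
  finally show ?case unfolding Q_def by (simp add: add_mono)
qed

section \<open>Brownian expectations as limits of iterates\<close>

text \<open>
On each of the \<open>n\<close> pieces the integral differs from length times left endpoint value by at most
length times the modulus of continuity.
\<close>

lemma left_riemann_sum_tendsto:
  fixes u :: "real \<Rightarrow> real"
  assumes t: "0 < t" and u: "continuous_on {0..t} u"
  shows "(\<lambda>n. t / real n * (\<Sum>k<n. u (real k * (t / real n)))) \<longlonglongrightarrow> (LINT s:{0..t}|lborel. u s)"
proof -
  have I: "(LINT s:{0..t}|lborel. u s) = integral {0..t} u"
    using borel_integrable_atLeastAtMost'[OF u] by (rule set_borel_integral_eq_integral)
  show ?thesis
    unfolding I
  proof (rule LIMSEQ_I)
    fix e :: real assume e: "0 < e"
    define \<epsilon> where "\<epsilon> = e / (2 * t)"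
    have \<epsilon>: "0 < \<epsilon>" using e t by (simp add: \<epsilon>_def)
    obtain d where d: "0 < d" "\<And>a b. a \<in> {0..t} \<Longrightarrow> b \<in> {0..t} \<Longrightarrow> dist b a < d \<Longrightarrow> dist (u b) (u a) < \<epsilon>"
      using compact_uniformly_continuous[OF u compact_Icc] \<epsilon> unfolding uniformly_continuous_on_def by metis
    obtain N :: nat where N: "t / d < real N" using reals_Archimedean2 by blast
    have "norm (t / real n * (\<Sum>k<n. u (real k * (t / real n))) - integral {0..t} u) < e" if n: "n \<ge> N" for n
    proof -
      have npos: "0 < real n"
        using N n t d by (smt (verit) divide_pos_pos of_nat_mono)
      define h where "h = t / real n"
      have h: "0 < h" "h < d" "real n * h = t"
        using npos t N n d by (auto simp: h_def field_simps) (smt (verit) mult_left_mono of_nat_mono)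
      have "\<bar>h * (\<Sum>k<m. u (real k * h)) - integral {0..real m * h} u\<bar> \<le> \<epsilon> * (real m * h)" if "m \<le> n" for m
        using that
      proof (induction m)
        case 0
        then show ?case by simp
      next
        case (Suc m)
        have le: "real (Suc m) * h \<le> t"
          using Suc.prems h by (metis less_eq_real_def mult_right_mono of_nat_mono)
        have ab: "0 \<le> real m * h" "real m * h \<le> real (Suc m) * h" using h by (auto simp: algebra_simps)
        have c: "continuous_on {real m * h..real (Suc m) * h} u" "continuous_on {0..real (Suc m) * h} u"
          using le ab by (auto intro: continuous_on_subset[OF u])
        have "integral {0..real (Suc m) * h} u = integral {0..real m * h} u + integral {real m * h..real (Suc m) * h} u"
          using Henstock_Kurzweil_Integration.integral_combine[OF ab, of u] integrable_continuous_real[OF c(2)] by simp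
        moreover have "integral {real m * h..real (Suc m) * h} (\<lambda>s. u s - u (real m * h))
           = integral {real m * h..real (Suc m) * h} u - h * u (real m * h)"
          using integrable_continuous_real[OF c(1)] ab by (subst integral_diff) (auto simp: algebra_simps)
        moreover have "norm (integral {real m * h..real (Suc m) * h} (\<lambda>s. u s - u (real m * h)))
           \<le> \<epsilon> * (real (Suc m) * h - real m * h)"
        proof (rule integral_bound)
          fix s assume s: "s \<in> {real m * h..real (Suc m) * h}"
          then have "dist s (real m * h) < d" using h by (auto simp: dist_real_def algebra_simps)
          then have "dist (u s) (u (real m * h)) < \<epsilon>"
            using s ab le by (intro d(2)) auto
          then show "norm (u s - u (real m * h)) \<le> \<epsilon>" by (simp add: dist_real_def)
        qed (use c ab in \<open>auto intro!: continuous_intros\<close>)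
        ultimately show ?case using Suc by (simp add: algebra_simps abs_le_iff)
      qed
      from this[of n] have "\<bar>h * (\<Sum>k<n. u (real k * h)) - integral {0..t} u\<bar> \<le> \<epsilon> * t"
        using h by simp
      also have "\<epsilon> * t < e" using e t by (simp add: \<epsilon>_def)
      finally show ?thesis by (simp add: h_def)
    qed
    then show "\<exists>N. \<forall>n\<ge>N. norm (t / real n * (\<Sum>k<n. u (real k * (t / real n))) - integral {0..t} u) < e"
      by blast
  qed
qed

lemma heat_shift:
  fixes f :: "real ^ 'n \<Rightarrow> ennreal"
  assumes "0 < h" and [measurable]: "f \<in> borel_measurable borel"
  shows "heat h f a = (\<integral>\<^sup>+z. ennreal (gauss h z) * f (a + z) \<partial>lborel)"
proof -
  have "heat h f a = (\<integral>\<^sup>+y. ennreal (gauss h (y - a)) * f y \<partial>distr lborel borel ((+) a))"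
    using assms by (simp add: heat_pos lborel_distr_plus)
  also have "\<dots> = (\<integral>\<^sup>+z. ennreal (gauss h z) * f (a + z) \<partial>lborel)"
    by (subst nn_integral_distr) auto
  finally show ?thesis .
qed

context brownian_motion
begin

text \<open>
The next increment is independent of all earlier ones, so it may be integrated out first against
its Gaussian law.  This is the only Markov property that the argument uses.
\<close>

lemma increment_nn_integral:
  assumes h: "0 < h" and [measurable]: "F \<in> borel_measurable (PiM {..<n} (\<lambda>_. borel) \<Otimes>\<^sub>M lborel)"
  defines "D \<equiv> \<lambda>k \<omega>. B (real (Suc k) * h) \<omega> - B (real k * h) \<omega>"
  shows "(\<integral>\<^sup>+\<omega>. F (restrict (\<lambda>k. D k \<omega>) {..<n}, D n \<omega>) \<partial>M)
    = (\<integral>\<^sup>+\<omega>. (\<integral>\<^sup>+z. ennreal (gauss h z) * F (restrict (\<lambda>k. D k \<omega>) {..<n}, z) \<partial>lborel) \<partial>M)"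
proof -
  have ind: "indep_vars (\<lambda>_. borel) D UNIV"
    using independent_increments[of "\<lambda>k. real k * h"] h by (auto simp: D_def strict_mono_def)
  have Dm[measurable]: "D k \<in> borel_measurable M" for k
    using measurable_process h by (simp add: D_def)
  let ?R = "\<lambda>\<omega>. restrict (\<lambda>k. D k \<omega>) {..<n}"
  have Rm[measurable]: "?R \<in> measurable M (PiM {..<n} (\<lambda>_. borel))"
    by (intro measurable_restrict) auto
  let ?L = "\<lambda>\<omega>. restrict (\<lambda>k. D k \<omega>) {n}"
  have Lm[measurable]: "?L \<in> measurable M (PiM {n} (\<lambda>_. borel))"
    by (intro measurable_restrict) auto
  have iv: "indep_var (PiM {..<n} (\<lambda>_. borel)) ?R (PiM {n} (\<lambda>_. borel)) ?L"
    by (rule indep_var_restrict[OF ind]) auto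
  have dens: "distr M lborel (D n) = density lborel (\<lambda>z. ennreal (gauss h z))"
  proof -
    have "0 \<le> real n * h" "real n * h < real (Suc n) * h" using h by (auto simp: algebra_simps)
    from gaussian_increments[OF this] have "distributed M lborel (D n)
        (\<lambda>z. ennreal (\<Prod>i\<in>UNIV. normal_density 0 (sqrt (real (Suc n) * h - real n * h)) (z $ i)))"
      unfolding D_def .
    moreover have "real (Suc n) * h - real n * h = h" by (simp add: algebra_simps)
    ultimately show ?thesis using h by (simp add: distributed_distr_eq_density prod_normal_density)
  qed
  interpret P: prob_space "distr M (PiM {n} (\<lambda>_. borel)) ?L" by (rule prob_space_distr) simp
  have [measurable]: "(\<lambda>e. e n) \<in> measurable (PiM {n} (\<lambda>_. borel)) (lborel :: (real ^ 'n) measure)"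
    using measurable_component_singleton[of n "{n}" "\<lambda>_. borel :: (real ^ 'n) measure"] by simp
  have Fm: "(\<lambda>p. F (fst p, snd p n)) \<in> borel_measurable (PiM {..<n} (\<lambda>_. borel) \<Otimes>\<^sub>M PiM {n} (\<lambda>_. borel))"
    by measurable
  have "(\<integral>\<^sup>+\<omega>. F (?R \<omega>, D n \<omega>) \<partial>M)
      = (\<integral>\<^sup>+p. F (fst p, snd p n)
          \<partial>distr M (PiM {..<n} (\<lambda>_. borel) \<Otimes>\<^sub>M PiM {n} (\<lambda>_. borel)) (\<lambda>\<omega>. (?R \<omega>, ?L \<omega>)))"
    using Fm by (subst nn_integral_distr) auto
  also have "\<dots> = (\<integral>\<^sup>+p. F (fst p, snd p n)
          \<partial>(distr M (PiM {..<n} (\<lambda>_. borel)) ?R \<Otimes>\<^sub>M distr M (PiM {n} (\<lambda>_. borel)) ?L))"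
    using iv by (simp add: indep_var_distribution_eq)
  also have "\<dots> = (\<integral>\<^sup>+d. \<integral>\<^sup>+e. F (d, e n) \<partial>distr M (PiM {n} (\<lambda>_. borel)) ?L \<partial>distr M (PiM {..<n} (\<lambda>_. borel)) ?R)"
    by (subst P.nn_integral_fst[symmetric]) (use Fm in auto)
  also have "\<dots> = (\<integral>\<^sup>+d. \<integral>\<^sup>+z. F (d, z) \<partial>distr M lborel (D n) \<partial>distr M (PiM {..<n} (\<lambda>_. borel)) ?R)"
  proof (rule nn_integral_cong)
    fix d assume d: "d \<in> space (distr M (PiM {..<n} (\<lambda>_. borel)) ?R)"
    then have "(\<lambda>z. F (d, z)) \<in> borel_measurable lborel"
      by (intro measurable_Pair2[OF assms(2)]) simp
    then have [measurable]: "(\<lambda>z. F (d, z)) \<in> borel_measurable borel" by simp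
    show "(\<integral>\<^sup>+e. F (d, e n) \<partial>distr M (PiM {n} (\<lambda>_. borel)) ?L) = (\<integral>\<^sup>+z. F (d, z) \<partial>distr M lborel (D n))"
      by (subst (1 2) nn_integral_distr) auto
  qed
  also have "\<dots> = (\<integral>\<^sup>+d. (\<integral>\<^sup>+z. ennreal (gauss h z) * F (d, z) \<partial>lborel) \<partial>distr M (PiM {..<n} (\<lambda>_. borel)) ?R)"
    unfolding dens
  proof (rule nn_integral_cong)
    fix d assume d: "d \<in> space (distr M (PiM {..<n} (\<lambda>_. borel)) ?R)"
    then have "(\<lambda>z. F (d, z)) \<in> borel_measurable lborel"
      by (intro measurable_Pair2[OF assms(2)]) simp
    then show "(\<integral>\<^sup>+z. F (d, z) \<partial>density lborel (\<lambda>z. ennreal (gauss h z)))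
        = (\<integral>\<^sup>+z. ennreal (gauss h z) * F (d, z) \<partial>lborel)"
      by (intro nn_integral_density) auto
  qed
  also have "\<dots> = (\<integral>\<^sup>+\<omega>. (\<integral>\<^sup>+z. ennreal (gauss h z) * F (?R \<omega>, z) \<partial>lborel) \<partial>M)"
    by (subst nn_integral_distr) auto
  finally show ?thesis .
qed

text \<open>
Peeling off the last step: almost surely the positions at times \<open>k h\<close> are functions of the first
increments, and integrating out the last increment replaces \<open>f\<close> by its heat flow.
\<close>

lemma fk_iter_eq_expectation:
  assumes h: "0 < h" and [measurable]: "f \<in> borel_measurable borel" "g \<in> borel_measurable borel"
  shows "(fk_step h g ^^ n) f x
    = (\<integral>\<^sup>+\<omega>. ennreal (exp (h * (\<Sum>k<n. g (B (real k * h) \<omega>)))) * f (B (real n * h) \<omega>) \<partial>M)"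
  using assms(2)
proof (induction n arbitrary: f)
  case 0
  have "(\<integral>\<^sup>+\<omega>. f (B 0 \<omega>) \<partial>M) = (\<integral>\<^sup>+\<omega>. f x \<partial>M)"
    by (rule nn_integral_cong_AE) (use start in auto)
  then show ?case by (simp add: emeasure_space_1)
next
  case (Suc n)
  note [measurable] = Suc.prems
  define D where "D = (\<lambda>k \<omega>. B (real (Suc k) * h) \<omega> - B (real k * h) \<omega>)"
  \<comment> \<open>\<open>S k\<close> is the position at time \<open>k h\<close> and \<open>W\<close> the weight up to time \<open>n h\<close>, as functions of the
    increments \<open>d\<close>.\<close>
  define S where "S k d = x + (\<Sum>j<k. d j)" for k and d :: "nat \<Rightarrow> real ^ 'n"
  have Sm[measurable]: "S k \<in> borel_measurable (PiM {..<n} (\<lambda>_. borel))" if "k \<le> n" for k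
    using that unfolding S_def by (auto intro!: borel_measurable_add borel_measurable_sum measurable_component_singleton)
  define W where "W d = ennreal (exp (h * (\<Sum>k<Suc n. g (S k d))))" for d
  have Wm[measurable]: "W \<in> borel_measurable (PiM {..<n} (\<lambda>_. borel))"
  proof -
    have "(\<lambda>d. g (S k d)) \<in> borel_measurable (PiM {..<n} (\<lambda>_. borel))" if "k < Suc n" for k
      using that by (intro measurable_compose[OF Sm]) auto
    then have "(\<lambda>d. \<Sum>k<Suc n. g (S k d)) \<in> borel_measurable (PiM {..<n} (\<lambda>_. borel))"
      by (intro borel_measurable_sum) auto
    then show ?thesis unfolding W_def by measurable
  qed
  define F where "F = (\<lambda>(d, z). W d * f (S n d + z))"
  have Fm: "F \<in> borel_measurable (PiM {..<n} (\<lambda>_. borel) \<Otimes>\<^sub>M lborel)"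
  proof -
    have [measurable]: "S n \<in> borel_measurable (PiM {..<n} (\<lambda>_. borel))" by (rule Sm) simp
    show ?thesis unfolding F_def by measurable
  qed
  let ?R = "\<lambda>\<omega>. restrict (\<lambda>k. D k \<omega>) {..<n}"
  have pos: "AE \<omega> in M. \<forall>k\<le>n. B (real k * h) \<omega> = S k (?R \<omega>)"
    using start
  proof eventually_elim
    case (elim \<omega>)
    have "B (real k * h) \<omega> = x + (\<Sum>j<k. D j \<omega>)" for k
      using sum_lessThan_telescope[of "\<lambda>j. B (real j * h) \<omega>" k] elim by (simp add: D_def)
    then show ?case by (simp add: S_def)
  qed
  have "(fk_step h g ^^ Suc n) f x = (fk_step h g ^^ n) (fk_step h g f) x"
    by (simp add: funpow_swap1)
  also have "\<dots> = (\<integral>\<^sup>+\<omega>. ennreal (exp (h * (\<Sum>k<n. g (B (real k * h) \<omega>)))) * fk_step h g f (B (real n * h) \<omega>) \<partial>M)"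
    by (rule Suc.IH) simp
  also have "\<dots> = (\<integral>\<^sup>+\<omega>. ennreal (exp (h * (\<Sum>k<Suc n. g (B (real k * h) \<omega>)))) * heat h f (B (real n * h) \<omega>) \<partial>M)"
    by (simp add: fk_step_def distrib_left exp_add ennreal_mult mult.assoc)
  also have "\<dots> = (\<integral>\<^sup>+\<omega>. (\<integral>\<^sup>+z. ennreal (gauss h z) * F (?R \<omega>, z) \<partial>lborel) \<partial>M)"
    using pos
  proof (intro nn_integral_cong_AE, eventually_elim)
    case (elim \<omega>)
    have "(\<integral>\<^sup>+z. ennreal (gauss h z) * F (?R \<omega>, z) \<partial>lborel)
        = (\<integral>\<^sup>+z. W (?R \<omega>) * (ennreal (gauss h z) * f (S n (?R \<omega>) + z)) \<partial>lborel)"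
      by (simp add: F_def mult_ac)
    also have "\<dots> = W (?R \<omega>) * heat h f (S n (?R \<omega>))"
      using h by (simp add: nn_integral_cmult heat_shift)
    also have "W (?R \<omega>) = ennreal (exp (h * (\<Sum>k<Suc n. g (B (real k * h) \<omega>))))"
      unfolding W_def using elim by (intro arg_cong[where f=ennreal] arg_cong[where f=exp] arg_cong2[where f="(*)"] sum.cong) auto
    also have "S n (?R \<omega>) = B (real n * h) \<omega>" using elim by (metis order_refl)
    finally show ?case by (rule sym)
  qed
  also have "\<dots> = (\<integral>\<^sup>+\<omega>. F (?R \<omega>, D n \<omega>) \<partial>M)"
    using increment_nn_integral[OF h Fm] unfolding D_def by simp
  also have "\<dots> = (\<integral>\<^sup>+\<omega>. ennreal (exp (h * (\<Sum>k<Suc n. g (B (real k * h) \<omega>)))) * f (B (real (Suc n) * h) \<omega>) \<partial>M)"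
    using pos
  proof (intro nn_integral_cong_AE, eventually_elim)
    case (elim \<omega>)
    have "W (?R \<omega>) = ennreal (exp (h * (\<Sum>k<Suc n. g (B (real k * h) \<omega>))))"
      unfolding W_def using elim by (intro arg_cong[where f=ennreal] arg_cong[where f=exp] arg_cong2[where f="(*)"] sum.cong) auto
    moreover have "S n (?R \<omega>) + D n \<omega> = B (real (Suc n) * h) \<omega>"
    proof -
      have "B (real n * h) \<omega> = S n (?R \<omega>)" using elim by (metis order_refl)
      then show ?thesis unfolding D_def by simp
    qed
    ultimately show ?case by (simp add: F_def)
  qed
  finally show ?case .
qed

text \<open>
The potential is merely Borel, so Riemann sums are of no use for measurability.  Instead the
process is jointly measurable as a limit of its values at the times \<open>\<lfloor>s n\<rfloor> / n\<close>, and Fubini applies.  The cutoff \<open>max 0 s\<close> keeps to the times at which the process is specified.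
\<close>

lemma path_integral_measurable:
  fixes V :: "real ^ 'n \<Rightarrow> real"
  assumes [measurable]: "V \<in> borel_measurable borel"
  shows "(\<lambda>\<omega>. LINT s:{0..t}|lborel. V (B s \<omega>)) \<in> borel_measurable M" (is ?thesis1)
    and "\<omega> \<in> space M \<Longrightarrow> set_borel_measurable lborel {0..t} (\<lambda>s. V (B s \<omega>))" (is "_ \<Longrightarrow> ?thesis2")
proof -
  have J[measurable]: "(\<lambda>(\<omega>, s). B (max 0 s) \<omega>) \<in> borel_measurable (M \<Otimes>\<^sub>M (lborel :: real measure))"
  proof (rule borel_measurable_LIMSEQ_metric)
    fix n :: nat
    have "(\<lambda>p. B (max 0 (real_of_int (\<lfloor>snd p * real (Suc n)\<rfloor>) / real (Suc n))) (fst p)) \<in> borel_measurable (M \<Otimes>\<^sub>M (lborel :: real measure))"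
      by (rule measurable_compose_countable[where f="\<lambda>i p. B (max 0 (real_of_int i / real (Suc n))) (fst p)" and g="\<lambda>p. \<lfloor>snd p * real (Suc n)\<rfloor>"])
         (auto intro!: measurable_compose[OF measurable_fst] measurable_process)
    then show "(\<lambda>(\<omega>, s). B (max 0 (real_of_int (\<lfloor>s * real (Suc n)\<rfloor>) / real (Suc n))) \<omega>) \<in> borel_measurable (M \<Otimes>\<^sub>M (lborel :: real measure))"
      by (simp add: case_prod_beta)
  next
    fix p assume "p \<in> space (M \<Otimes>\<^sub>M (lborel :: real measure))"
    then obtain \<omega> s where p: "p = (\<omega>, s)" "\<omega> \<in> space M" by (auto simp: space_pair_measure)
    have "(\<lambda>n. real_of_int (\<lfloor>s * real (Suc n)\<rfloor>) / real (Suc n)) \<longlonglongrightarrow> s"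
    proof (rule tendsto_sandwich)
      show "\<forall>\<^sub>F n in sequentially. s - 1 / real (Suc n) \<le> real_of_int (\<lfloor>s * real (Suc n)\<rfloor>) / real (Suc n)"
      proof (intro always_eventually allI)
        fix n
        have "s - 1 / real (Suc n) = (s * real (Suc n) - 1) / real (Suc n)" by (simp add: field_simps)
        also have "\<dots> \<le> real_of_int (\<lfloor>s * real (Suc n)\<rfloor>) / real (Suc n)"
          by (intro divide_right_mono) linarith+
        finally show "s - 1 / real (Suc n) \<le> real_of_int (\<lfloor>s * real (Suc n)\<rfloor>) / real (Suc n)" .
      qed
      show "\<forall>\<^sub>F n in sequentially. real_of_int (\<lfloor>s * real (Suc n)\<rfloor>) / real (Suc n) \<le> s"
        by (intro always_eventually allI) (simp add: pos_divide_le_eq)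
      show "(\<lambda>n. s - 1 / real (Suc n)) \<longlonglongrightarrow> s"
        using tendsto_diff[OF tendsto_const LIMSEQ_inverse_real_of_nat, of s] by (simp add: inverse_eq_divide)
    qed simp
    then have "(\<lambda>n. max 0 (real_of_int (\<lfloor>s * real (Suc n)\<rfloor>) / real (Suc n))) \<longlonglongrightarrow> max 0 s"
      by (intro tendsto_max tendsto_const)
    then have "(\<lambda>n. B (max 0 (real_of_int (\<lfloor>s * real (Suc n)\<rfloor>) / real (Suc n))) \<omega>) \<longlonglongrightarrow> B (max 0 s) \<omega>"
      by (rule continuous_on_tendsto_compose[OF continuous_paths[OF p(2)]]) auto
    then show "(\<lambda>n. case p of (\<omega>, s) \<Rightarrow> B (max 0 (real_of_int (\<lfloor>s * real (Suc n)\<rfloor>) / real (Suc n))) \<omega>)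
        \<longlonglongrightarrow> (case p of (\<omega>, s) \<Rightarrow> B (max 0 s) \<omega>)"
      by (simp add: p)
  qed
  have eq: "indicator {0..t} s *\<^sub>R V (B s \<omega>) = indicator {0..t} s *\<^sub>R V (B (max 0 s) \<omega>)" for s \<omega>
    by (auto simp: indicator_def)
  have Jm: "(\<lambda>(\<omega>, s). indicator {0..t} s *\<^sub>R V (B (max 0 s) \<omega>)) \<in> borel_measurable (M \<Otimes>\<^sub>M (lborel :: real measure))"
  proof -
    have "(\<lambda>p. indicator {0..t} (snd p) *\<^sub>R V (case p of (\<omega>, s) \<Rightarrow> B (max 0 s) \<omega>)) \<in> borel_measurable (M \<Otimes>\<^sub>M (lborel :: real measure))"
      by measurable
    then show ?thesis by (simp add: case_prod_beta)
  qed
  show ?thesis1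
    unfolding set_lebesgue_integral_def eq 
    by (rule sigma_finite_measure.borel_measurable_lebesgue_integral[OF sigma_finite_lborel]) (rule Jm)
  show ?thesis2 if "\<omega> \<in> space M"
    unfolding set_borel_measurable_def eq
    using measurable_Pair2[OF Jm that] by simp
qed

lemma fk_iter_tendsto:
  assumes t: "0 < t" and f: "continuous_on UNIV f" "\<And>y. 0 \<le> f y" "\<And>y. f y \<le> C"
    and g: "continuous_on UNIV g" "\<And>y. 0 \<le> g y" "\<And>y. g y \<le> K"
  shows "(\<lambda>n. (fk_step (t / real n) g ^^ n) (\<lambda>y. ennreal (f y)) x)
    \<longlonglongrightarrow> (\<integral>\<^sup>+\<omega>. ennreal (f (B t \<omega>) * exp (LINT s:{0..t}|lborel. g (B s \<omega>))) \<partial>M)"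
proof -
  have [measurable]: "f \<in> borel_measurable borel" "g \<in> borel_measurable borel"
    using f g by (auto intro: borel_measurable_continuous_onI)
  have [measurable]: "B s \<in> borel_measurable M" if "0 \<le> s" for s by (rule measurable_process[OF that])
  note [measurable] = path_integral_measurable(1)
  define u where "u n \<omega> = ennreal (f (B t \<omega>) * exp (t / real n * (\<Sum>k<n. g (B (real k * (t / real n)) \<omega>))))" for n \<omega>
  have um[measurable]: "u n \<in> borel_measurable M" for n
  proof -
    have "(\<lambda>\<omega>. g (B (real k * (t / real n)) \<omega>)) \<in> borel_measurable M" for k
      using t by (intro measurable_compose[OF measurable_process]) auto
    then have [measurable]: "(\<lambda>\<omega>. \<Sum>k<n. g (B (real k * (t / real n)) \<omega>)) \<in> borel_measurable M"
      by (intro borel_measurable_sum) auto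
    have [measurable]: "B t \<in> borel_measurable M" using t by (intro measurable_process) simp
    show ?thesis unfolding u_def by measurable
  qed
  have lim: "(\<lambda>n. \<integral>\<^sup>+\<omega>. u n \<omega> \<partial>M) \<longlonglongrightarrow> (\<integral>\<^sup>+\<omega>. ennreal (f (B t \<omega>) * exp (LINT s:{0..t}|lborel. g (B s \<omega>))) \<partial>M)"
  proof (rule nn_integral_dominated_convergence[where w="\<lambda>_. ennreal (C * exp (t * K))"])
    show "AE \<omega> in M. u n \<omega> \<le> ennreal (C * exp (t * K))" for n
    proof (intro always_eventually allI)
      fix \<omega>
      have C: "0 \<le> C" using f(2,3)[of 0] by simp
      have K: "0 \<le> K" using g(2,3)[of 0] by simp
      have "(\<Sum>k<n. g (B (real k * (t / real n)) \<omega>)) \<le> real n * K"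
        using sum_mono[of "{..<n}" "\<lambda>k. g (B (real k * (t / real n)) \<omega>)" "\<lambda>_. K"] g by simp
      then have "t / real n * (\<Sum>k<n. g (B (real k * (t / real n)) \<omega>)) \<le> t / real n * (real n * K)"
        using t by (intro mult_left_mono) auto
      also have "\<dots> \<le> t * K" using t K by (cases "n = 0") auto
      finally show "u n \<omega> \<le> ennreal (C * exp (t * K))"
        unfolding u_def using f C by (intro ennreal_leI mult_mono) auto
    qed
    show "AE \<omega> in M. (\<lambda>n. u n \<omega>) \<longlonglongrightarrow> ennreal (f (B t \<omega>) * exp (LINT s:{0..t}|lborel. g (B s \<omega>)))"
    proof (rule AE_I2)
      fix \<omega> assume \<omega>: "\<omega> \<in> space M"
      have "continuous_on {0..t} (\<lambda>s. g (B s \<omega>))"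
        by (rule continuous_on_compose2[OF g(1) continuous_on_subset[OF continuous_paths[OF \<omega>]]]) auto
      from left_riemann_sum_tendsto[OF t this]
      show "(\<lambda>n. u n \<omega>) \<longlonglongrightarrow> ennreal (f (B t \<omega>) * exp (LINT s:{0..t}|lborel. g (B s \<omega>)))"
        unfolding u_def by (intro tendsto_intros)
    qed
  qed (use t in \<open>auto simp: emeasure_space_1 ennreal_mult_less_top\<close>)
  show ?thesis
  proof (rule Lim_transform_eventually[OF lim])
    show "\<forall>\<^sub>F n in sequentially. (\<integral>\<^sup>+\<omega>. u n \<omega> \<partial>M) = (fk_step (t / real n) g ^^ n) (\<lambda>y. ennreal (f y)) x"
      using eventually_gt_at_top[of 0]
    proof eventually_elim
      case (elim n)
      then have "(fk_step (t / real n) g ^^ n) (\<lambda>y. ennreal (f y)) x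
        = (\<integral>\<^sup>+\<omega>. ennreal (exp (t / real n * (\<Sum>k<n. g (B (real k * (t / real n)) \<omega>)))) * ennreal (f (B t \<omega>)) \<partial>M)"
        using t by (subst fk_iter_eq_expectation) auto
      also have "\<dots> = (\<integral>\<^sup>+\<omega>. u n \<omega> \<partial>M)"
        unfolding u_def using f by (simp add: ennreal_mult mult.commute)
      finally show ?case by simp
    qed
  qed
qed

text \<open>
The comparison is pathwise.  Measurability of the path integral and the bounds on \<open>V\<close> are needed
to make the middle term a genuine integral; a non-integrable function would have Bochner integral \<open>0\<close>
and spoil the lower bound.
\<close>

lemma feynman_kac_mono:
  assumes t: "0 < t" and f: "continuous_on UNIV f" "\<And>y. 0 \<le> f y" "\<And>y. f y \<le> C"
    and V: "V \<in> borel_measurable borel"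
    and g: "continuous_on UNIV g" "\<And>y. 0 \<le> g y" "\<And>y. g y \<le> - V y"
    and g': "continuous_on UNIV g'" "\<And>y. - V y \<le> g' y" "\<And>y. g' y \<le> K"
  shows "(\<integral>\<^sup>+\<omega>. ennreal (f (B t \<omega>) * exp (LINT s:{0..t}|lborel. g (B s \<omega>))) \<partial>M)
      \<le> ennreal (\<integral>\<omega>. f (B t \<omega>) * exp (- (LINT s:{0..t}|lborel. V (B s \<omega>))) \<partial>M)" (is "?a \<le> ?v")
    and "ennreal (\<integral>\<omega>. f (B t \<omega>) * exp (- (LINT s:{0..t}|lborel. V (B s \<omega>))) \<partial>M)
      \<le> (\<integral>\<^sup>+\<omega>. ennreal (f (B t \<omega>) * exp (LINT s:{0..t}|lborel. g' (B s \<omega>))) \<partial>M)" (is "?v \<le> ?b")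
proof -
  note [measurable] = V path_integral_measurable(1)
  have [measurable]: "f \<in> borel_measurable borel" using f by (auto intro: borel_measurable_continuous_onI)
  have [measurable]: "B t \<in> borel_measurable M" using t by (auto intro: measurable_process)
  have Vb: "\<bar>V y\<bar> \<le> K" for y using g(2,3)[of y] g'(2,3)[of y] by auto
  have int: "set_integrable lborel {0..t} (\<lambda>s. q (B s \<omega>))"
    if "\<omega> \<in> space M" "q \<in> borel_measurable borel" "\<And>y. \<bar>q y\<bar> \<le> K" for q \<omega>
    unfolding set_integrable_def
  proof (rule Bochner_Integration.integrable_bound[where f="\<lambda>s. indicator {0..t} s * K"])
    show "integrable lborel (\<lambda>s. indicator {0..t} s * K)"
      using t by (intro integrable_mult_left) (auto simp: integrable_indicator_iff)
    show "(\<lambda>s. indicator {0..t} s *\<^sub>R q (B s \<omega>)) \<in> borel_measurable lborel"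
      using path_integral_measurable(2)[OF that(2,1), of t] unfolding set_borel_measurable_def .
    show "AE s in lborel. norm (indicator {0..t} s *\<^sub>R q (B s \<omega>)) \<le> norm (indicator {0..t} s * K)"
    proof (intro always_eventually allI)
      fix s
      have "0 \<le> K" using that(3)[of 0] by linarith
      then show "norm (indicator {0..t} s *\<^sub>R q (B s \<omega>)) \<le> norm (indicator {0..t} s * K)"
        using that(3)[of "B s \<omega>"] by (auto simp: indicator_def)
    qed
  qed
  have gm: "g \<in> borel_measurable borel" "g' \<in> borel_measurable borel"
    using g g' by (auto intro: borel_measurable_continuous_onI)
  have gb: "\<bar>g y\<bar> \<le> K" "\<bar>g' y\<bar> \<le> K" for y using g(2,3)[of y] g'(2,3)[of y] by auto
  have Vneg: "- (LINT s:{0..t}|lborel. V (B s \<omega>)) = (LINT s:{0..t}|lborel. - V (B s \<omega>))" for \<omega>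
    unfolding set_lebesgue_integral_def by simp
  have neg: "set_integrable lborel {0..t} (\<lambda>s. - V (B s \<omega>))" if "\<omega> \<in> space M" for \<omega>
    using int[OF that, of "\<lambda>y. - V y"] Vb by simp
  have lo: "(LINT s:{0..t}|lborel. g (B s \<omega>)) \<le> - (LINT s:{0..t}|lborel. V (B s \<omega>))" if "\<omega> \<in> space M" for \<omega>
    unfolding Vneg using int[OF that gm(1) gb(1)] neg[OF that] g(3) by (intro set_integral_mono) auto
  have hi: "- (LINT s:{0..t}|lborel. V (B s \<omega>)) \<le> (LINT s:{0..t}|lborel. g' (B s \<omega>))" if "\<omega> \<in> space M" for \<omega>
    unfolding Vneg using int[OF that gm(2) gb(2)] neg[OF that] g'(2) by (intro set_integral_mono) auto
  have hiK: "(LINT s:{0..t}|lborel. g' (B s \<omega>)) \<le> K * t" if "\<omega> \<in> space M" for \<omega>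
  proof -
    have "(LINT s:{0..t}|lborel. g' (B s \<omega>)) \<le> (LINT s:{0..t}|lborel. K)"
      using int[OF that gm(2) gb(2)] g'(3) t by (intro set_integral_mono) (auto simp: set_integrable_def integrable_indicator_iff)
    also have "\<dots> = K * t" using t by (simp add: set_lebesgue_integral_def)
    finally show ?thesis .
  qed
  have C: "0 \<le> C" using f(2,3)[of 0] by simp
  have integ: "integrable M (\<lambda>\<omega>. f (B t \<omega>) * exp (- (LINT s:{0..t}|lborel. V (B s \<omega>))))"
  proof (rule integrable_const_bound[where B="C * exp (K * t)"])
    show "AE \<omega> in M. norm (f (B t \<omega>) * exp (- (LINT s:{0..t}|lborel. V (B s \<omega>)))) \<le> C * exp (K * t)"
    proof (rule AE_I2)
      fix \<omega> assume "\<omega> \<in> space M"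
      from hi[OF this] hiK[OF this] f C show "norm (f (B t \<omega>) * exp (- (LINT s:{0..t}|lborel. V (B s \<omega>)))) \<le> C * exp (K * t)"
        by (auto simp: abs_mult intro!: mult_mono)
    qed
  qed measurable
  have v: "?v = (\<integral>\<^sup>+\<omega>. ennreal (f (B t \<omega>) * exp (- (LINT s:{0..t}|lborel. V (B s \<omega>)))) \<partial>M)"
    using integ f by (subst nn_integral_eq_integral) auto
  show "?a \<le> ?v" unfolding v using lo f by (intro nn_integral_mono ennreal_leI mult_left_mono) auto
  show "?v \<le> ?b" unfolding v using hi f by (intro nn_integral_mono ennreal_leI mult_left_mono) auto
qed

end

section \<open>From the semigroup to the kernel\<close>

text \<open>
If \<open>v < u\<close> held at a point then it would hold on a ball, and a bump function supported there
contradicts the inequality of the integrals.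
\<close>

lemma le_if_integrals_against_bumps_le:
  fixes u v :: "real ^ 'n \<Rightarrow> real"
  assumes u: "continuous_on UNIV u" and v: "continuous_on UNIV v"
    and le: "\<And>f. continuous_on UNIV f \<Longrightarrow> (\<And>y. 0 \<le> f y) \<Longrightarrow> (\<And>y. f y \<le> 1) \<Longrightarrow>
      integrable lborel (\<lambda>y. u y * f y) \<Longrightarrow> integrable lborel (\<lambda>y. v y * f y) \<Longrightarrow>
      (\<integral>y. u y * f y \<partial>lborel) \<le> (\<integral>y. v y * f y \<partial>lborel)"
  shows "u y \<le> v y"
proof (rule ccontr)
  assume "\<not> u y \<le> v y"
  then have y: "y \<in> {y. v y < u y}" by simp
  have "open {y. v y < u y}" using u v by (intro open_Collect_less) auto
  then obtain d where d: "0 < d" "ball y d \<subseteq> {y. v y < u y}" using y by (auto simp: open_contains_ball)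
  define f where "f z = max 0 (1 - dist z y / d)" for z
  have f: "continuous_on UNIV f" "\<And>z. 0 \<le> f z" "\<And>z. f z \<le> 1"
    using d by (auto simp: f_def intro!: continuous_intros)
  have f0: "f z = 0" if "z \<notin> ball y d" for z
    using that d by (auto simp: f_def dist_commute field_simps)
  have f1: "0 < f z" if "z \<in> ball y d" for z
    using that d by (auto simp: f_def dist_commute less_max_iff_disj field_simps)
  have int: "integrable lborel (\<lambda>z. q z * f z)" if "continuous_on UNIV q" for q :: "real ^ 'n \<Rightarrow> real"
  proof -
    have "integrable lborel (\<lambda>z. indicator (cball y d) z *\<^sub>R (q z * f z))"
      using that f by (intro borel_integrable_compact continuous_intros) (auto intro: continuous_on_subset)
    also have "(\<lambda>z. indicator (cball y d) z *\<^sub>R (q z * f z)) = (\<lambda>z. q z * f z)"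
    proof
      fix z show "indicator (cball y d) z *\<^sub>R (q z * f z) = q z * f z"
        using f0[of z] by (cases "z \<in> ball y d") (auto simp: indicator_def)
    qed
    finally show ?thesis .
  qed
  let ?q = "\<lambda>z. u z * f z - v z * f z"
  have q0: "0 \<le> ?q z" for z
    using d f0[of z] f(2)[of z] by (cases "z \<in> ball y d") (auto simp: left_diff_distrib[symmetric] less_imp_le subset_iff)
  have "(\<integral>z. ?q z \<partial>lborel) \<le> 0" using le[OF f int[OF u] int[OF v]] int[OF u] int[OF v] by simp
  moreover have "0 \<le> (\<integral>z. ?q z \<partial>lborel)" using q0 by simp
  ultimately have "AE z in lborel. ?q z = 0"
    using q0 int[OF u] int[OF v] by (subst integral_nonneg_eq_0_iff_AE[symmetric]) auto
  then have "AE z in lborel. z \<notin> ball y d"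
  proof eventually_elim
    case (elim z)
    then have "(u z - v z) * f z = 0" by (simp add: algebra_simps)
    then show ?case using f1[of z] d by auto
  qed
  then have "emeasure lborel (ball y d) = 0"
    by (subst (asm) AE_iff_measurable[where N="ball y d"]) auto
  then have "measure lborel (ball y d) = 0" by (simp add: measure_def)
  with content_ball_pos[OF d(1), of y] show False by simp
qed

lemma frequently_le_imp_tendsto_le:
  fixes X :: "nat \<Rightarrow> 'a::linorder_topology"
  assumes "X \<longlonglongrightarrow> L" "\<exists>\<^sub>F n in sequentially. X n \<le> c"
  shows "L \<le> c"
  using assms order_tendstoD(1)[OF assms(1), of c] by (fastforce simp: frequently_def not_le)

lemma frequently_ge_imp_tendsto_ge:
  fixes X :: "nat \<Rightarrow> 'a::linorder_topology"
  assumes "X \<longlonglongrightarrow> L" "\<exists>\<^sub>F n in sequentially. c \<le> X n"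
  shows "c \<le> L"
  using assms order_tendstoD(2)[OF assms(1), of c] by (fastforce simp: frequently_def not_le)

text \<open>
It suffices to bound the iterates for infinitely many \<open>n\<close>, since they converge; this leaves the
freedom to choose step numbers adapted to the estimate.
\<close>

lemma heat_kernel_le:
  fixes P :: "real ^ 'n \<Rightarrow> 'w measure" and U :: "real ^ 'n \<Rightarrow> real"
  assumes PB: "brownian_family P B" and p: "heat_kernel P B V p" and V: "V \<in> borel_measurable borel"
    and t: "0 < t" and V0: "\<And>y. V y \<le> 0"
    and g: "continuous_on UNIV g" "\<And>y. - V y \<le> g y" "\<And>y. g y \<le> K"
    and U: "continuous_on UNIV U" "\<And>y. 0 \<le> U y"
    and le: "\<And>f. f \<in> borel_measurable borel \<Longrightarrow>
      \<exists>\<^sub>F n in sequentially. (fk_step (t / real n) g ^^ n) f x \<le> (\<integral>\<^sup>+y. ennreal (U y) * f y \<partial>lborel)"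
  shows "p t x y \<le> U y"
proof (rule le_if_integrals_against_bumps_le[where u="p t x" and v=U])
  interpret brownian_motion "P x" B x using PB by (simp add: brownian_family_def)
  have pc: "continuous_on ({0<..} \<times> UNIV \<times> UNIV) (\<lambda>(t, x, y). p t x y)"
    using p by (simp add: heat_kernel_def)
  show "continuous_on UNIV (p t x)"
  proof -
    have "continuous_on UNIV (\<lambda>y. (t, x, y))" by (intro continuous_intros)
    moreover have "range (\<lambda>y. (t, x, y)) \<subseteq> {0<..} \<times> UNIV \<times> UNIV" using t by auto
    ultimately show ?thesis using continuous_on_compose2[OF pc] by fastforce
  qed
  fix f :: "real ^ 'n \<Rightarrow> real"
  assume f: "continuous_on UNIV f" "\<And>y. 0 \<le> f y" "\<And>y. f y \<le> 1"
    and int: "integrable lborel (\<lambda>y. p t x y * f y)" "integrable lborel (\<lambda>y. U y * f y)"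
  have "has_bochner_integral lborel (\<lambda>y. p t x y * f y) (schroedinger_semigroup P B V t f x)"
  proof -
    have "bounded (range f)" using f by (auto simp: bounded_iff intro!: exI[of _ 1])
    then show ?thesis using p f t unfolding heat_kernel_def by blast
  qed
  then have I: "(\<integral>y. p t x y * f y \<partial>lborel) = schroedinger_semigroup P B V t f x"
    by (rule has_bochner_integral_integral_eq)
  have g0: "0 \<le> g y" for y using g(2)[of y] V0[of y] by linarith
  have "ennreal (schroedinger_semigroup P B V t f x)
      \<le> (\<integral>\<^sup>+\<omega>. ennreal (f (B t \<omega>) * exp (LINT s:{0..t}|lborel. g (B s \<omega>))) \<partial>P x)"
    unfolding schroedinger_semigroup_def
    using V0 by (intro feynman_kac_mono(2)[OF t f V _ _ _ g, where g="\<lambda>_. 0"]) auto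
  also have "\<dots> \<le> (\<integral>\<^sup>+y. ennreal (U y) * ennreal (f y) \<partial>lborel)"
    by (rule frequently_le_imp_tendsto_le[OF fk_iter_tendsto[OF t f g(1) g0 g(3)] le])
       (use f in \<open>auto intro!: measurable_compose[OF _ measurable_ennreal] borel_measurable_continuous_onI\<close>)
  also have "\<dots> = ennreal (\<integral>y. U y * f y \<partial>lborel)"
    using int(2) U f by (subst nn_integral_eq_integral[symmetric]) (auto simp: ennreal_mult)
  finally show "(\<integral>y. p t x y * f y \<partial>lborel) \<le> (\<integral>y. U y * f y \<partial>lborel)"
    using U f unfolding I by (subst (asm) ennreal_le_iff) auto
qed (rule U)

lemma heat_kernel_ge:
  fixes P :: "real ^ 'n \<Rightarrow> 'w measure" and L :: "real ^ 'n \<Rightarrow> real"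
  assumes PB: "brownian_family P B" and p: "heat_kernel P B V p" and V: "V \<in> borel_measurable borel"
    and t: "0 < t" and VK: "\<And>y. - V y \<le> K"
    and g: "continuous_on UNIV g" "\<And>y. 0 \<le> g y" "\<And>y. g y \<le> - V y"
    and L: "continuous_on UNIV L" "\<And>y. 0 \<le> L y"
    and le: "\<And>f. f \<in> borel_measurable borel \<Longrightarrow>
      \<exists>\<^sub>F n in sequentially. (\<integral>\<^sup>+y. ennreal (L y) * f y \<partial>lborel) \<le> (fk_step (t / real n) g ^^ n) f x"
  shows "L y \<le> p t x y"
proof (rule le_if_integrals_against_bumps_le[where v="p t x" and u=L])
  interpret brownian_motion "P x" B x using PB by (simp add: brownian_family_def)
  have pc: "continuous_on ({0<..} \<times> UNIV \<times> UNIV) (\<lambda>(t, x, y). p t x y)"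
    using p by (simp add: heat_kernel_def)
  show "continuous_on UNIV (p t x)"
  proof -
    have "continuous_on UNIV (\<lambda>y. (t, x, y))" by (intro continuous_intros)
    moreover have "range (\<lambda>y. (t, x, y)) \<subseteq> {0<..} \<times> UNIV \<times> UNIV" using t by auto
    ultimately show ?thesis using continuous_on_compose2[OF pc] by fastforce
  qed
  fix f :: "real ^ 'n \<Rightarrow> real"
  assume f: "continuous_on UNIV f" "\<And>y. 0 \<le> f y" "\<And>y. f y \<le> 1"
    and int: "integrable lborel (\<lambda>y. L y * f y)" "integrable lborel (\<lambda>y. p t x y * f y)"
  have "has_bochner_integral lborel (\<lambda>y. p t x y * f y) (schroedinger_semigroup P B V t f x)"
  proof -
    have "bounded (range f)" using f by (auto simp: bounded_iff intro!: exI[of _ 1])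
    then show ?thesis using p f t unfolding heat_kernel_def by blast
  qed
  then have I: "(\<integral>y. p t x y * f y \<partial>lborel) = schroedinger_semigroup P B V t f x"
    by (rule has_bochner_integral_integral_eq)
  have gK: "g y \<le> K" for y using g(3)[of y] VK[of y] by linarith
  have "ennreal (\<integral>y. L y * f y \<partial>lborel) = (\<integral>\<^sup>+y. ennreal (L y) * ennreal (f y) \<partial>lborel)"
    using int(1) L f by (subst nn_integral_eq_integral[symmetric]) (auto simp: ennreal_mult)
  also have "\<dots> \<le> (\<integral>\<^sup>+\<omega>. ennreal (f (B t \<omega>) * exp (LINT s:{0..t}|lborel. g (B s \<omega>))) \<partial>P x)"
    by (rule frequently_ge_imp_tendsto_ge[OF fk_iter_tendsto[OF t f g(1,2) gK] le])
       (use f in \<open>auto intro!: measurable_compose[OF _ measurable_ennreal] borel_measurable_continuous_onI\<close>)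
  also have "\<dots> \<le> ennreal (schroedinger_semigroup P B V t f x)"
    unfolding schroedinger_semigroup_def
    using VK by (intro feynman_kac_mono(1)[OF t f V g, where g'="\<lambda>_. K"]) auto
  finally show "(\<integral>y. L y * f y \<partial>lborel) \<le> (\<integral>y. p t x y * f y \<partial>lborel)"
    using f unfolding I by (subst (asm) ennreal_le_iff) (auto simp: schroedinger_semigroup_def)
qed (rule L)

section \<open>The upper estimate\<close>

definition decay :: "real \<Rightarrow> real ^ 'n \<Rightarrow> real" where
  "decay \<alpha> x = (1 + norm x) powr (- \<alpha>)"

lemma decay_continuous [continuous_intros]: "continuous_on S (\<lambda>x. decay \<alpha> x)"
  unfolding decay_def by (intro continuous_intros) (auto simp: add_nonneg_eq_0_iff)

lemma decay_measurable [measurable]: "decay \<alpha> \<in> borel_measurable borel"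
  by (rule borel_measurable_continuous_onI) (rule decay_continuous)

lemma decay_nonneg [simp]: "0 \<le> decay \<alpha> x"
  by (simp add: decay_def)

lemma decay_le_1: "0 \<le> \<alpha> \<Longrightarrow> decay \<alpha> x \<le> 1"
proof -
  assume "0 \<le> \<alpha>"
  moreover have "1 + norm x \<noteq> 0" using norm_ge_zero[of x] by linarith
  ultimately show ?thesis unfolding decay_def using powr_mono[of "- \<alpha>" 0 "1 + norm x"] by simp
qed

lemma decay_le:
  assumes "0 \<le> \<alpha>" "0 < r" "r \<le> 1 + norm x"
  shows "decay \<alpha> x \<le> r powr (- \<alpha>)"
  unfolding decay_def using assms by (intro powr_mono2') auto

lemma decay_ge:
  assumes "0 \<le> \<alpha>" "1 + norm x \<le> r"
  shows "r powr (- \<alpha>) \<le> decay \<alpha> x"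
  unfolding decay_def using assms by (intro powr_mono2') (auto intro: add_pos_nonneg)

lemma heat_le_heat_double:
  fixes f :: "real ^ 'n \<Rightarrow> ennreal"
  assumes s: "0 < s" "s \<le> t" and \<rho>: "\<And>z. \<rho> \<le> norm (z - x) \<or> f z = 0" "0 \<le> \<rho>"
    and [measurable]: "f \<in> borel_measurable borel"
  shows "heat s f x \<le> ennreal (2 powr (real CARD('n) / 2) * exp (- \<rho>\<^sup>2 / (4 * t))) * heat (2 * s) f x"
proof -
  let ?c = "2 powr (real CARD('n) / 2) * exp (- \<rho>\<^sup>2 / (4 * t))"
  have "ennreal (gauss s (z - x)) * f z \<le> ennreal ?c * (ennreal (gauss (2 * s) (z - x)) * f z)" for z
  proof (cases "f z = 0")
    case False
    with \<rho> have \<rho>z: "\<rho>\<^sup>2 \<le> (norm (z - x))\<^sup>2" by (metis power_mono)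
    have "\<rho>\<^sup>2 / (4 * t) \<le> (norm (z - x))\<^sup>2 / (4 * s)"
      using \<rho>z s by (intro frac_le) auto
    then have "gauss s (z - x) \<le> ?c * gauss (2 * s) (z - x)"
      unfolding gauss_double[OF s(1), of "z - x"] by (intro mult_right_mono mult_left_mono) auto
    then have "ennreal (gauss s (z - x)) \<le> ennreal ?c * ennreal (gauss (2 * s) (z - x))"
      by (simp add: ennreal_mult[symmetric] ennreal_leI)
    then show ?thesis by (metis mult.assoc mult_right_mono zero_le)
  qed simp
  then show ?thesis
    using s by (simp add: heat_pos nn_integral_cmult[symmetric] nn_integral_mono)
qed

text \<open>
Passing through a set at distance \<open>\<rho>\<close> from the starting point costs \<open>exp (- \<rho>\<^sup>2 / (4 (s + r)))\<close> at the
price of doubling the time.  At \<open>s = 0\<close> the left side vanishes because \<open>x\<close> is not in the set; for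
this \<open>\<rho>\<close> has to be positive.
\<close>

lemma heat_through_far_set_le:
  fixes f :: "real ^ 'n \<Rightarrow> ennreal"
  assumes s: "0 \<le> s" "0 < r" and A: "A \<in> sets borel" "\<And>z. z \<in> A \<Longrightarrow> \<rho> \<le> norm (z - x)" "0 < \<rho>"
    and [measurable]: "f \<in> borel_measurable borel"
  shows "heat s (\<lambda>z. indicator A z * heat r f z) x
    \<le> ennreal (2 powr real CARD('n) * exp (- \<rho>\<^sup>2 / (4 * (s + r)))) * heat (2 * (s + r)) f x"
proof (cases "s = 0")
  case True
  have "x \<notin> A" using A(2)[of x] A(3) by auto
  with True show ?thesis by simp
next
  case False
  with s have s': "0 < s" by simp
  note [measurable] = A(1)
  let ?c = "2 powr (real CARD('n) / 2)"
  have "heat s (\<lambda>z. indicator A z * heat r f z) x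
      \<le> ennreal (?c * exp (- \<rho>\<^sup>2 / (4 * (s + r)))) * heat (2 * s) (\<lambda>z. indicator A z * heat r f z) x"
    using s s' A by (intro heat_le_heat_double) (auto simp: indicator_def)
  also have "heat (2 * s) (\<lambda>z. indicator A z * heat r f z) x \<le> heat (2 * s) (\<lambda>z. ennreal ?c * heat (2 * r) f z) x"
  proof (rule heat_mono)
    fix z
    have "heat r f z \<le> ennreal (?c * exp (- 0\<^sup>2 / (4 * r))) * heat (2 * r) f z"
      using s by (intro heat_le_heat_double) auto
    then have "heat r f z \<le> ennreal ?c * heat (2 * r) f z" by simp
    then show "indicator A z * heat r f z \<le> ennreal ?c * heat (2 * r) f z"
      by (auto simp: indicator_def)
  qed
  also have "\<dots> = ennreal ?c * heat (2 * (s + r)) f x"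
    using s by (subst heat_cmult, simp, subst heat_heat) (auto simp: distrib_left)
  also have "ennreal (?c * exp (- \<rho>\<^sup>2 / (4 * (s + r)))) * (ennreal ?c * heat (2 * (s + r)) f x)
      = ennreal (?c * exp (- \<rho>\<^sup>2 / (4 * (s + r))) * ?c) * heat (2 * (s + r)) f x"
    by (simp add: ennreal_mult mult.assoc)
  also have "?c * exp (- \<rho>\<^sup>2 / (4 * (s + r))) * ?c = 2 powr real CARD('n) * exp (- \<rho>\<^sup>2 / (4 * (s + r)))"
    by (simp add: powr_add[symmetric] mult_ac)
  finally show ?thesis by (simp add: mult_left_mono)
qed

text \<open>
The potential is at most \<open>l\<close> except on a set \<open>A\<close> far from the starting point.  Expand once in the part
on \<open>A\<close>: each term of the Duhamel sum visits \<open>A\<close>, and after the visit the crude bound \<open>e\<^sup>K\<^sup>t\<close> is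
affordable.
\<close>

lemma fk_iter_far_core_le:
  fixes f :: "real ^ 'n \<Rightarrow> ennreal"
  assumes h: "0 < h" "real n * h = t" "0 < t"
    and A: "A \<in> sets borel" "\<And>z. z \<in> A \<Longrightarrow> \<rho> \<le> norm (z - x)" "0 < \<rho>"
    and K: "0 \<le> K" and g: "\<And>z. g z \<le> l + K * indicator A z"
    and [measurable]: "f \<in> borel_measurable borel"
  shows "(fk_step h g ^^ n) f x \<le> ennreal (exp (l * t) *
      (2 powr (real CARD('n) / 2) + 2 powr real CARD('n) * (K * t * exp (K * t - \<rho>\<^sup>2 / (4 * t))))) * heat (2 * t) f x"
proof -
  note [measurable] = A(1)
  let ?g = "\<lambda>z. K * indicator A z :: real"
  let ?c = "2 powr (real CARD('n) / 2)" and ?c2 = "2 powr real CARD('n) * exp (- \<rho>\<^sup>2 / (4 * t))"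
  have g1: "0 \<le> ?g z" "?g z \<le> K" for z using K by (auto simp: indicator_def)
  have "(fk_step h g ^^ n) f x \<le> (fk_step h (\<lambda>z. l + ?g z) ^^ n) f x"
    using h g by (intro fk_iter_mono) auto
  also have "\<dots> = ennreal (exp (l * t)) * (fk_step h ?g ^^ n) f x"
    using fk_iter_add_const[where f=f and g="?g" and h=h and c=l and n=n and x=x] h by simp
  also have "(fk_step h ?g ^^ n) f x \<le> heat t f x
    + (\<Sum>k<n. heat (real k * h) (\<lambda>z. ennreal (h * exp (h * K) * ?g z) * heat h ((fk_step h ?g ^^ (n - Suc k)) f) z) x)"
    using fk_iter_duhamel_le[where g="?g" and h=h and f=f and n=n and x=x and K=K] h g1 K by simp
  also have "heat t f x \<le> ennreal ?c * heat (2 * t) f x"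
    using heat_le_heat_double[of t t 0 x f] h by simp
  also have "(\<Sum>k<n. heat (real k * h) (\<lambda>z. ennreal (h * exp (h * K) * ?g z) * heat h ((fk_step h ?g ^^ (n - Suc k)) f) z) x)
      \<le> (\<Sum>k<n. ennreal (h * K * exp (K * t)) * (ennreal ?c2 * heat (2 * t) f x))"
  proof (rule sum_mono)
    fix k assume "k \<in> {..<n}"
    then have k: "k < n" by simp
    have nk: "0 < real (n - k) * h" using k h by simp
    have kh: "real k * h + real (n - k) * h = t" using k h by (simp add: algebra_simps)
    have nk1: "h + real (n - Suc k) * h = real (n - k) * h"
      using k by (simp add: of_nat_diff algebra_simps)
    have "heat (real k * h) (\<lambda>z. ennreal (h * exp (h * K) * ?g z) * heat h ((fk_step h ?g ^^ (n - Suc k)) f) z) x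
        \<le> heat (real k * h) (\<lambda>z. ennreal (h * K * exp (K * t)) * (indicator A z * heat (real (n - k) * h) f z)) x"
    proof (rule heat_mono)
      fix z
      have "heat h ((fk_step h ?g ^^ (n - Suc k)) f) z
          \<le> heat h (\<lambda>z. ennreal (exp (K * (real (n - Suc k) * h))) * heat (real (n - Suc k) * h) f z) z"
        using h g1 by (intro heat_mono fk_iter_le_exp_heat) auto
      also have "\<dots> = ennreal (exp (K * (real (n - Suc k) * h))) * heat (real (n - k) * h) f z"
        using h by (simp add: heat_cmult heat_heat nk1)
      finally have 1: "heat h ((fk_step h ?g ^^ (n - Suc k)) f) z
          \<le> ennreal (exp (K * (real (n - Suc k) * h))) * heat (real (n - k) * h) f z" .
      have "h * K + K * (real (n - Suc k) * h) = K * (real (n - k) * h)"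
        unfolding nk1[symmetric] by (simp add: algebra_simps)
      also have "\<dots> \<le> K * t" using K kh h by (intro mult_left_mono) (auto simp: algebra_simps)
      finally have 2: "exp (h * K) * exp (K * (real (n - Suc k) * h)) \<le> exp (K * t)"
        by (simp add: exp_add[symmetric])
      show "ennreal (h * exp (h * K) * ?g z) * heat h ((fk_step h ?g ^^ (n - Suc k)) f) z
          \<le> ennreal (h * K * exp (K * t)) * (indicator A z * heat (real (n - k) * h) f z)"
      proof (cases "z \<in> A")
        case True
        have "ennreal (h * exp (h * K) * ?g z) * heat h ((fk_step h ?g ^^ (n - Suc k)) f) z
            \<le> ennreal (h * exp (h * K) * K) * (ennreal (exp (K * (real (n - Suc k) * h))) * heat (real (n - k) * h) f z)"
          using 1 True by (intro mult_mono) auto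
        also have "\<dots> = ennreal (h * exp (h * K) * K * exp (K * (real (n - Suc k) * h))) * heat (real (n - k) * h) f z"
          using h K by (simp add: ennreal_mult mult.assoc)
        also have "\<dots> \<le> ennreal (h * K * exp (K * t)) * heat (real (n - k) * h) f z"
        proof (intro mult_right_mono ennreal_leI)
          have "h * K * (exp (h * K) * exp (K * (real (n - Suc k) * h))) \<le> h * K * exp (K * t)"
            using 2 h K by (intro mult_left_mono) auto
          then show "h * exp (h * K) * K * exp (K * (real (n - Suc k) * h)) \<le> h * K * exp (K * t)"
            by (simp only: mult_ac)
        qed simp
        finally show ?thesis using True by simp
      qed simp
    qed
    also have "\<dots> = ennreal (h * K * exp (K * t)) * heat (real k * h) (\<lambda>z. indicator A z * heat (real (n - k) * h) f z) x"
      by (intro heat_cmult) measurable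
    also have "\<dots> \<le> ennreal (h * K * exp (K * t)) * (ennreal ?c2 * heat (2 * t) f x)"
      using heat_through_far_set_le[OF _ nk A, of "real k * h" f] h unfolding kh by (intro mult_left_mono) auto
    finally show "heat (real k * h) (\<lambda>z. ennreal (h * exp (h * K) * ?g z) * heat h ((fk_step h ?g ^^ (n - Suc k)) f) z) x
        \<le> ennreal (h * K * exp (K * t)) * (ennreal ?c2 * heat (2 * t) f x)" .
  qed
  also have "\<dots> = ennreal (K * t * exp (K * t) * ?c2) * heat (2 * t) f x"
  proof -
    have "of_nat n * (ennreal (h * K * exp (K * t)) * (ennreal ?c2 * heat (2 * t) f x))
        = ennreal (real n * (h * K * exp (K * t)) * ?c2) * heat (2 * t) f x"
      using h K by (simp only: ennreal_of_nat_eq_real_of_nat ennreal_mult mult.assoc of_nat_0_le_iff mult_nonneg_nonneg exp_ge_zero less_imp_le powr_ge_zero)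
    also have "real n * (h * K * exp (K * t)) = K * t * exp (K * t)" unfolding h(2)[symmetric] by simp
    finally show ?thesis by simp
  qed
  also have "ennreal (exp (l * t)) * (ennreal ?c * heat (2 * t) f x + ennreal (K * t * exp (K * t) * ?c2) * heat (2 * t) f x)
      = ennreal (exp (l * t) * (?c + K * t * exp (K * t) * ?c2)) * heat (2 * t) f x"
    using h K by (simp add: ennreal_mult ennreal_plus distrib_right mult.assoc)
  also have "K * t * exp (K * t) * ?c2 = 2 powr real CARD('n) * (K * t * exp (K * t - \<rho>\<^sup>2 / (4 * t)))"
    by (simp add: exp_diff exp_minus field_simps)
  finally show ?thesis by (simp add: mult_left_mono add_mono)
qed

lemma potential_N_bounds:
  assumes "potential_N \<alpha> K1 K2 V"
  shows "0 < \<alpha>" "0 < K1" "0 < K2" "K1 * decay \<alpha> y \<le> - V y" "- V y \<le> K2 * decay \<alpha> y" "- V y \<le> K2" "V y \<le> 0"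
proof -
  show 1: "0 < \<alpha>" "0 < K1" "0 < K2" using assms by (auto simp: potential_N_def)
  show 2: "K1 * decay \<alpha> y \<le> - V y" "- V y \<le> K2 * decay \<alpha> y"
    using assms by (auto simp: potential_N_def decay_def) (metis minus_mult_left neg_le_iff_le minus_minus)+
  have "K2 * decay \<alpha> y \<le> K2 * 1" using 1 by (intro mult_left_mono decay_le_1) auto
  with 2 show "- V y \<le> K2" by simp
  have "0 \<le> K1 * decay \<alpha> y" using 1 by simp
  with 2 show "V y \<le> 0" by linarith
qed

text \<open>
The second bound takes for \<open>A\<close> the ball of radius \<open>m/2\<close>.  Its points are at distance at least
\<open>m - 1 - m/2 \<ge> m/4\<close> from \<open>x\<close>, which is where \<open>4 \<le> m\<close> enters.  As \<open>m\<close> may be any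
number up to \<open>1 + |x|\<close>, the smaller of the values for \<open>x\<close> and \<open>y\<close> is admissible.
\<close>

lemma heat_kernel_upper:
  fixes P :: "real ^ 'n \<Rightarrow> 'w measure"
  assumes PB: "brownian_family P B" and p: "heat_kernel P B V p" and V: "V \<in> borel_measurable borel"
    and N: "potential_N \<alpha> K1 K V" and t: "0 < t"
  shows heat_kernel_le_exp: "p t x y \<le> exp (K * t) * gauss t (y - x)"
    and heat_kernel_le_far: "4 \<le> m \<Longrightarrow> m \<le> 1 + norm x \<Longrightarrow>
      p t x y \<le> exp (K * 2 powr \<alpha> * m powr (- \<alpha>) * t) * (2 powr (real CARD('n) / 2)
        + 2 powr real CARD('n) * (K * t * exp (K * t - (m / 4)\<^sup>2 / (4 * t)))) * gauss (2 * t) (y - x)"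
proof -
  note N = potential_N_bounds[OF N]
  let ?g = "\<lambda>z :: real ^ 'n. K * decay \<alpha> z"
  have g: "continuous_on UNIV ?g" "\<And>z. ?g z \<le> K" "\<And>z. 0 \<le> ?g z"
    using N(1,3) decay_le_1[of \<alpha>] by (auto intro!: continuous_intros mult_left_le)
  show "p t x y \<le> exp (K * t) * gauss t (y - x)"
  proof (rule heat_kernel_le[OF PB p V t N(7) g(1) N(5) g(2)])
    fix f :: "real ^ 'n \<Rightarrow> ennreal" assume [measurable]: "f \<in> borel_measurable borel"
    have "(fk_step (t / real n) ?g ^^ n) f x \<le> (\<integral>\<^sup>+y. ennreal (exp (K * t) * gauss t (y - x)) * f y \<partial>lborel)"
      if "0 < n" for n
      using fk_iter_le_exp_heat[of "t / real n" ?g K f n x] t that g(2)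
      by (simp add: heat_as_kernel)
    then show "\<exists>\<^sub>F n in sequentially. (fk_step (t / real n) ?g ^^ n) f x
        \<le> (\<integral>\<^sup>+y. ennreal (exp (K * t) * gauss t (y - x)) * f y \<partial>lborel)"
      by (intro eventually_frequently eventually_mono[OF eventually_gt_at_top[of 0]]) auto
  qed (auto intro!: continuous_intros)
  assume m: "4 \<le> m" "m \<le> 1 + norm x"
  let ?C = "exp (K * 2 powr \<alpha> * m powr (- \<alpha>) * t) * (2 powr (real CARD('n) / 2)
        + 2 powr real CARD('n) * (K * t * exp (K * t - (m / 4)\<^sup>2 / (4 * t))))"
  have C: "0 \<le> ?C" using N t by (intro mult_nonneg_nonneg add_nonneg_nonneg) auto
  show "p t x y \<le> ?C * gauss (2 * t) (y - x)"
  proof (rule heat_kernel_le[OF PB p V t N(7) g(1) N(5) g(2)])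
    fix f :: "real ^ 'n \<Rightarrow> ennreal" assume [measurable]: "f \<in> borel_measurable borel"
    have far: "m / 4 \<le> norm (z - x)" if "z \<in> ball 0 (m / 2)" for z
      using that m norm_triangle_sub[of x z] by (auto simp: norm_minus_commute)
    have split: "?g z \<le> K * 2 powr \<alpha> * m powr (- \<alpha>) + K * indicator (ball 0 (m / 2)) z" for z
    proof (cases "z \<in> ball 0 (m / 2)")
      case True
      have "0 \<le> K * 2 powr \<alpha> * m powr (- \<alpha>)" using N by simp
      then show ?thesis using True g(2)[of z] by simp
    next
      case False
      then have "decay \<alpha> z \<le> (m / 2) powr (- \<alpha>)" using N m by (intro decay_le) auto
      also have "(m / 2) powr (- \<alpha>) = 2 powr \<alpha> * m powr (- \<alpha>)"
        using m by (simp add: powr_divide powr_minus field_simps)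
      finally show ?thesis using False N by simp
    qed
    have "(fk_step (t / real n) ?g ^^ n) f x \<le> (\<integral>\<^sup>+y. ennreal (?C * gauss (2 * t) (y - x)) * f y \<partial>lborel)"
      if "0 < n" for n
    proof -
      have "(fk_step (t / real n) ?g ^^ n) f x \<le> ennreal ?C * heat (2 * t) f x"
        using t that m N by (intro fk_iter_far_core_le[where A="ball 0 (m / 2)" and g="?g"] far split) auto
      then show ?thesis using t C by (simp only: heat_as_kernel mult_pos_pos zero_less_numeral \<open>f \<in> _\<close>)
    qed
    then show "\<exists>\<^sub>F n in sequentially. (fk_step (t / real n) ?g ^^ n) f x
        \<le> (\<integral>\<^sup>+y. ennreal (?C * gauss (2 * t) (y - x)) * f y \<partial>lborel)"
      by (intro eventually_frequently eventually_mono[OF eventually_gt_at_top[of 0]]) auto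
  qed (use C in \<open>auto intro!: continuous_intros\<close>)
qed

text \<open>
Three regimes.  If \<open>m\<^sup>2 \<le> 128 K t\<^sup>2\<close>, the second term of the maximum is at least \<open>K t\<close> and the crude
bound is enough.  Otherwise either \<open>m < 4\<close>, and then \<open>K t\<close> is bounded, or the excursion cost
\<open>exp (- m\<^sup>2 / (64 t))\<close> beats \<open>K t e\<^sup>K\<^sup>t\<close>.
\<close>

lemma heat_kernel_upper_estimate:
  fixes P :: "real ^ 'n \<Rightarrow> 'w measure"
  assumes PB: "brownian_family P B" and p: "heat_kernel P B V p" and V: "V \<in> borel_measurable borel"
    and N: "potential_N \<alpha> K1 K V" and t: "0 < t"
  defines "m x y \<equiv> 1 + min (norm x) (norm y)"
  shows "p t x y \<le> (2 powr (real CARD('n) / 2) + 2 powr real CARD('n)) * exp (1 + K)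
      * t powr (- real CARD('n) / 2) * exp (- (1 / 4 * (norm (x - y))\<^sup>2 / t))
      * exp (max ((K * 2 powr \<alpha> + 2 * K) * t / m x y powr \<alpha>)
                 ((K * 2 powr \<alpha> + 2 * K) * t - 1 / 128 * (m x y)\<^sup>2 / t))"
proof -
  let ?c = "2 powr (real CARD('n) / 2) + 2 powr real CARD('n)"
  let ?Q = "t powr (- real CARD('n) / 2) * exp (- (1 / 4 * (norm (x - y))\<^sup>2 / t))"
  let ?C7 = "K * 2 powr \<alpha> + 2 * K"
  define \<mu> where "\<mu> = m x y"
  let ?M = "max (?C7 * t / \<mu> powr \<alpha>) (?C7 * t - 1 / 128 * \<mu>\<^sup>2 / t)"
  have \<mu>: "1 \<le> \<mu>" "\<mu> \<le> 1 + norm x" by (auto simp: \<mu>_def m_def)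
  have K: "0 < K" and \<alpha>: "0 < \<alpha>" using potential_N_bounds[OF N] by auto
  have Q: "0 \<le> ?Q" by simp
  have c1: "1 \<le> ?c"
    using ge_one_powr_ge_zero[of 2 "real CARD('n)"] by (smt (verit) of_nat_0_le_iff powr_ge_zero)
  have gl: "gauss s (y - x) \<le> ?Q" if "t \<le> s" "s \<le> 2 * t" for s
    using gauss_le[OF t that, of "y - x"] by (simp add: norm_minus_commute)
  have "p t x y \<le> ?c * exp (1 + K) * exp ?M * ?Q"
  proof -
    have M0: "0 \<le> ?C7 * t / \<mu> powr \<alpha>" using K t by simp
    consider (a) "\<mu>\<^sup>2 \<le> 128 * K * t\<^sup>2" | (b) "128 * K * t\<^sup>2 < \<mu>\<^sup>2" "\<mu> < 4" | (c) "128 * K * t\<^sup>2 < \<mu>\<^sup>2" "4 \<le> \<mu>"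
      by linarith
    then show ?thesis
    proof cases
      case a
      have "1 / 128 * \<mu>\<^sup>2 / t \<le> K * t"
        using a t by (simp add: field_simps power2_eq_square)
      moreover have "0 \<le> K * 2 powr \<alpha> * t" using K t by simp
      ultimately have "K * t \<le> ?M" by (simp add: algebra_simps)
      have "p t x y \<le> exp (K * t) * gauss t (y - x)" by (rule heat_kernel_le_exp[OF PB p V N t])
      also have "\<dots> \<le> exp ?M * ?Q" using \<open>K * t \<le> ?M\<close> t by (intro mult_mono gl) auto
      also have "\<dots> \<le> (?c * exp (1 + K)) * (exp ?M * ?Q)"
      proof -
        have "1 * 1 \<le> ?c * exp (1 + K)" using c1 K by (intro mult_mono) auto
        then have "1 * (exp ?M * ?Q) \<le> (?c * exp (1 + K)) * (exp ?M * ?Q)" using Q by (intro mult_right_mono) auto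
        then show ?thesis by simp
      qed
      finally show ?thesis by (simp only: mult.assoc)
    next
      case b
      have Kt: "K * t \<le> 1 + K"
      proof (rule ccontr)
        assume "\<not> K * t \<le> 1 + K"
        then have "(1 + K)\<^sup>2 < (K * t)\<^sup>2" using K by (intro power_strict_mono) auto
        also have "(K * t)\<^sup>2 = K * (K * t\<^sup>2)" by (simp add: power2_eq_square)
        also have "\<dots> \<le> K * 1"
        proof -
          have "\<mu>\<^sup>2 < 4\<^sup>2" using b \<mu> by (intro power_strict_mono) auto
          then have "K * t\<^sup>2 \<le> 1" using b by simp
          then show ?thesis using K by (intro mult_left_mono) auto
        qed
        finally show False using K mult_pos_pos[OF K K] by (simp add: power2_eq_square algebra_simps)
      qed
      have "p t x y \<le> exp (K * t) * gauss t (y - x)" by (rule heat_kernel_le_exp[OF PB p V N t])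
      also have "\<dots> \<le> (exp (1 + K) * exp ?M) * ?Q"
      proof (intro mult_mono gl)
        have "exp (K * t) * 1 \<le> exp (1 + K) * exp ?M" using Kt M0 by (intro mult_mono) auto
        then show "exp (K * t) \<le> exp (1 + K) * exp ?M" by simp
      qed (use t in auto)
      also have "\<dots> = 1 * (exp (1 + K) * exp ?M * ?Q)" by simp
      also have "\<dots> \<le> ?c * (exp (1 + K) * exp ?M * ?Q)" using c1 Q by (intro mult_right_mono) auto
      finally show ?thesis by (simp only: mult.assoc)
    next
      case c
      have small: "K * t * exp (K * t - (\<mu> / 4)\<^sup>2 / (4 * t)) \<le> 1"
      proof -
        have le: "2 * (K * t) \<le> (\<mu> / 4)\<^sup>2 / (4 * t)"
          using c t by (simp add: field_simps power2_eq_square)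
        have "K * t \<le> exp (K * t)" using exp_ge_add_one_self[of "K * t"] by linarith
        then have "K * t * exp (K * t - (\<mu> / 4)\<^sup>2 / (4 * t)) \<le> exp (K * t) * exp (K * t - (\<mu> / 4)\<^sup>2 / (4 * t))"
          by (intro mult_right_mono) auto
        also have "\<dots> = exp (2 * (K * t) - (\<mu> / 4)\<^sup>2 / (4 * t))" by (simp add: exp_add[symmetric])
        also have "\<dots> \<le> 1" using le by simp
        finally show ?thesis .
      qed
      have la: "K * 2 powr \<alpha> * \<mu> powr (- \<alpha>) * t \<le> ?M"
      proof -
        have "K * 2 powr \<alpha> * \<mu> powr (- \<alpha>) * t = K * 2 powr \<alpha> * t / \<mu> powr \<alpha>"
          by (simp add: powr_minus divide_inverse)
        also have "\<dots> \<le> ?C7 * t / \<mu> powr \<alpha>" using K t by (intro divide_right_mono mult_right_mono) auto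
        finally show ?thesis by simp
      qed
      have "p t x y \<le> exp (K * 2 powr \<alpha> * \<mu> powr (- \<alpha>) * t) * (2 powr (real CARD('n) / 2)
        + 2 powr real CARD('n) * (K * t * exp (K * t - (\<mu> / 4)\<^sup>2 / (4 * t)))) * gauss (2 * t) (y - x)"
        by (rule heat_kernel_le_far[OF PB p V N t c(2) \<mu>(2)])
      also have "\<dots> \<le> exp ?M * ?c * ?Q"
      proof (intro mult_mono gl add_mono)
        have "2 powr real CARD('n) * (K * t * exp (K * t - (\<mu> / 4)\<^sup>2 / (4 * t))) \<le> 2 powr real CARD('n) * 1"
          using small by (intro mult_left_mono) auto
        then show "2 powr real CARD('n) * (K * t * exp (K * t - (\<mu> / 4)\<^sup>2 / (4 * t))) \<le> 2 powr real CARD('n)" by simp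
      qed (use la t K in auto)
      also have "\<dots> = 1 * (?c * exp ?M * ?Q)" by simp
      also have "\<dots> \<le> exp (1 + K) * (?c * exp ?M * ?Q)" using c1 Q K by (intro mult_right_mono) auto
      finally show ?thesis by (simp only: mult_ac)
    qed
  qed
  then show ?thesis unfolding \<mu>_def by (simp only: mult_ac)
qed

section \<open>Staying in a ball\<close>

definition ball_mass :: "'n::finite itself \<Rightarrow> real" where
  "ball_mass _ = measure lborel (ball (0 :: real ^ 'n) 1)"

lemma ball_mass_pos: "0 < ball_mass TYPE('n::finite)"
  unfolding ball_mass_def by (rule content_ball_pos) simp

lemma emeasure_ball:
  fixes a :: "real ^ 'n"
  assumes "0 < R"
  shows "emeasure lborel (ball a R) = ennreal (ball_mass TYPE('n) * R ^ CARD('n))"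
proof -
  have "measure lborel (ball a R) = R ^ CARD('n) * ball_mass TYPE('n)"
    using content_ball_conv_unit_ball[of R a] assms by (simp add: ball_mass_def)
  then show ?thesis
    using emeasure_eq_ennreal_measure[of lborel "ball a R"] emeasure_lborel_ball_finite[of a R]
    by (simp add: mult.commute)
qed

lemma heat_ge_on_ball:
  fixes f :: "real ^ 'n \<Rightarrow> ennreal"
  assumes s: "0 < s" and R: "0 < R" and b: "0 \<le> b" "\<And>u. u \<in> ball a R \<Longrightarrow> b \<le> gauss s (u - z)"
    and c: "\<And>u. u \<in> ball a R \<Longrightarrow> c \<le> f u" and [measurable]: "f \<in> borel_measurable borel"
  shows "ennreal (b * (ball_mass TYPE('n) * R ^ CARD('n))) * c \<le> heat s f z"
proof -
  have "ennreal (b * (ball_mass TYPE('n) * R ^ CARD('n))) * c = ennreal b * c * emeasure lborel (ball a R)"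
    using b ball_mass_pos[where 'n='n] R unfolding emeasure_ball[OF R] by (subst ennreal_mult) (auto simp: mult_ac)
  also have "\<dots> = (\<integral>\<^sup>+u. ennreal b * c * indicator (ball a R) u \<partial>lborel)"
    by (subst nn_integral_cmult_indicator) auto
  also have "\<dots> \<le> (\<integral>\<^sup>+u. ennreal (gauss s (u - z)) * f u \<partial>lborel)"
    by (intro nn_integral_mono) (auto simp: indicator_def b(2) c intro!: mult_mono ennreal_leI)
  finally show ?thesis using s by (simp add: heat_pos)
qed

lemma square_powr_neg_half:
  fixes x :: real
  assumes "0 < x"
  shows "(x\<^sup>2) powr (- real n / 2) = 1 / x ^ n"
proof -
  have "(x\<^sup>2) powr (- real n / 2) = (x powr 2) powr (- real n / 2)" using assms by simp
  also have "\<dots> = x powr (- real n)" unfolding powr_powr by simp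
  also have "\<dots> = 1 / x ^ n" using assms by (simp add: powr_minus powr_realpow divide_inverse)
  finally show ?thesis .
qed

text \<open>
A lower bound for the probability that Brownian motion started in a ball of radius \<open>R\<close> is in that
ball again at a given time between \<open>R\<^sup>2/3\<close> and \<open>4 R\<^sup>2/3\<close>; by scaling it does not depend on \<open>R\<close>.
\<close>

definition return_mass :: "'n::finite itself \<Rightarrow> real" where
  "return_mass T = exp (- 6) / 3 ^ CARD('n) * ball_mass T"

lemma return_mass_pos: "0 < return_mass TYPE('n::finite)"
  by (simp add: return_mass_def ball_mass_pos)

lemma heat_return_to_ball:
  fixes f :: "real ^ 'n \<Rightarrow> ennreal"
  assumes R: "0 < R" and s: "R\<^sup>2 / 3 \<le> s" "s \<le> 4 * R\<^sup>2 / 3" and z: "z \<in> ball a R"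
    and c: "\<And>u. u \<in> ball a R \<Longrightarrow> c \<le> f u" and f: "f \<in> borel_measurable borel"
  shows "ennreal (return_mass TYPE('n)) * c \<le> heat s f z"
proof -
  have s0: "0 < s" using R s by (smt (verit) divide_pos_pos zero_less_power)
  \<comment> \<open>Two points of the ball have distance at most \<open>2 R\<close>, so the exponent is at most
    \<open>(2 R)\<^sup>2 / (2 R\<^sup>2 / 3) = 6\<close>; the prefactor uses \<open>8 \<pi> / 3 \<le> 9\<close>.\<close>
  define b where "b = exp (- 6) / (3 * R) ^ CARD('n)"
  have "b \<le> gauss s (u - z)" if u: "u \<in> ball a R" for u
  proof -
    have "dist u z < 2 * R" using u z dist_triangle2[of u z a] by (simp add: dist_commute)
    then have "(norm (u - z))\<^sup>2 \<le> (2 * R)\<^sup>2" by (intro power_mono) (auto simp: dist_norm)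
    then have "(norm (u - z))\<^sup>2 / (2 * s) \<le> (2 * R)\<^sup>2 / (2 * (R\<^sup>2 / 3))"
      using s R s0 by (intro frac_le) auto
    also have "\<dots> = 6" using R by (simp add: power2_eq_square)
    finally have e: "exp (- 6) \<le> exp (- (norm (u - z))\<^sup>2 / (2 * s))" by simp
    have "2 * pi * s \<le> 2 * pi * (4 * R\<^sup>2 / 3)" using s by (intro mult_left_mono) auto
    also have "\<dots> = R\<^sup>2 * (8 / 3 * pi)" by simp
    also have "\<dots> \<le> R\<^sup>2 * 9" using pi_less_4 pi_approx by (intro mult_left_mono) auto
    also have "\<dots> = (3 * R)\<^sup>2" by (simp add: power2_eq_square)
    finally have "(2 * pi * s) powr (- real CARD('n) / 2) \<ge> ((3 * R)\<^sup>2) powr (- real CARD('n) / 2)"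
      using s0 by (intro powr_mono2') auto
    moreover have "((3 * R)\<^sup>2) powr (- real CARD('n) / 2) = 1 / (3 * R) ^ CARD('n)"
      using R by (intro square_powr_neg_half) simp
    ultimately have "1 / (3 * R) ^ CARD('n) * exp (- 6) \<le> gauss s (u - z)"
      unfolding gauss_def using e by (intro mult_mono) auto
    then show ?thesis by (simp add: b_def)
  qed
  from heat_ge_on_ball[OF s0 R _ this c f, of a]
  have "ennreal (b * (ball_mass TYPE('n) * R ^ CARD('n))) * c \<le> heat s f z" using R by (simp add: b_def)
  also have "b * (ball_mass TYPE('n) * R ^ CARD('n)) = return_mass TYPE('n)"
    using R by (simp add: b_def return_mass_def power_mult_distrib)
  finally show ?thesis .
qed

text \<open>
One time block, of length \<open>3 q h\<close> between \<open>R\<^sup>2\<close> and \<open>2 R\<^sup>2\<close>.  Only the middle third of the Duhamel terms is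
kept, so that both the time before the potential acts and the time after it are comparable to
\<open>R\<^sup>2\<close> and the flow returns to the ball each time.
\<close>

lemma fk_block_gain:
  fixes f :: "real ^ 'n \<Rightarrow> ennreal"
  assumes R: "0 < R" and h: "0 < h" "R\<^sup>2 \<le> 3 * real q * h" "3 * real q * h \<le> 2 * R\<^sup>2"
    and g: "\<And>u. 0 \<le> g u" "\<And>u. u \<in> ball a R \<Longrightarrow> \<gamma> \<le> g u" and \<gamma>: "3 * exp 1 / (return_mass TYPE('n))\<^sup>2 \<le> \<gamma> * R\<^sup>2"
    and c: "\<And>u. u \<in> ball a R \<Longrightarrow> c \<le> f u" and z: "z \<in> ball a R"
    and [measurable]: "f \<in> borel_measurable borel" "g \<in> borel_measurable borel"
  shows "ennreal (exp 1) * c \<le> (fk_step h g ^^ (3 * q)) f z"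
proof -
  let ?k = "return_mass TYPE('n)"
  have k: "0 < ?k" by (rule return_mass_pos)
  have "0 < 3 * exp 1 / ?k\<^sup>2" using k by simp
  then have "0 < \<gamma> * R\<^sup>2" using \<gamma> by linarith
  then have \<gamma>0: "0 < \<gamma>" using R by (simp add: zero_less_mult_iff)
  have st: "ennreal ?k * (ennreal (h * \<gamma>) * (ennreal ?k * c))
      \<le> heat (real j * h) (\<lambda>u. ennreal (h * g u) * heat (real (3 * q - j) * h) f u) z" if j: "j \<in> {q..<2 * q}" for j
  proof -
    have jq: "real q * h \<le> real j * h" "real j * h \<le> 2 * real q * h"
      "real q * h \<le> real (3 * q - j) * h" "real (3 * q - j) * h \<le> 2 * real q * h"
      using j h by (auto intro!: mult_right_mono)
    have 1: "R\<^sup>2 / 3 \<le> real j * h" "real j * h \<le> 4 * R\<^sup>2 / 3"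
      "R\<^sup>2 / 3 \<le> real (3 * q - j) * h" "real (3 * q - j) * h \<le> 4 * R\<^sup>2 / 3"
      using h jq by linarith+
    have "ennreal (h * \<gamma>) * (ennreal ?k * c) \<le> ennreal (h * g u) * heat (real (3 * q - j) * h) f u" if "u \<in> ball a R" for u
      using that heat_return_to_ball[OF R 1(3,4) that c] g h by (intro mult_mono ennreal_leI mult_left_mono) auto
    then show ?thesis by (intro heat_return_to_ball[OF R 1(1,2) z]) auto
  qed
  have "ennreal (exp 1) * c \<le> ennreal (real q * (?k * (h * \<gamma> * ?k))) * c"
  proof (intro mult_right_mono ennreal_leI)
    have "3 * exp 1 \<le> \<gamma> * R\<^sup>2 * ?k\<^sup>2" using \<gamma> k by (simp add: field_simps)
    also have "\<dots> \<le> \<gamma> * (3 * real q * h) * ?k\<^sup>2" using h \<gamma>0 by (intro mult_right_mono mult_left_mono) auto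
    also have "\<dots> = 3 * (real q * (?k * (h * \<gamma> * ?k)))" by (simp add: power2_eq_square mult_ac)
    finally show "exp 1 \<le> real q * (?k * (h * \<gamma> * ?k))" by simp
  qed simp
  also have "\<dots> = (\<Sum>j\<in>{q..<2 * q}. ennreal ?k * (ennreal (h * \<gamma>) * (ennreal ?k * c)))"
    using k \<gamma>0 h by (simp add: ennreal_mult ennreal_of_nat_eq_real_of_nat mult.assoc)
  also have "\<dots> \<le> (\<Sum>j\<in>{q..<2 * q}. heat (real j * h) (\<lambda>u. ennreal (h * g u) * heat (real (3 * q - j) * h) f u) z)"
    by (rule sum_mono) (rule st)
  also have "\<dots> \<le> (\<Sum>j<3 * q. heat (real j * h) (\<lambda>u. ennreal (h * g u) * heat (real (3 * q - j) * h) f u) z)"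
    by (rule sum_mono2) auto
  also have "\<dots> \<le> (fk_step h g ^^ (3 * q)) f z"
    using h g by (intro fk_iter_ge_duhamel) auto
  finally show ?thesis .
qed

lemma fk_blocks_gain:
  fixes f :: "real ^ 'n \<Rightarrow> ennreal"
  assumes R: "0 < R" and h: "0 < h" "R\<^sup>2 \<le> 3 * real q * h" "3 * real q * h \<le> 2 * R\<^sup>2"
    and g: "\<And>u. 0 \<le> g u" "\<And>u. u \<in> ball a R \<Longrightarrow> \<gamma> \<le> g u" and \<gamma>: "3 * exp 1 / (return_mass TYPE('n))\<^sup>2 \<le> \<gamma> * R\<^sup>2"
    and c: "\<And>u. u \<in> ball a R \<Longrightarrow> c \<le> f u" and z: "z \<in> ball a R"
    and [measurable]: "f \<in> borel_measurable borel" "g \<in> borel_measurable borel"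
  shows "ennreal (exp (real N)) * c \<le> (fk_step h g ^^ (N * (3 * q))) f z"
  using z
proof (induction N arbitrary: z)
  case 0
  then show ?case using c by simp
next
  case (Suc N)
  have "ennreal (exp (real (Suc N))) * c = ennreal (exp 1) * (ennreal (exp (real N)) * c)"
    by (simp add: exp_add ennreal_mult mult.assoc)
  also have "\<dots> \<le> (fk_step h g ^^ (3 * q)) ((fk_step h g ^^ (N * (3 * q))) f) z"
    by (rule fk_block_gain[OF R h g \<gamma> Suc.IH Suc.prems]) auto
  finally show ?case by (simp add: funpow_add)
qed

lemma gauss_third_ge:
  fixes x a z :: "real ^ 'n"
  assumes t: "0 < t" "3 * R\<^sup>2 \<le> t" and z: "z \<in> ball a R"
  shows "(3 * t) powr (- real CARD('n) / 2) * exp (- 1 - 3 * (norm (x - a))\<^sup>2 / t) \<le> gauss (t / 3) (z - x)"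
proof -
  have "norm (z - x) \<le> norm (x - a) + R"
    using z dist_triangle[of x z a] by (auto simp: dist_norm norm_minus_commute)
  then have "(norm (z - x))\<^sup>2 \<le> (norm (x - a) + R)\<^sup>2" by (intro power_mono) auto
  also have "\<dots> \<le> 2 * (norm (x - a))\<^sup>2 + 2 * R\<^sup>2"
    using sum_squares_bound[of "norm (x - a)" R] by (simp add: power2_sum)
  finally have "(norm (z - x))\<^sup>2 \<le> 2 * (norm (x - a))\<^sup>2 + 2 * t / 3" using t by simp
  then have "(norm (z - x))\<^sup>2 / (2 * (t / 3)) \<le> (2 * (norm (x - a))\<^sup>2 + 2 * t / 3) / (2 * (t / 3))"
    using t by (intro divide_right_mono) auto
  also have "\<dots> = 1 + 3 * (norm (x - a))\<^sup>2 / t" using t by (simp add: field_simps)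
  finally have "exp (- 1 - 3 * (norm (x - a))\<^sup>2 / t) \<le> exp (- (norm (z - x))\<^sup>2 / (2 * (t / 3)))" by simp
  moreover have "(3 * t) powr (- real CARD('n) / 2) \<le> (2 * pi * (t / 3)) powr (- real CARD('n) / 2)"
  proof (rule powr_mono2')
    have "2 * pi * (t / 3) = t * (2 / 3 * pi)" by simp
    also have "\<dots> \<le> t * 3" using t pi_less_4 by (intro mult_left_mono) auto
    finally show "2 * pi * (t / 3) \<le> 3 * t" by simp
  qed (use t in auto)
  ultimately show ?thesis unfolding gauss_def by (intro mult_mono) auto
qed

text \<open>
The numbers are tuned so that \<open>t/3\<close> consists of \<open>N\<close> whole blocks of length \<open>t / (3 N)\<close>, which lies
between \<open>R\<^sup>2\<close> and \<open>2 R\<^sup>2\<close>, each divided into \<open>3 q\<close> steps.  The potential is discarded while travelling.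
\<close>

lemma fk_travel_stay_travel:
  fixes f :: "real ^ 'n \<Rightarrow> ennreal"
  assumes R: "0 < R" and t: "3 * R\<^sup>2 \<le> t" and N: "N = nat \<lfloor>t / (3 * R\<^sup>2)\<rfloor>" and q: "0 < q"
    and g: "\<And>u. 0 \<le> g u" "\<And>u. u \<in> ball a R \<Longrightarrow> \<gamma> \<le> g u" and \<gamma>: "3 * exp 1 / (return_mass TYPE('n))\<^sup>2 \<le> \<gamma> * R\<^sup>2"
    and [measurable]: "f \<in> borel_measurable borel" "g \<in> borel_measurable borel"
  shows "(\<integral>\<^sup>+y. ennreal (ball_mass TYPE('n) * R ^ CARD('n) * exp (real N)
        * ((3 * t) powr (- real CARD('n) / 2) * exp (- 1 - 3 * (norm (x - a))\<^sup>2 / t))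
        * ((3 * t) powr (- real CARD('n) / 2) * exp (- 1 - 3 * (norm (y - a))\<^sup>2 / t))) * f y \<partial>lborel)
      \<le> (fk_step (t / real (9 * N * q)) g ^^ (9 * N * q)) f x"
proof -
  let ?G = "\<lambda>y. (3 * t) powr (- real CARD('n) / 2) * exp (- 1 - 3 * (norm (y - a))\<^sup>2 / t)"
  have R2: "0 < R\<^sup>2" using R by simp
  then have t0: "0 < t" using t by linarith
  have w: "1 \<le> t / (3 * R\<^sup>2)" using t R2 by (simp add: field_simps)
  then have N1: "1 \<le> N" unfolding N by linarith
  have Nw: "real N \<le> t / (3 * R\<^sup>2)" "t / (3 * R\<^sup>2) \<le> 2 * real N"
    using w N1 unfolding N by linarith+
  define h where "h = t / real (9 * N * q)"
  have h: "0 < h" using t0 N1 q by (simp add: h_def)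
  have hN: "real (N * (3 * q)) * h = t / 3" using N1 q by (simp add: h_def field_simps)
  have hq: "3 * real q * h = t / (3 * real N)" using N1 q by (simp add: h_def field_simps)
  have h1: "R\<^sup>2 \<le> 3 * real q * h" "3 * real q * h \<le> 2 * R\<^sup>2"
    using Nw N1 R2 unfolding hq by (auto simp: field_simps)
  define c where "c = (\<integral>\<^sup>+y. ennreal (?G y) * f y \<partial>lborel)"
  let ?A = "fk_step h g ^^ (N * (3 * q))"
  have A1: "heat (t / 3) f' u \<le> ?A f' u" if "f' \<in> borel_measurable borel" for f' u
    using heat_le_fk_iter[of h g f' "N * (3 * q)" u] h g that unfolding hN by simp
  have c1: "c \<le> ?A f u" if "u \<in> ball a R" for u
  proof -
    have "?G y \<le> gauss (t / 3) (y - u)" for y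
      using gauss_third_ge[OF t0 t that, of y] by (simp add: gauss_minus_commute)
    then have "c \<le> heat (t / 3) f u"
      unfolding c_def using t0 by (auto simp: heat_pos intro!: nn_integral_mono mult_right_mono ennreal_leI)
    also have "\<dots> \<le> ?A f u" by (rule A1) simp
    finally show ?thesis .
  qed
  have c2: "ennreal (exp (real N)) * c \<le> ?A (?A f) u" if "u \<in> ball a R" for u
    by (rule fk_blocks_gain[OF R h h1 g \<gamma> c1 that]) auto
  have "ennreal (?G x * (ball_mass TYPE('n) * R ^ CARD('n))) * (ennreal (exp (real N)) * c) \<le> heat (t / 3) (?A (?A f)) x"
    using t0 gauss_third_ge[OF t0 t] by (intro heat_ge_on_ball[OF _ R _ _ c2]) auto
  also have "\<dots> \<le> ?A (?A (?A f)) x" by (rule A1) simp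
  also have "?A (?A (?A f)) = (fk_step h g ^^ (9 * N * q)) f"
  proof -
    have "9 * N * q = N * (3 * q) + (N * (3 * q) + N * (3 * q))" by simp
    then show ?thesis by (simp only: funpow_add comp_def)
  qed
  finally have 1: "ennreal (?G x * (ball_mass TYPE('n) * R ^ CARD('n))) * (ennreal (exp (real N)) * c)
      \<le> (fk_step h g ^^ (9 * N * q)) f x" .
  have v: "0 \<le> ball_mass TYPE('n)" using ball_mass_pos[where 'n='n] by simp
  have "(\<integral>\<^sup>+y. ennreal (ball_mass TYPE('n) * R ^ CARD('n) * exp (real N) * ?G x * ?G y) * f y \<partial>lborel)
      = (\<integral>\<^sup>+y. ennreal (ball_mass TYPE('n) * R ^ CARD('n) * exp (real N) * ?G x) * (ennreal (?G y) * f y) \<partial>lborel)"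
    using v R by (intro nn_integral_cong) (simp add: ennreal_mult mult.assoc)
  also have "\<dots> = ennreal (ball_mass TYPE('n) * R ^ CARD('n) * exp (real N) * ?G x) * c"
    unfolding c_def by (rule nn_integral_cmult) measurable
  also have "\<dots> = ennreal ((?G x * (ball_mass TYPE('n) * R ^ CARD('n))) * exp (real N)) * c"
    by (simp only: mult_ac)
  also have "\<dots> = ennreal (?G x * (ball_mass TYPE('n) * R ^ CARD('n))) * (ennreal (exp (real N)) * c)"
    using v R by (subst ennreal_mult) (auto simp: mult.assoc)
  finally show ?thesis using 1 unfolding h_def by simp
qed

lemma frequently_multiples:
  assumes "0 < m" "\<And>q. 0 < q \<Longrightarrow> Q (m * q)"
  shows "\<exists>\<^sub>F n::nat in sequentially. Q n"
  unfolding frequently_sequentially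
proof (intro allI)
  fix n
  have "n \<le> m * Suc n" using assms(1) by (cases m) auto
  then show "\<exists>k\<ge>n. Q k" using assms(2)[of "Suc n"] by blast
qed

text \<open>
Starting and ending in a ball of radius \<open>R\<close> costs a power of \<open>w = t / R\<^sup>2\<close>; half of the exponential
gain pays for it.
\<close>

lemma polynomial_loss:
  fixes w d :: real
  assumes "0 < w" "0 < d"
  shows "(18 * d) powr (- d / 2) * exp (- w / 12) \<le> (3 * w) powr (- d / 2)"
proof -
  \<comment> \<open>The slope of the tangent bound for \<open>ln\<close> is chosen so that \<open>d/2\<close> times it equals \<open>1/12\<close>.\<close>
  have "ln (3 * w) = ln (18 * d) + ln (w / (6 * d))"
    using assms by (subst ln_mult_pos[symmetric]) auto
  also have "\<dots> \<le> ln (18 * d) + w / (6 * d)"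
    using assms ln_le_minus_one[of "w / (6 * d)"] by simp
  finally have "d / 2 * ln (3 * w) \<le> d / 2 * (ln (18 * d) + w / (6 * d))"
    using assms by (intro mult_left_mono) auto
  also have "\<dots> = d / 2 * ln (18 * d) + w / 12" using assms by (simp add: field_simps)
  finally have le: "- d / 2 * ln (18 * d) + - w / 12 \<le> - d / 2 * ln (3 * w)" by simp
  have "(18 * d) powr (- d / 2) = exp (- d / 2 * ln (18 * d))" "(3 * w) powr (- d / 2) = exp (- d / 2 * ln (3 * w))"
    using assms by (simp_all add: powr_def)
  then show ?thesis using le by (simp only: exp_add[symmetric] exp_le_cancel_iff)
qed

lemma heat_kernel_ge_gauss:
  fixes P :: "real ^ 'n \<Rightarrow> 'w measure"
  assumes PB: "brownian_family P B" and p: "heat_kernel P B V p" and V: "V \<in> borel_measurable borel"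
    and N: "potential_N \<alpha> K1 K V" and t: "0 < t"
  shows "gauss t (y - x) \<le> p t x y"
proof -
  note N = potential_N_bounds[OF N]
  show ?thesis
  proof (rule heat_kernel_ge[OF PB p V t N(6), where g="\<lambda>_. 0"])
    fix f :: "real ^ 'n \<Rightarrow> ennreal" assume [measurable]: "f \<in> borel_measurable borel"
    have "(\<integral>\<^sup>+y. ennreal (gauss t (y - x)) * f y \<partial>lborel) \<le> (fk_step (t / real n) (\<lambda>_. 0) ^^ n) f x"
      if "0 < n" for n
      using heat_le_fk_iter[of "t / real n" "\<lambda>_. 0" f n x] t that by (simp add: heat_pos)
    then show "\<exists>\<^sub>F n in sequentially. (\<integral>\<^sup>+y. ennreal (gauss t (y - x)) * f y \<partial>lborel) \<le> (fk_step (t / real n) (\<lambda>_. 0) ^^ n) f x"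
      by (intro eventually_frequently eventually_mono[OF eventually_gt_at_top[of 0]]) auto
  qed (use N in \<open>auto intro!: continuous_intros\<close>)
qed

text \<open>
The first number serves times \<open>t \<ge> 3 R\<^sup>2\<close>, the second one shorter times, where the Gaussian kernel alone
suffices.
\<close>

definition lower_const :: "'n::finite itself \<Rightarrow> real" where
  "lower_const T = min (ball_mass T * exp (- 2) * 3 powr (- real CARD('n) / 2) * (18 * real CARD('n)) powr (- real CARD('n) / 2))
      (exp (- 1) * (2 * pi) powr (- real CARD('n) / 2))"

lemma lower_const_pos: "0 < lower_const TYPE('n::finite)"
  by (simp add: lower_const_def ball_mass_pos)

text \<open>
For \<open>t < 3 R\<^sup>2\<close> the factor \<open>exp (t / (12 R\<^sup>2))\<close> is bounded and nothing beyond the Gaussian is needed.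
For larger \<open>t\<close> the number of blocks spent in the ball is at least \<open>t / (6 R\<^sup>2)\<close>, and half of this
exponent is given up to the polynomial loss.
\<close>

lemma heat_kernel_ge_staying:
  fixes P :: "real ^ 'n \<Rightarrow> 'w measure" and V :: "real ^ 'n \<Rightarrow> real"
  assumes PB: "brownian_family P B" and p: "heat_kernel P B V p" and V: "V \<in> borel_measurable borel"
    and N: "potential_N \<alpha> K1 K V" and t: "0 < t" and R: "0 < R"
    and gain: "3 * exp 1 / (return_mass TYPE('n))\<^sup>2 \<le> K1 * (1 + norm a + R) powr (- \<alpha>) * R\<^sup>2"
  shows "lower_const TYPE('n) * t powr (- real CARD('n) / 2) * exp (- 3 * ((norm (x - a))\<^sup>2 + (norm (y - a))\<^sup>2) / t) * exp (t / (12 * R\<^sup>2)) \<le> p t x y"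
proof -
  let ?C = "lower_const TYPE('n)"
  let ?d = "real CARD('n)" and ?D = "(norm (x - a))\<^sup>2 + (norm (y - a))\<^sup>2"
  have d: "0 < ?d" by simp
  have R2: "0 < R\<^sup>2" using R by simp
  show ?thesis
  proof (cases "3 * R\<^sup>2 \<le> t")
    case False
    have "?C * t powr (- ?d / 2) * exp (- 3 * ?D / t) * exp (t / (12 * R\<^sup>2))
      \<le> (exp (- 1) * (2 * pi) powr (- ?d / 2)) * t powr (- ?d / 2) * exp (- (norm (y - x))\<^sup>2 / (2 * t)) * exp 1"
    proof (intro mult_mono)
      show "?C \<le> exp (- 1) * (2 * pi) powr (- ?d / 2)" by (simp add: lower_const_def)
      have "norm (y - x) \<le> norm (x - a) + norm (y - a)"
        using dist_triangle2[of x y a] by (simp add: dist_norm norm_minus_commute)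
      then have "(norm (y - x))\<^sup>2 \<le> (norm (x - a) + norm (y - a))\<^sup>2" by (intro power_mono) auto
      also have "\<dots> \<le> 2 * ?D"
        using sum_squares_bound[of "norm (x - a)" "norm (y - a)"] by (simp add: power2_sum)
      also have "\<dots> \<le> 6 * ?D" by simp
      finally have "(norm (y - x))\<^sup>2 / (2 * t) \<le> 6 * ?D / (2 * t)" using t by (intro divide_right_mono) auto
      also have "\<dots> = 3 * ?D / t"
      proof -
        have "6 * u / (2 * t) = 3 * u / t" for u by simp
        then show ?thesis .
      qed
      finally have "- (3 * ?D / t) \<le> - ((norm (y - x))\<^sup>2 / (2 * t))" by (rule le_imp_neg_le)
      moreover have "- 3 * u / t = - (3 * u / t)" "- u / (2 * t) = - (u / (2 * t))" for u by simp_all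
      ultimately show "exp (- 3 * ?D / t) \<le> exp (- (norm (y - x))\<^sup>2 / (2 * t))"
        by (simp only: exp_le_cancel_iff)
      have "t \<le> 12 * R\<^sup>2" using False R2 by linarith
      then have "t / (12 * R\<^sup>2) \<le> 1" using R2 by simp
      then show "exp (t / (12 * R\<^sup>2)) \<le> exp 1" by simp
    qed auto
    also have "\<dots> = (2 * pi) powr (- ?d / 2) * t powr (- ?d / 2) * exp (- (norm (y - x))\<^sup>2 / (2 * t))"
      by (simp add: exp_minus)
    also have "\<dots> = gauss t (y - x)" using t by (simp add: gauss_def powr_mult)
    also have "\<dots> \<le> p t x y" by (rule heat_kernel_ge_gauss[OF PB p V N t])
    finally show ?thesis .
  next
    case True
    let ?G = "\<lambda>y. (3 * t) powr (- ?d / 2) * exp (- 1 - 3 * (norm (y - a))\<^sup>2 / t)"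
    define M where "M = nat \<lfloor>t / (3 * R\<^sup>2)\<rfloor>"
    let ?L = "\<lambda>y. ball_mass TYPE('n) * R ^ CARD('n) * exp (real M) * ?G x * ?G y"
    have w1: "1 \<le> t / (3 * R\<^sup>2)" using True R2 by (simp add: field_simps)
    then have M1: "1 \<le> M" unfolding M_def by linarith
    have "t / (3 * R\<^sup>2) < real M + 1" using w1 unfolding M_def by linarith
    with M1 have M: "0 < M" "t / (3 * R\<^sup>2) \<le> 2 * real M" by linarith+
    have v: "0 < ball_mass TYPE('n)" by (rule ball_mass_pos)
    note Nb = potential_N_bounds[OF N]
    have "?L y \<le> p t x y"
    proof (rule heat_kernel_ge[OF PB p V t Nb(6), where g="\<lambda>z. K1 * decay \<alpha> z"])
      fix f :: "real ^ 'n \<Rightarrow> ennreal" assume [measurable]: "f \<in> borel_measurable borel"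
      show "\<exists>\<^sub>F n in sequentially. (\<integral>\<^sup>+y. ennreal (?L y) * f y \<partial>lborel) \<le> (fk_step (t / real n) (\<lambda>z. K1 * decay \<alpha> z) ^^ n) f x"
      proof (rule frequently_multiples[of "9 * M"])
        fix q :: nat assume q: "0 < q"
        have low: "K1 * (1 + norm a + R) powr (- \<alpha>) \<le> K1 * decay \<alpha> u" if "u \<in> ball a R" for u
        proof -
          have "norm u \<le> norm a + R" using that norm_triangle_sub[of u a] by (simp add: dist_norm norm_minus_commute)
          then show ?thesis using Nb by (intro mult_left_mono decay_ge) auto
        qed
        show "(\<integral>\<^sup>+y. ennreal (?L y) * f y \<partial>lborel)
            \<le> (fk_step (t / real (9 * M * q)) (\<lambda>z. K1 * decay \<alpha> z) ^^ (9 * M * q)) f x"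
          using Nb by (intro fk_travel_stay_travel[OF R True M_def q _ low gain]) auto
      qed (use M in auto)
    qed (use Nb v R t in \<open>auto intro!: continuous_intros\<close>)
    have "?C * t powr (- ?d / 2) * exp (- 3 * ?D / t) * exp (t / (12 * R\<^sup>2))
      \<le> (ball_mass TYPE('n) * exp (- 2) * 3 powr (- ?d / 2) * (18 * ?d) powr (- ?d / 2)) * t powr (- ?d / 2) * exp (- 3 * ?D / t) * exp (t / (12 * R\<^sup>2))"
      by (intro mult_right_mono) (auto simp: lower_const_def)
    also have "\<dots> = ball_mass TYPE('n) * (3 powr (- ?d / 2) * t powr (- ?d / 2)) * (exp (- 2) * exp (- 3 * ?D / t))
         * ((18 * ?d) powr (- ?d / 2) * exp (t / (12 * R\<^sup>2)))"
      by (simp only: mult_ac)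
    also have "\<dots> \<le> ball_mass TYPE('n) * (3 powr (- ?d / 2) * t powr (- ?d / 2)) * (exp (- 2) * exp (- 3 * ?D / t))
         * ((3 * (t / R\<^sup>2)) powr (- ?d / 2) * exp (real M))"
    proof (intro mult_left_mono)
      have "t / (12 * R\<^sup>2) = - (t / R\<^sup>2) / 12 + (t / R\<^sup>2) / 6" by (simp add: field_simps)
      then have "(18 * ?d) powr (- ?d / 2) * exp (t / (12 * R\<^sup>2)) = ((18 * ?d) powr (- ?d / 2) * exp (- (t / R\<^sup>2) / 12)) * exp ((t / R\<^sup>2) / 6)"
        by (simp only: exp_add mult.assoc)
      also have "\<dots> \<le> (3 * (t / R\<^sup>2)) powr (- ?d / 2) * exp (real M)"
      proof (intro mult_mono polynomial_loss)
        have "t / R\<^sup>2 / 6 \<le> real M" using M(2) by simp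
        then show "exp (t / R\<^sup>2 / 6) \<le> exp (real M)" by simp
      qed (use t R2 in auto)
      finally show "(18 * ?d) powr (- ?d / 2) * exp (t / (12 * R\<^sup>2)) \<le> (3 * (t / R\<^sup>2)) powr (- ?d / 2) * exp (real M)" .
    qed (use v in auto)
    also have "(3 * (t / R\<^sup>2)) powr (- ?d / 2) = (3 * t) powr (- ?d / 2) * R ^ CARD('n)"
    proof -
      have "(3 * (t / R\<^sup>2)) powr (- ?d / 2) = (3 * t) powr (- ?d / 2) / (R\<^sup>2) powr (- ?d / 2)"
        using t R2 powr_divide[of "3 * t" "R\<^sup>2" "- ?d / 2"] by simp
      also have "(R\<^sup>2) powr (- ?d / 2) = 1 / R ^ CARD('n)"
        by (rule square_powr_neg_half[OF R])
      finally show ?thesis by simp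
    qed
    also have "3 powr (- ?d / 2) * t powr (- ?d / 2) = (3 * t) powr (- ?d / 2)"
      using t by (simp add: powr_mult)
    also have "exp (- 2) * exp (- 3 * ?D / t) = exp (- 1 - 3 * (norm (x - a))\<^sup>2 / t) * exp (- 1 - 3 * (norm (y - a))\<^sup>2 / t)"
      unfolding exp_add[symmetric] using t by (intro arg_cong[where f=exp]) (simp add: field_simps)
    also have "ball_mass TYPE('n) * (3 * t) powr (- ?d / 2) * (exp (- 1 - 3 * (norm (x - a))\<^sup>2 / t) * exp (- 1 - 3 * (norm (y - a))\<^sup>2 / t))
         * ((3 * t) powr (- ?d / 2) * R ^ CARD('n) * exp (real M)) = ?L y"
      by (simp only: mult_ac)
    also have "\<dots> \<le> p t x y" by fact
    finally show ?thesis .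
  qed
qed

section \<open>The lower estimates\<close>

text \<open>
Travelling by way of the origin costs \<open>|x|\<^sup>2 + |y|\<^sup>2\<close>; this turns the cost into the two quantities that
occur in the estimate.
\<close>

lemma norm_squares_le:
  fixes x y :: "'a::real_normed_vector"
  shows "(norm x)\<^sup>2 + (norm y)\<^sup>2 \<le> 3 * (1 + min (norm x) (norm y))\<^sup>2 + 2 * (norm (x - y))\<^sup>2"
proof -
  have *: "(norm x)\<^sup>2 + (norm y)\<^sup>2 \<le> 3 * (1 + norm x)\<^sup>2 + 2 * (norm (x - y))\<^sup>2" for x y :: 'a
  proof -
    have "norm y \<le> norm x + norm (x - y)" using norm_triangle_sub[of y x] by (simp add: norm_minus_commute)
    then have "(norm y)\<^sup>2 \<le> (norm x + norm (x - y))\<^sup>2" by (intro power_mono) auto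
    also have "\<dots> \<le> 2 * (norm x)\<^sup>2 + 2 * (norm (x - y))\<^sup>2"
      using sum_squares_bound[of "norm x" "norm (x - y)"] by (simp add: power2_sum)
    finally have "(norm x)\<^sup>2 + (norm y)\<^sup>2 \<le> 3 * (norm x)\<^sup>2 + 2 * (norm (x - y))\<^sup>2" by simp
    also have "(norm x)\<^sup>2 \<le> (1 + norm x)\<^sup>2" by (intro power_mono) auto
    finally show ?thesis by simp
  qed
  show ?thesis
    using *[of x y] *[of y x] by (cases "norm x \<le> norm y") (auto simp: min_def norm_minus_commute)
qed

lemma heat_kernel_ge_at_origin:
  fixes P :: "real ^ 'n \<Rightarrow> 'w measure"
  assumes PB: "brownian_family P B" and p: "heat_kernel P B V p" and V: "V \<in> borel_measurable borel"
    and N: "potential_N \<alpha> K1 K V" and t: "0 < t" and R: "0 < R"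
    and gain: "3 * exp 1 / (return_mass TYPE('n))\<^sup>2 \<le> K1 * (1 + R) powr (- \<alpha>) * R\<^sup>2"
  shows "lower_const TYPE('n) * t powr (- real CARD('n) / 2) * exp (- (6 * (norm (x - y))\<^sup>2 / t))
    * exp (t / (12 * R\<^sup>2) - 9 * (1 + min (norm x) (norm y))\<^sup>2 / t) \<le> p t x y"
proof -
  let ?c = "lower_const TYPE('n) * t powr (- real CARD('n) / 2)"
  let ?m = "1 + min (norm x) (norm y)"
  have c: "0 \<le> ?c" using lower_const_pos[where 'n='n] by simp
  have "3 * ((norm x)\<^sup>2 + (norm y)\<^sup>2) / t \<le> 3 * (3 * ?m\<^sup>2 + 2 * (norm (x - y))\<^sup>2) / t"
    using norm_squares_le[of x y] t by (intro divide_right_mono mult_left_mono) auto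
  also have "\<dots> = 9 * ?m\<^sup>2 / t + 6 * (norm (x - y))\<^sup>2 / t" by (simp add: add_divide_distrib)
  finally have le: "- (6 * (norm (x - y))\<^sup>2 / t) + (t / (12 * R\<^sup>2) - 9 * ?m\<^sup>2 / t)
      \<le> - (3 * ((norm x)\<^sup>2 + (norm y)\<^sup>2) / t) + t / (12 * R\<^sup>2)" by linarith
  have "?c * exp (- (6 * (norm (x - y))\<^sup>2 / t)) * exp (t / (12 * R\<^sup>2) - 9 * ?m\<^sup>2 / t)
      = ?c * exp (- (6 * (norm (x - y))\<^sup>2 / t) + (t / (12 * R\<^sup>2) - 9 * ?m\<^sup>2 / t))"
    by (simp only: exp_add mult.assoc)
  also have "\<dots> \<le> ?c * exp (- (3 * ((norm x)\<^sup>2 + (norm y)\<^sup>2) / t) + t / (12 * R\<^sup>2))"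
    using le c by (intro mult_left_mono) auto
  also have "\<dots> = ?c * exp (- 3 * ((norm x)\<^sup>2 + (norm y)\<^sup>2) / t) * exp (t / (12 * R\<^sup>2))"
    by (simp only: exp_add mult.assoc minus_divide_left mult_minus_left)
  also have "\<dots> \<le> p t x y"
    using heat_kernel_ge_staying[OF PB p V N t R, of 0 x y] gain by simp
  finally show ?thesis .
qed

text \<open>
The ball sits at the endpoint closer to the origin, where the potential is strongest; travelling
then costs only \<open>|x - y|\<^sup>2\<close>.
\<close>

lemma heat_kernel_ge_at_endpoint:
  fixes P :: "real ^ 'n \<Rightarrow> 'w measure"
  assumes PB: "brownian_family P B" and p: "heat_kernel P B V p" and V: "V \<in> borel_measurable borel"
    and N: "potential_N \<alpha> K1 K V" and t: "0 < t" and R: "0 < R"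
    and gain: "3 * exp 1 / (return_mass TYPE('n))\<^sup>2 \<le> K1 * (1 + min (norm x) (norm y) + R) powr (- \<alpha>) * R\<^sup>2"
  shows "lower_const TYPE('n) * t powr (- real CARD('n) / 2) * exp (- (6 * (norm (x - y))\<^sup>2 / t))
    * exp (t / (12 * R\<^sup>2)) \<le> p t x y"
proof -
  let ?c = "lower_const TYPE('n) * t powr (- real CARD('n) / 2)"
  have c: "0 \<le> ?c" using lower_const_pos[where 'n='n] by simp
  obtain a where a: "norm a = min (norm x) (norm y)" "a = x \<or> a = y"
    by (metis min_def)
  then have D: "(norm (x - a))\<^sup>2 + (norm (y - a))\<^sup>2 = (norm (x - y))\<^sup>2"
    by (auto simp: norm_minus_commute)
  have "6 * (norm (x - y))\<^sup>2 / t \<ge> 3 * (norm (x - y))\<^sup>2 / t" using t by (intro divide_right_mono) auto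
  then have "exp (- (6 * (norm (x - y))\<^sup>2 / t)) \<le> exp (- 3 * (norm (x - y))\<^sup>2 / t)" by simp
  then have "?c * exp (- (6 * (norm (x - y))\<^sup>2 / t)) * exp (t / (12 * R\<^sup>2))
      \<le> ?c * exp (- 3 * (norm (x - y))\<^sup>2 / t) * exp (t / (12 * R\<^sup>2))"
    using c by (intro mult_right_mono mult_left_mono) auto
  also have "\<dots> \<le> p t x y"
    using heat_kernel_ge_staying[OF PB p V N t R, of a x y] gain unfolding D a(1) by simp
  finally show ?thesis .
qed

text \<open>
With \<open>R = S m\<^sup>\<alpha>\<^sup>/\<^sup>2 \<le> S m\<close> the gain per block is at least \<open>K\<^sub>1 2\<^sup>-\<^sup>\<alpha> S\<^sup>2\<^sup>-\<^sup>\<alpha>\<close>, which is large with \<open>S\<close> precisely because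
\<open>\<alpha> < 2\<close>, and the resulting rate \<open>1 / (12 R\<^sup>2)\<close> is a multiple of \<open>m\<^sup>-\<^sup>\<alpha>\<close>.  The case \<open>m = 1\<close> is the ball
about the origin.
\<close>

lemma heat_kernel_lower_slow_decay:
  fixes P :: "real ^ 'n \<Rightarrow> 'w measure"
  assumes PB: "brownian_family P B" and \<alpha>: "0 < \<alpha>" "\<alpha> < 2" and K1: "0 < K1"
  shows "\<exists>C3>0. \<forall>K V p x y t. heat_kernel P B V p \<and> V \<in> borel_measurable borel \<and> potential_N \<alpha> K1 K V \<and> 0 < t \<longrightarrow>
    (let m = 1 + min (norm x) (norm y) in
    lower_const TYPE('n) * t powr (- real CARD('n) / 2) * exp (- (6 * (norm (x - y))\<^sup>2 / t))
    * exp (max (C3 * t / m powr \<alpha>) (C3 * t - 9 * m\<^sup>2 / t)) \<le> p t x y)"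
proof -
  let ?\<Lambda> = "3 * exp 1 / (return_mass TYPE('n))\<^sup>2"
  have \<Lambda>: "0 < ?\<Lambda>" using return_mass_pos[where 'n='n] by simp
  \<comment> \<open>\<open>S\<close> solves \<open>\<Lambda> = K\<^sub>1 2\<^sup>-\<^sup>\<alpha> S\<^sup>2\<^sup>-\<^sup>\<alpha>\<close> unless the solution is below \<open>1\<close>.\<close>
  define S where "S = max 1 ((?\<Lambda> * 2 powr \<alpha> / K1) powr (1 / (2 - \<alpha>)))"
  have S1: "1 \<le> S" by (simp add: S_def)
  have S2: "?\<Lambda> \<le> K1 * 2 powr (- \<alpha>) * S powr (2 - \<alpha>)"
  proof -
    have q: "0 < ?\<Lambda> * 2 powr \<alpha> / K1" using K1 by (intro divide_pos_pos mult_pos_pos \<Lambda>) auto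
    have root: "(u powr (1 / (2 - \<alpha>))) powr (2 - \<alpha>) = u" if "0 < u" for u :: real
      using \<alpha> that by (simp add: powr_powr)
    have "((?\<Lambda> * 2 powr \<alpha> / K1) powr (1 / (2 - \<alpha>))) powr (2 - \<alpha>) \<le> S powr (2 - \<alpha>)"
      using \<alpha> by (intro powr_mono2) (auto simp: S_def)
    then have "?\<Lambda> * 2 powr \<alpha> / K1 \<le> S powr (2 - \<alpha>)"
      unfolding root[OF q] .
    then have "K1 * 2 powr (- \<alpha>) * (?\<Lambda> * 2 powr \<alpha> / K1) \<le> K1 * 2 powr (- \<alpha>) * S powr (2 - \<alpha>)"
      using K1 by (intro mult_left_mono) auto
    also have "K1 * 2 powr (- \<alpha>) * (?\<Lambda> * 2 powr \<alpha> / K1) = ?\<Lambda> * (2 powr (- \<alpha>) * 2 powr \<alpha>)"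
      using K1 by simp
    finally show ?thesis by (simp add: powr_add[symmetric])
  qed
  have gain: "?\<Lambda> \<le> K1 * (m + S * m powr (\<alpha> / 2)) powr (- \<alpha>) * (S * m powr (\<alpha> / 2))\<^sup>2" if m: "1 \<le> m" for m
  proof -
    have "m powr (\<alpha> / 2) \<le> m powr 1" using m \<alpha> by (intro powr_mono) auto
    then have "S * m powr (\<alpha> / 2) \<le> S * m" using S1 m by (intro mult_left_mono) auto
    moreover have "m * 1 \<le> m * S" using S1 m by (intro mult_left_mono) auto
    ultimately have le: "m + S * m powr (\<alpha> / 2) \<le> 2 * S * m" by (simp add: mult.commute[of m S])
    have pos: "0 < m + S * m powr (\<alpha> / 2)" using m S1 by (intro add_pos_nonneg) auto
    have "K1 * 2 powr (- \<alpha>) * S powr (2 - \<alpha>) = K1 * (2 * S * m) powr (- \<alpha>) * (S * m powr (\<alpha> / 2))\<^sup>2"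
    proof -
      have "(S * m powr (\<alpha> / 2))\<^sup>2 = S powr 2 * m powr \<alpha>"
        using S1 m by (simp add: power_mult_distrib) (simp add: power2_eq_square powr_add[symmetric])
      moreover have "(2 * S * m) powr (- \<alpha>) = 2 powr (- \<alpha>) * S powr (- \<alpha>) * m powr (- \<alpha>)"
        using S1 m by (simp add: powr_mult)
      ultimately have "K1 * (2 * S * m) powr (- \<alpha>) * (S * m powr (\<alpha> / 2))\<^sup>2
        = K1 * 2 powr (- \<alpha>) * (S powr 2 * S powr (- \<alpha>)) * (m powr \<alpha> * m powr (- \<alpha>))"
        by (simp only: mult_ac)
      also have "S powr 2 * S powr (- \<alpha>) = S powr (2 - \<alpha>)" by (subst powr_add[symmetric]) simp
      also have "m powr \<alpha> * m powr (- \<alpha>) = 1" using m by (subst powr_add[symmetric]) simp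
      finally show ?thesis by (simp only: mult_1_right)
    qed
    also have "\<dots> \<le> K1 * (m + S * m powr (\<alpha> / 2)) powr (- \<alpha>) * (S * m powr (\<alpha> / 2))\<^sup>2"
      using K1 \<alpha> le pos by (intro mult_right_mono mult_left_mono powr_mono2') auto
    finally show ?thesis using S2 by linarith
  qed
  show ?thesis
  proof (intro exI[of _ "1 / (12 * S\<^sup>2)"] conjI allI impI)
    show "0 < 1 / (12 * S\<^sup>2)" using S1 by simp
    fix K V p and x y :: "real ^ 'n" and t :: real
    assume A: "heat_kernel P B V p \<and> V \<in> borel_measurable borel \<and> potential_N \<alpha> K1 K V \<and> 0 < t"
    define m where "m = 1 + min (norm x) (norm y)"
    have m: "1 \<le> m" by (simp add: m_def)
    let ?R = "S * m powr (\<alpha> / 2)"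
    have R: "0 < ?R" using S1 m by simp
    have "?R\<^sup>2 = S\<^sup>2 * m powr \<alpha>"
      by (simp add: power_mult_distrib) (simp add: power2_eq_square powr_add[symmetric])
    then have R2: "t / (12 * ?R\<^sup>2) = 1 / (12 * S\<^sup>2) * t / m powr \<alpha>" by simp
    have 1: "lower_const TYPE('n) * t powr (- real CARD('n) / 2) * exp (- (6 * (norm (x - y))\<^sup>2 / t))
        * exp (1 / (12 * S\<^sup>2) * t / m powr \<alpha>) \<le> p t x y"
      using heat_kernel_ge_at_endpoint[OF PB, of V p \<alpha> K1 K t ?R x y, folded m_def] A R gain[OF m]
      unfolding R2 by blast
    have "?\<Lambda> \<le> K1 * (1 + S) powr (- \<alpha>) * S\<^sup>2" using gain[of 1] by simp
    then have 2: "lower_const TYPE('n) * t powr (- real CARD('n) / 2) * exp (- (6 * (norm (x - y))\<^sup>2 / t))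
        * exp (1 / (12 * S\<^sup>2) * t - 9 * m\<^sup>2 / t) \<le> p t x y"
      using heat_kernel_ge_at_origin[OF PB, of V p \<alpha> K1 K t S x y] A S1 unfolding m_def by simp
    show "let m = 1 + min (norm x) (norm y) in
      lower_const TYPE('n) * t powr (- real CARD('n) / 2) * exp (- (6 * (norm (x - y))\<^sup>2 / t))
      * exp (max (1 / (12 * S\<^sup>2) * t / m powr \<alpha>) (1 / (12 * S\<^sup>2) * t - 9 * m\<^sup>2 / t)) \<le> p t x y"
      unfolding Let_def m_def[symmetric] using 1 2 by (cases "1 / (12 * S\<^sup>2) * t / m powr \<alpha> \<le> 1 / (12 * S\<^sup>2) * t - 9 * m\<^sup>2 / t") (simp_all add: max_def)
  qed
qed

text \<open>
Here the ball of radius \<open>1\<close> about the origin yields \<open>exp (t/12 - 9 m\<^sup>2/t)\<close>.  If this does not dominate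
\<open>exp (t / (24 m\<^sup>\<alpha>))\<close>, then \<open>t < 20 m\<close>, hence \<open>t / m\<^sup>\<alpha> \<le> 20\<close> because \<open>\<alpha> \<ge> 1\<close>, and the Gaussian lower bound is
enough.
\<close>

lemma heat_kernel_lower_large_coupling:
  fixes P :: "real ^ 'n \<Rightarrow> 'w measure"
  assumes PB: "brownian_family P B" and \<alpha>: "2 \<le> \<alpha>" and K1: "3 * exp 1 / (return_mass TYPE('n))\<^sup>2 * 2 powr \<alpha> \<le> K1"
    and p: "heat_kernel P B V p" and V: "V \<in> borel_measurable borel" and N: "potential_N \<alpha> K1 K V" and t: "0 < t"
  shows "let m = 1 + min (norm x) (norm y) in
    lower_const TYPE('n) * t powr (- real CARD('n) / 2) * exp (- (6 * (norm (x - y))\<^sup>2 / t))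
    * exp (max (1 / 24 * t / m powr \<alpha>) (1 / 24 * t - 9 * m\<^sup>2 / t)) \<le> p t x y"
proof -
  define m where "m = 1 + min (norm x) (norm y)"
  have m: "1 \<le> m" by (simp add: m_def)
  let ?Q = "lower_const TYPE('n) * t powr (- real CARD('n) / 2) * exp (- (6 * (norm (x - y))\<^sup>2 / t))"
  have Q: "0 \<le> ?Q" using lower_const_pos[where 'n='n] by simp
  have "3 * exp 1 / (return_mass TYPE('n))\<^sup>2 * 2 powr \<alpha> * 2 powr (- \<alpha>) \<le> K1 * 2 powr (- \<alpha>)"
    using K1 by (intro mult_right_mono) auto
  then have gain: "3 * exp 1 / (return_mass TYPE('n))\<^sup>2 \<le> K1 * (1 + 1) powr (- \<alpha>) * 1\<^sup>2"
    by (simp add: mult.assoc powr_add[symmetric])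
  have origin: "?Q * exp (t / 12 - 9 * m\<^sup>2 / t) \<le> p t x y"
    using heat_kernel_ge_at_origin[OF PB p V N t zero_less_one gain, of x y] unfolding m_def by simp
  have "?Q * exp (max (1 / 24 * t / m powr \<alpha>) (1 / 24 * t - 9 * m\<^sup>2 / t)) \<le> p t x y"
  proof (cases "1 / 24 * t / m powr \<alpha> \<le> t / 12 - 9 * m\<^sup>2 / t")
    case True
    then have "max (1 / 24 * t / m powr \<alpha>) (1 / 24 * t - 9 * m\<^sup>2 / t) \<le> t / 12 - 9 * m\<^sup>2 / t"
      using t by simp
    then have "?Q * exp (max (1 / 24 * t / m powr \<alpha>) (1 / 24 * t - 9 * m\<^sup>2 / t)) \<le> ?Q * exp (t / 12 - 9 * m\<^sup>2 / t)"
      using Q by (intro mult_left_mono) auto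
    then show ?thesis using origin by linarith
  next
    case False
    have mp: "m powr 1 \<le> m powr \<alpha>" using m \<alpha> by (intro powr_mono) auto
    have "t / m powr \<alpha> \<le> t / 1" using mp m t by (intro divide_left_mono) auto
    then have "t / 24 < 9 * m\<^sup>2 / t" using False by simp
    then have "t\<^sup>2 < 216 * m\<^sup>2" using t by (simp add: field_simps power2_eq_square)
    also have "\<dots> \<le> (20 * m)\<^sup>2" by (simp add: power_mult_distrib)
    finally have "t < 20 * m" using m by (intro power2_less_imp_less[of t "20 * m"]) auto
    then have "t / m powr \<alpha> \<le> 20 * m / m powr 1" using mp m t by (intro frac_le) auto
    also have "\<dots> = 20" using m by simp
    finally have e1: "1 / 24 * t / m powr \<alpha> \<le> 1" by simp
    have "1 / 24 * t - 9 * m\<^sup>2 / t \<le> 1" using \<open>t / 24 < 9 * m\<^sup>2 / t\<close> by simp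
    with e1 have "?Q * exp (max (1 / 24 * t / m powr \<alpha>) (1 / 24 * t - 9 * m\<^sup>2 / t)) \<le> ?Q * exp 1"
      using Q by (intro mult_left_mono) auto
    also have "\<dots> \<le> (exp (- 1) * (2 * pi) powr (- real CARD('n) / 2)) * t powr (- real CARD('n) / 2)
        * exp (- (1 / 2 * (norm (y - x))\<^sup>2 / t)) * exp 1"
    proof (intro mult_right_mono mult_mono)
      show "lower_const TYPE('n) \<le> exp (- 1) * (2 * pi) powr (- real CARD('n) / 2)" by (simp add: lower_const_def)
      have "1 / 2 * (norm (y - x))\<^sup>2 / t \<le> 6 * (norm (x - y))\<^sup>2 / t"
        using t by (intro divide_right_mono) (auto simp: norm_minus_commute)
      then show "exp (- (6 * (norm (x - y))\<^sup>2 / t)) \<le> exp (- (1 / 2 * (norm (y - x))\<^sup>2 / t))" by simp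
    qed auto
    also have "\<dots> = gauss t (y - x)" by (simp add: gauss_eq[OF t] exp_minus)
    also have "\<dots> \<le> p t x y" by (rule heat_kernel_ge_gauss[OF PB p V N t])
    finally show ?thesis .
  qed
  then show ?thesis unfolding m_def Let_def .
qed

section \<open>Small potentials in dimension at least three\<close>

lemma nn_integral_powr_Icc:
  fixes \<gamma> \<sigma> :: real
  assumes \<gamma>: "\<gamma> < 1" and \<sigma>: "0 < \<sigma>"
  shows "(\<integral>\<^sup>+u. ennreal ((1 + u) powr (- \<gamma>)) * indicator {0..\<sigma>} u \<partial>lborel)
    = ennreal (((1 + \<sigma>) powr (1 - \<gamma>) - 1) / (1 - \<gamma>))"
proof -
  have "(\<integral>\<^sup>+u. ennreal ((1 + u) powr (- \<gamma>)) * indicator {0..\<sigma>} u \<partial>lborel)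
    = ennreal ((1 + \<sigma>) powr (1 - \<gamma>) / (1 - \<gamma>) - (1 + 0) powr (1 - \<gamma>) / (1 - \<gamma>))"
  proof (rule nn_integral_FTC_Icc)
    fix u :: real assume "u \<in> {0..\<sigma>}"
    then have "((\<lambda>u. (1 + u) powr (1 - \<gamma>) / (1 - \<gamma>)) has_real_derivative
        ((1 - \<gamma>) * (1 + u) powr (1 - \<gamma> - 1) * 1) / (1 - \<gamma>)) (at u)"
      by (auto intro!: derivative_eq_intros)
    then have "((\<lambda>u. (1 + u) powr (1 - \<gamma>) / (1 - \<gamma>)) has_real_derivative (1 + u) powr (- \<gamma>)) (at u)"
      using \<gamma> by simp
    then show "((\<lambda>u. (1 + u) powr (1 - \<gamma>) / (1 - \<gamma>)) has_real_derivative (1 + u) powr (- \<gamma>)) (at u)" .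
  qed (use \<sigma> in auto)
  then show ?thesis by (simp add: diff_divide_distrib)
qed

text \<open>
For \<open>|u| > \<sigma>\<close> the weight is at most \<open>(1 + \<sigma>)\<^sup>-\<^sup>\<gamma>\<close>; for \<open>|u| \<le> \<sigma>\<close> the density is at most \<open>1 / (2 \<sigma>)\<close> and
\<open>\<gamma> < 1\<close> makes the average of the weight over the interval of the same order.
\<close>

lemma normal_average_powr_le:
  fixes \<gamma> \<sigma> \<mu> :: real
  assumes \<gamma>: "0 < \<gamma>" "\<gamma> < 1" and \<sigma>: "0 < \<sigma>"
  shows "(\<integral>\<^sup>+u. ennreal (normal_density \<mu> \<sigma> u) * ennreal ((1 + \<bar>u\<bar>) powr (- \<gamma>)) \<partial>lborel)
    \<le> ennreal ((1 + 1 / (1 - \<gamma>)) * (1 + \<sigma>) powr (- \<gamma>))"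
proof -
  \<comment> \<open>\<open>\<phi> u + \<phi> (- u)\<close> dominates the weight on the interval from \<open>- \<sigma>\<close> to \<open>\<sigma>\<close>.\<close>
  define \<phi> where "\<phi> u = ennreal ((1 + u) powr (- \<gamma>)) * indicator {0..\<sigma>} u" for u :: real
  have [measurable]: "\<phi> \<in> borel_measurable borel" unfolding \<phi>_def by measurable
  have dens: "normal_density \<mu> \<sigma> u \<le> 1 / (2 * \<sigma>)" for u
  proof -
    have "2 * \<sigma> = sqrt ((2 * \<sigma>)\<^sup>2)" using \<sigma> by (subst real_sqrt_abs) simp
    also have "\<dots> \<le> sqrt (2 * pi * \<sigma>\<^sup>2)"
    proof (rule real_sqrt_le_mono)
      have "4 * \<sigma>\<^sup>2 \<le> (2 * pi) * \<sigma>\<^sup>2" using pi_gt3 by (intro mult_right_mono) auto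
      then show "(2 * \<sigma>)\<^sup>2 \<le> 2 * pi * \<sigma>\<^sup>2" by (simp add: power_mult_distrib)
    qed
    finally have "1 / sqrt (2 * pi * \<sigma>\<^sup>2) \<le> 1 / (2 * \<sigma>)" using \<sigma> by (intro divide_left_mono) auto
    moreover have "exp (- (u - \<mu>)\<^sup>2 / (2 * \<sigma>\<^sup>2)) \<le> 1" by simp
    ultimately have "1 / sqrt (2 * pi * \<sigma>\<^sup>2) * exp (- (u - \<mu>)\<^sup>2 / (2 * \<sigma>\<^sup>2)) \<le> 1 / (2 * \<sigma>) * 1"
      using \<sigma> by (intro mult_mono) auto
    then show ?thesis by (simp add: normal_density_def)
  qed
  have pt: "ennreal (normal_density \<mu> \<sigma> u) * ennreal ((1 + \<bar>u\<bar>) powr (- \<gamma>))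
      \<le> ennreal ((1 + \<sigma>) powr (- \<gamma>)) * ennreal (normal_density \<mu> \<sigma> u) + ennreal (1 / (2 * \<sigma>)) * (\<phi> u + \<phi> (- u))" for u
  proof (cases "\<bar>u\<bar> \<le> \<sigma>")
    case True
    then have "ennreal ((1 + \<bar>u\<bar>) powr (- \<gamma>)) \<le> \<phi> u + \<phi> (- u)"
      by (cases "0 \<le> u") (auto simp: \<phi>_def)
    then have "ennreal (normal_density \<mu> \<sigma> u) * ennreal ((1 + \<bar>u\<bar>) powr (- \<gamma>)) \<le> ennreal (1 / (2 * \<sigma>)) * (\<phi> u + \<phi> (- u))"
      using dens by (intro mult_mono ennreal_leI) auto
    then show ?thesis by (rule order_trans) simp
  next
    case False
    then have "(1 + \<bar>u\<bar>) powr (- \<gamma>) \<le> (1 + \<sigma>) powr (- \<gamma>)" using \<gamma> \<sigma> by (intro powr_mono2') auto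
    then have "ennreal (normal_density \<mu> \<sigma> u) * ennreal ((1 + \<bar>u\<bar>) powr (- \<gamma>)) \<le> ennreal ((1 + \<sigma>) powr (- \<gamma>)) * ennreal (normal_density \<mu> \<sigma> u)"
      by (subst mult.commute) (intro mult_right_mono ennreal_leI, auto)
    then show ?thesis by (rule order_trans) simp
  qed
  have one: "(\<integral>\<^sup>+u. ennreal (normal_density \<mu> \<sigma> u) \<partial>lborel) = 1"
    using \<sigma> prob_space.emeasure_space_1[OF prob_space_normal_density[of \<sigma> \<mu>]] by (simp add: emeasure_density)
  have neg: "(\<integral>\<^sup>+u. \<phi> (- u) \<partial>lborel) = (\<integral>\<^sup>+u. \<phi> u \<partial>lborel)"
    using nn_integral_real_affine[of \<phi> "-1" 0] by simp
  let ?I = "((1 + \<sigma>) powr (1 - \<gamma>) - 1) / (1 - \<gamma>)"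
  have I: "(\<integral>\<^sup>+u. \<phi> u \<partial>lborel) = ennreal ?I"
    unfolding \<phi>_def by (rule nn_integral_powr_Icc[OF \<gamma>(2) \<sigma>])
  have I0: "0 \<le> ?I" using \<gamma> \<sigma> ge_one_powr_ge_zero[of "1 + \<sigma>" "1 - \<gamma>"] by simp
  have "(\<integral>\<^sup>+u. ennreal (normal_density \<mu> \<sigma> u) * ennreal ((1 + \<bar>u\<bar>) powr (- \<gamma>)) \<partial>lborel)
      \<le> (\<integral>\<^sup>+u. ennreal ((1 + \<sigma>) powr (- \<gamma>)) * ennreal (normal_density \<mu> \<sigma> u) + ennreal (1 / (2 * \<sigma>)) * (\<phi> u + \<phi> (- u)) \<partial>lborel)"
    by (rule nn_integral_mono) (rule pt)
  also have "\<dots> = ennreal ((1 + \<sigma>) powr (- \<gamma>)) + ennreal (1 / (2 * \<sigma>)) * (ennreal ?I + ennreal ?I)"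
    by (simp add: nn_integral_add nn_integral_cmult one neg I)
  also have "\<dots> = ennreal ((1 + \<sigma>) powr (- \<gamma>) + 1 / (2 * \<sigma>) * (?I + ?I))"
  proof -
    have *: "ennreal p + ennreal q * (ennreal u + ennreal u) = ennreal (p + q * (u + u))"
      if "0 \<le> p" "0 \<le> q" "0 \<le> u" for p q u
      using that by (simp add: ennreal_plus[symmetric] ennreal_mult[symmetric] del: ennreal_plus)
    show ?thesis by (rule *) (use I0 \<sigma> in auto)
  qed
  also have "\<dots> \<le> ennreal ((1 + 1 / (1 - \<gamma>)) * (1 + \<sigma>) powr (- \<gamma>))"
  proof (rule ennreal_leI)
    \<comment> \<open>\<open>(1 + \<sigma>)\<^sup>1\<^sup>-\<^sup>\<gamma> - 1 \<le> \<sigma> (1 + \<sigma>)\<^sup>-\<^sup>\<gamma>\<close> covers small and large \<open>\<sigma>\<close> at once.\<close>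
    have "(1 + \<sigma>) powr (- \<gamma>) \<le> 1" using \<gamma> \<sigma> powr_mono[of "- \<gamma>" 0 "1 + \<sigma>"] by simp
    moreover have "(1 + \<sigma>) powr (1 - \<gamma>) = (1 + \<sigma>) * (1 + \<sigma>) powr (- \<gamma>)"
      using \<sigma> by (simp add: powr_diff powr_minus divide_inverse)
    ultimately have "(1 + \<sigma>) powr (1 - \<gamma>) - 1 \<le> \<sigma> * (1 + \<sigma>) powr (- \<gamma>)" by (simp add: algebra_simps)
    then have "?I \<le> \<sigma> * (1 + \<sigma>) powr (- \<gamma>) / (1 - \<gamma>)" using \<gamma> by (intro divide_right_mono) auto
    then have "1 / \<sigma> * ?I \<le> 1 / \<sigma> * (\<sigma> * (1 + \<sigma>) powr (- \<gamma>) / (1 - \<gamma>))" using \<sigma> by (intro mult_left_mono) auto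
    also have "\<dots> = 1 / (1 - \<gamma>) * (1 + \<sigma>) powr (- \<gamma>)" using \<sigma> by simp
    finally have "1 / \<sigma> * ?I \<le> 1 / (1 - \<gamma>) * (1 + \<sigma>) powr (- \<gamma>)" .
    moreover have "1 / (2 * \<sigma>) * (?I + ?I) = 1 / \<sigma> * ?I"
    proof -
      have "1 / (2 * \<sigma>) * (u + u) = 1 / \<sigma> * u" for u using \<sigma> by (simp add: field_simps)
      then show ?thesis .
    qed
    moreover have "(1 + 1 / (1 - \<gamma>)) * (1 + \<sigma>) powr (- \<gamma>) = (1 + \<sigma>) powr (- \<gamma>) + 1 / (1 - \<gamma>) * (1 + \<sigma>) powr (- \<gamma>)"
      by (simp only: distrib_right mult_1)
    ultimately show "(1 + \<sigma>) powr (- \<gamma>) + 1 / (2 * \<sigma>) * (?I + ?I) \<le> (1 + 1 / (1 - \<gamma>)) * (1 + \<sigma>) powr (- \<gamma>)"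
      by linarith
  qed
  finally show ?thesis .
qed

text \<open>
Since \<open>|z| \<ge> |z\<^sub>i|\<close> for each coordinate, \<open>(1 + |z|)\<^sup>-\<^sup>\<beta>\<close> is at most the product of the
\<open>(1 + |z\<^sub>i|)\<^sup>-\<^sup>\<beta>\<^sup>/\<^sup>d\<close>, and the integral factors.  The condition \<open>\<beta> < d\<close> gives exponents below \<open>1\<close>.
\<close>

lemma gauss_average_decay_le:
  fixes m :: "real ^ 'n"
  assumes \<beta>: "0 < \<beta>" "\<beta> < real CARD('n)" and v: "0 < v"
  shows "(\<integral>\<^sup>+z. ennreal (gauss v (z - m)) * ennreal (decay \<beta> z) \<partial>lborel)
    \<le> ennreal ((1 + 1 / (1 - \<beta> / real CARD('n))) ^ CARD('n) * (1 + v) powr (- \<beta> / 2))"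
proof -
  let ?d = "real CARD('n)"
  let ?\<gamma> = "\<beta> / ?d" and ?\<sigma> = "sqrt v"
  let ?\<psi> = "\<lambda>u :: real. ennreal ((1 + \<bar>u\<bar>) powr (- ?\<gamma>))"
  have \<gamma>: "0 < ?\<gamma>" "?\<gamma> < 1" using \<beta> by auto
  have \<sigma>: "0 < ?\<sigma>" using v by simp
  have "ennreal (decay \<beta> z) \<le> (\<Prod>i\<in>UNIV. ?\<psi> (z $ i))" for z :: "real ^ 'n"
  proof -
    have nz: "0 < 1 + norm z" by (rule add_pos_nonneg) auto
    have "decay \<beta> z = ((1 + norm z) powr (- ?\<gamma>)) ^ CARD('n)"
      using nz by (simp add: decay_def powr_realpow[symmetric] powr_powr)
    also have "\<dots> = (\<Prod>i\<in>(UNIV :: 'n set). (1 + norm z) powr (- ?\<gamma>))" by simp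
    also have "\<dots> \<le> (\<Prod>i\<in>UNIV. (1 + \<bar>z $ i\<bar>) powr (- ?\<gamma>))"
      using \<gamma> component_le_norm_cart[of z] by (intro prod_mono conjI powr_mono2') (auto intro: add_pos_nonneg)
    finally show ?thesis by (simp add: prod_ennreal ennreal_leI)
  qed
  then have "(\<integral>\<^sup>+z. ennreal (gauss v (z - m)) * ennreal (decay \<beta> z) \<partial>lborel)
      \<le> (\<integral>\<^sup>+z. ennreal (gauss v (z - m)) * (\<Prod>i\<in>UNIV. ?\<psi> (z $ i)) \<partial>lborel)"
    by (intro nn_integral_mono mult_left_mono) auto
  also have "\<dots> = (\<Prod>i\<in>UNIV. \<integral>\<^sup>+u. ennreal (normal_density (m $ i) ?\<sigma> u) * ?\<psi> u \<partial>lborel)"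
    by (rule nn_integral_gauss_prod[OF v]) measurable
  also have "\<dots> \<le> (\<Prod>i\<in>(UNIV :: 'n set). ennreal ((1 + 1 / (1 - ?\<gamma>)) * (1 + ?\<sigma>) powr (- ?\<gamma>)))"
    by (intro prod_mono_ennreal normal_average_powr_le[OF \<gamma> \<sigma>])
  also have "\<dots> = ennreal (((1 + 1 / (1 - ?\<gamma>)) * (1 + ?\<sigma>) powr (- ?\<gamma>)) ^ CARD('n))"
    using \<gamma> by (simp add: prod_ennreal[symmetric] ennreal_power)
  also have "\<dots> \<le> ennreal ((1 + 1 / (1 - ?\<gamma>)) ^ CARD('n) * (1 + v) powr (- \<beta> / 2))"
  proof (rule ennreal_leI)
    have s0: "0 < 1 + ?\<sigma>" using \<sigma> by linarith
    have "((1 + ?\<sigma>) powr (- ?\<gamma>)) ^ CARD('n) = (1 + ?\<sigma>) powr (- \<beta>)"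
      using s0 by (simp add: powr_realpow[symmetric] powr_powr)
    also have "\<dots> = ((1 + ?\<sigma>) powr 2) powr (- \<beta> / 2)" unfolding powr_powr by simp
    also have "\<dots> \<le> (1 + v) powr (- \<beta> / 2)"
    proof (rule powr_mono2')
      show "1 + v \<le> (1 + ?\<sigma>) powr 2" using s0 v by (simp add: power2_sum)
    qed (use \<beta> v in auto)
    finally show "((1 + 1 / (1 - ?\<gamma>)) * (1 + ?\<sigma>) powr (- ?\<gamma>)) ^ CARD('n) \<le> (1 + 1 / (1 - ?\<gamma>)) ^ CARD('n) * (1 + v) powr (- \<beta> / 2)"
      using \<gamma> unfolding power_mult_distrib by (intro mult_left_mono) auto
  qed
  finally show ?thesis .
qed

text \<open>
The weight acts as its average over the bridge, whose law has variance \<open>s r / (s + r)\<close> wherever the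
endpoints are.
\<close>

lemma heat_decay_heat_le:
  fixes f :: "real ^ 'n \<Rightarrow> ennreal"
  assumes \<beta>: "0 < \<beta>" "\<beta> < real CARD('n)" and s: "0 \<le> s" "0 < r" and [measurable]: "f \<in> borel_measurable borel"
  shows "heat s (\<lambda>z. ennreal (decay \<beta> z) * heat r f z) x
    \<le> ennreal ((1 + 1 / (1 - \<beta> / real CARD('n))) ^ CARD('n) * (1 + s * r / (s + r)) powr (- \<beta> / 2)) * heat (s + r) f x"
proof (cases "s = 0")
  case True
  have "0 \<le> 1 / (1 - \<beta> / real CARD('n))" using \<beta> by simp
  then have "1 \<le> (1 + 1 / (1 - \<beta> / real CARD('n))) ^ CARD('n)" by (intro one_le_power) simp
  then have "decay \<beta> x \<le> (1 + 1 / (1 - \<beta> / real CARD('n))) ^ CARD('n)"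
    using decay_le_1[of \<beta> x] \<beta> by linarith
  then show ?thesis using True by (auto intro!: mult_right_mono ennreal_leI)
next
  case False
  with s have s: "0 < s" "0 < r" by auto
  let ?v = "s * r / (s + r)"
  let ?C = "(1 + 1 / (1 - \<beta> / real CARD('n))) ^ CARD('n) * (1 + ?v) powr (- \<beta> / 2)"
  have v: "0 < ?v" using s by simp
  have "heat s (\<lambda>z. ennreal (decay \<beta> z) * heat r f z) x
      \<le> (\<integral>\<^sup>+y. ennreal (gauss (s + r) (y - x)) * f y * ennreal ?C \<partial>lborel)"
    unfolding heat_weight_heat[OF s, of f "\<lambda>z. ennreal (decay \<beta> z)" x, simplified]
    by (intro nn_integral_mono mult_left_mono gauss_average_decay_le[OF \<beta> v]) auto
  also have "\<dots> = (\<integral>\<^sup>+y. ennreal ?C * (ennreal (gauss (s + r) (y - x)) * f y) \<partial>lborel)"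
    by (simp only: mult.commute)
  also have "\<dots> = ennreal ?C * heat (s + r) f x"
    using s by (simp add: nn_integral_cmult heat_pos)
  finally show ?thesis .
qed

text \<open>
A telescoping comparison with \<open>\<integral> (1 + u)\<^sup>-\<^sup>b du\<close>; the mean value theorem supplies each step.
\<close>

lemma sum_powr_le:
  fixes b h :: real
  assumes b: "1 < b" and h: "0 < h"
  shows "(\<Sum>k<n. h * (1 + real (Suc k) * h) powr (- b)) \<le> (1 - (1 + real n * h) powr (1 - b)) / (b - 1)"
proof (induction n)
  case 0
  then show ?case by simp
next
  case (Suc n)
  let ?X = "1 + real n * h" and ?Y = "1 + real (Suc n) * h"
  have X: "0 < ?X" "?X < ?Y" using h by (auto intro: add_pos_nonneg)
  have "\<exists>\<xi>. ?X < \<xi> \<and> \<xi> < ?Y \<and> ?Y powr (1 - b) - ?X powr (1 - b) = (?Y - ?X) * ((1 - b) * \<xi> powr (- b))"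
  proof (rule MVT2[OF X(2)])
    fix u assume "?X \<le> u" "u \<le> ?Y"
    then have "0 < u" using X by linarith
    then have "((\<lambda>u. u powr (1 - b)) has_real_derivative (1 - b) * u powr (1 - b - 1)) (at u)"
      by (auto intro!: derivative_eq_intros)
    then show "((\<lambda>u. u powr (1 - b)) has_real_derivative (1 - b) * u powr (- b)) (at u)" by simp
  qed
  then obtain \<xi> where \<xi>: "?X < \<xi>" "\<xi> < ?Y" "?Y powr (1 - b) - ?X powr (1 - b) = (?Y - ?X) * ((1 - b) * \<xi> powr (- b))" by blast
  have "?Y powr (- b) \<le> \<xi> powr (- b)" using \<xi> X b by (intro powr_mono2') auto
  then have "(b - 1) * (h * ?Y powr (- b)) \<le> (b - 1) * (h * \<xi> powr (- b))" using b h by (intro mult_left_mono) auto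
  also have "\<dots> = ?X powr (1 - b) - ?Y powr (1 - b)"
  proof -
    have "?Y - ?X = h" by (simp add: algebra_simps)
    then show ?thesis using \<xi>(3) by (simp add: algebra_simps)
  qed
  finally have "h * ?Y powr (- b) \<le> (?X powr (1 - b) - ?Y powr (1 - b)) / (b - 1)"
    using b by (simp add: field_simps)
  then have "(\<Sum>k<Suc n. h * (1 + real (Suc k) * h) powr (- b))
      \<le> (1 - ?X powr (1 - b)) / (b - 1) + (?X powr (1 - b) - ?Y powr (1 - b)) / (b - 1)"
    using Suc by simp
  also have "\<dots> = (1 - ?Y powr (1 - b)) / (b - 1)" by (simp add: add_divide_distrib[symmetric])
  finally show ?case .
qed

text \<open>
The bridge variance at time \<open>k h\<close> is at least half the distance in time to the nearer endpoint, so the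
sum is controlled by two copies of a convergent one, uniformly in the total time.
\<close>

lemma sum_bridge_powr_le:
  fixes b h :: real
  assumes b: "1 < b" and h: "0 < h" "h \<le> 1"
  shows "(\<Sum>k<n. h * (1 + (real k * h) * (real (n - k) * h) / (real k * h + real (n - k) * h)) powr (- b))
    \<le> 2 powr b * (1 + 2 / (b - 1))"
proof -
  have S: "(\<Sum>k<n. h * (1 + real (Suc k) * h) powr (- b)) \<le> 1 / (b - 1)" for n
  proof -
    have "(1 - (1 + real n * h) powr (1 - b)) / (b - 1) \<le> 1 / (b - 1)" using b by (intro divide_right_mono) auto
    then show ?thesis using sum_powr_le[OF b h(1), of n] by linarith
  qed
  have term_le: "h * (1 + (real k * h) * (real (n - k) * h) / (real k * h + real (n - k) * h)) powr (- b)
      \<le> 2 powr b * (h * (1 + real k * h) powr (- b) + h * (1 + real (n - k) * h) powr (- b))" if k: "k < n" for k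
  proof -
    define s r where "s = real k * h" and "r = real (n - k) * h"
    have sr: "0 \<le> s" "0 < r" using k h by (auto simp: s_def r_def)
    define \<mu> where "\<mu> = min s r"
    have "\<mu> * (s + r) \<le> 2 * (s * r)"
    proof -
      have "\<mu> * s \<le> r * s" "\<mu> * r \<le> s * r" using sr by (auto simp: \<mu>_def intro!: mult_right_mono)
      then show ?thesis by (simp add: algebra_simps)
    qed
    then have "\<mu> / 2 \<le> s * r / (s + r)" using sr by (simp add: field_simps)
    moreover have \<mu>0: "0 \<le> \<mu>" using sr by (simp add: \<mu>_def)
    ultimately have "(1 + \<mu>) / 2 \<le> 1 + s * r / (s + r)" by (simp add: field_simps)
    then have "(1 + s * r / (s + r)) powr (- b) \<le> ((1 + \<mu>) / 2) powr (- b)"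
      using b \<mu>0 by (intro powr_mono2') auto
    also have "\<dots> = 2 powr b * (1 + \<mu>) powr (- b)"
      using \<mu>0 by (simp add: powr_divide powr_minus field_simps)
    also have "\<dots> \<le> 2 powr b * ((1 + s) powr (- b) + (1 + r) powr (- b))"
      by (intro mult_left_mono) (auto simp: \<mu>_def min_def)
    finally have "h * (1 + s * r / (s + r)) powr (- b) \<le> h * (2 powr b * ((1 + s) powr (- b) + (1 + r) powr (- b)))"
      using h by (intro mult_left_mono) auto
    then show ?thesis unfolding s_def r_def by (simp add: algebra_simps)
  qed
  have 1: "(\<Sum>k<n. h * (1 + (real k * h) * (real (n - k) * h) / (real k * h + real (n - k) * h)) powr (- b))
      \<le> (\<Sum>k<n. 2 powr b * (h * (1 + real k * h) powr (- b) + h * (1 + real (n - k) * h) powr (- b)))"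
    by (intro sum_mono term_le) auto
  have 2: "(\<Sum>k<n. 2 powr b * (h * (1 + real k * h) powr (- b) + h * (1 + real (n - k) * h) powr (- b)))
      = 2 powr b * ((\<Sum>k<n. h * (1 + real k * h) powr (- b)) + (\<Sum>k<n. h * (1 + real (n - k) * h) powr (- b)))"
    by (simp add: sum_distrib_left[symmetric] sum.distrib)
  have 3: "(\<Sum>k<n. h * (1 + real k * h) powr (- b)) \<le> 1 + 1 / (b - 1)"
  proof (cases n)
    case 0
    then show ?thesis using b by simp
  next
    case (Suc m)
    then show ?thesis using S[of m] h unfolding Suc sum.lessThan_Suc_shift by simp
  qed
  have "(\<Sum>k<n. h * (1 + real (n - k) * h) powr (- b)) = (\<Sum>k<n. h * (1 + real (Suc k) * h) powr (- b))"
    by (rule sum.reindex_bij_witness[where i="\<lambda>k. n - Suc k" and j="\<lambda>k. n - Suc k"]) (auto simp: Suc_diff_Suc)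
  then have "(\<Sum>k<n. h * (1 + real (n - k) * h) powr (- b)) \<le> 1 / (b - 1)" using S[of n] by linarith
  with 3 have "(\<Sum>k<n. h * (1 + real k * h) powr (- b)) + (\<Sum>k<n. h * (1 + real (n - k) * h) powr (- b))
      \<le> 1 + (1 / (b - 1) + 1 / (b - 1))" by linarith
  also have "1 / (b - 1) + 1 / (b - 1) = 2 / (b - 1)" by (simp only: add_divide_distrib[symmetric] one_add_one)
  finally have "2 powr b * ((\<Sum>k<n. h * (1 + real k * h) powr (- b)) + (\<Sum>k<n. h * (1 + real (n - k) * h) powr (- b)))
      \<le> 2 powr b * (1 + 2 / (b - 1))" by (rule mult_left_mono) simp
  with 1 show ?thesis unfolding 2 by (rule order_trans)
qed

text \<open>
Khasminskii's argument in discrete time.  By induction the later part of each Duhamel term is at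
most twice the free flow, the bridge bounds sum to at most half, and \<open>1 + 2 \<cdot> 1/2 = 2\<close> reproduces
the claim.
\<close>

lemma fk_iter_le_twice_heat:
  fixes f :: "real ^ 'n \<Rightarrow> ennreal"
  assumes \<beta>: "2 < \<beta>" "\<beta> < real CARD('n)" and h: "0 < h" "h \<le> 1"
    and K: "0 \<le> K" "K \<le> 1"
      "2 * exp 1 * (1 + 1 / (1 - \<beta> / real CARD('n))) ^ CARD('n) * (2 powr (\<beta> / 2) * (1 + 2 / (\<beta> / 2 - 1))) * K \<le> 1"
    and g: "\<And>z. 0 \<le> g z" "\<And>z. g z \<le> K * decay \<beta> z"
    and [measurable]: "f \<in> borel_measurable borel" "g \<in> borel_measurable borel"
  shows "(fk_step h g ^^ n) f x \<le> 2 * heat (real n * h) f x"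
proof (induction n arbitrary: x rule: less_induct)
  case (less n)
  let ?C = "(1 + 1 / (1 - \<beta> / real CARD('n))) ^ CARD('n)"
  let ?H = "heat (real n * h) f x"
  define \<theta> where "\<theta> k = (1 + (real k * h) * (real (n - k) * h) / (real k * h + real (n - k) * h)) powr (- (\<beta> / 2))" for k
  have C: "0 \<le> ?C" using \<beta> by simp
  have gK: "g z \<le> K" for z
  proof -
    have "K * decay \<beta> z \<le> K * 1" using K \<beta> by (intro mult_left_mono decay_le_1) auto
    then show ?thesis using g(2)[of z] by simp
  qed
  have hK: "exp (h * K) \<le> exp 1" using h K mult_mono[of h 1 K 1] by simp
  have "(fk_step h g ^^ n) f x \<le> ?H + (\<Sum>k<n. heat (real k * h)
        (\<lambda>z. ennreal (h * exp (h * K) * g z) * heat h ((fk_step h g ^^ (n - Suc k)) f) z) x)"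
    using h g gK K by (intro fk_iter_duhamel_le) auto
  also have "(\<Sum>k<n. heat (real k * h)
        (\<lambda>z. ennreal (h * exp (h * K) * g z) * heat h ((fk_step h g ^^ (n - Suc k)) f) z) x)
      \<le> (\<Sum>k<n. ennreal (2 * exp 1 * ?C * K * (h * \<theta> k)) * ?H)"
  proof (rule sum_mono)
    fix k assume "k \<in> {..<n}"
    then have k: "k < n" by simp
    have nk1: "h + real (n - Suc k) * h = real (n - k) * h" using k by (simp add: of_nat_diff algebra_simps)
    have kh: "real k * h + real (n - k) * h = real n * h" using k by (simp add: algebra_simps)
    have "heat (real k * h) (\<lambda>z. ennreal (h * exp (h * K) * g z) * heat h ((fk_step h g ^^ (n - Suc k)) f) z) x
        \<le> heat (real k * h) (\<lambda>z. ennreal (2 * h * exp 1 * K) * (ennreal (decay \<beta> z) * heat (real (n - k) * h) f z)) x"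
    proof (rule heat_mono)
      fix z
      have "heat h ((fk_step h g ^^ (n - Suc k)) f) z \<le> heat h (\<lambda>z. 2 * heat (real (n - Suc k) * h) f z) z"
        using k by (intro heat_mono less.IH) auto
      also have "\<dots> = 2 * heat (real (n - k) * h) f z" using h by (simp add: heat_cmult heat_heat nk1)
      finally have 1: "heat h ((fk_step h g ^^ (n - Suc k)) f) z \<le> 2 * heat (real (n - k) * h) f z" .
      have "h * exp (h * K) * g z \<le> h * exp 1 * (K * decay \<beta> z)"
        using h hK g by (intro mult_mono) auto
      then have "ennreal (h * exp (h * K) * g z) * heat h ((fk_step h g ^^ (n - Suc k)) f) z
          \<le> ennreal (h * exp 1 * (K * decay \<beta> z)) * (2 * heat (real (n - k) * h) f z)"
        by (rule mult_mono[OF ennreal_leI 1]) auto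
      also have "\<dots> = ennreal (h * exp 1 * (K * decay \<beta> z)) * (ennreal 2 * heat (real (n - k) * h) f z)" by simp
      also have "\<dots> = ennreal (2 * h * exp 1 * K * decay \<beta> z) * heat (real (n - k) * h) f z"
        using h K by (subst mult.assoc[symmetric], subst ennreal_mult[symmetric]) (auto simp: mult_ac)
      also have "\<dots> = ennreal (2 * h * exp 1 * K) * (ennreal (decay \<beta> z) * heat (real (n - k) * h) f z)"
        using h K by (subst ennreal_mult) (auto simp: mult.assoc)
      finally show "ennreal (h * exp (h * K) * g z) * heat h ((fk_step h g ^^ (n - Suc k)) f) z
          \<le> ennreal (2 * h * exp 1 * K) * (ennreal (decay \<beta> z) * heat (real (n - k) * h) f z)" .
    qed
    also have "\<dots> = ennreal (2 * h * exp 1 * K) * heat (real k * h) (\<lambda>z. ennreal (decay \<beta> z) * heat (real (n - k) * h) f z) x"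
      by (intro heat_cmult) measurable
    also have "\<dots> \<le> ennreal (2 * h * exp 1 * K) * (ennreal (?C * \<theta> k) * ?H)"
    proof (rule mult_left_mono)
      have "0 < real (n - k) * h" using k h by simp
      from heat_decay_heat_le[OF _ \<beta>(2) _ this, of "real k * h" f x]
      show "heat (real k * h) (\<lambda>z. ennreal (decay \<beta> z) * heat (real (n - k) * h) f z) x \<le> ennreal (?C * \<theta> k) * ?H"
        using \<beta> h unfolding \<theta>_def kh by simp
    qed simp
    also have "\<dots> = ennreal (2 * h * exp 1 * K * (?C * \<theta> k)) * ?H"
      using h K C by (subst (2) ennreal_mult) (auto simp: \<theta>_def mult.assoc)
    also have "2 * h * exp 1 * K * (?C * \<theta> k) = 2 * exp 1 * ?C * K * (h * \<theta> k)" by (simp only: mult_ac)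
    finally show "heat (real k * h) (\<lambda>z. ennreal (h * exp (h * K) * g z) * heat h ((fk_step h g ^^ (n - Suc k)) f) z) x
        \<le> ennreal (2 * exp 1 * ?C * K * (h * \<theta> k)) * ?H" .
  qed
  also have "(\<Sum>k<n. ennreal (2 * exp 1 * ?C * K * (h * \<theta> k)) * ?H) = ennreal (2 * exp 1 * ?C * K * (\<Sum>k<n. h * \<theta> k)) * ?H"
    using h K C unfolding sum_distrib_left sum_distrib_right[symmetric]
    by (subst sum_ennreal) (auto simp: \<theta>_def)
  also have "\<dots> \<le> 1 * ?H"
  proof (rule mult_right_mono)
    have "(\<Sum>k<n. h * \<theta> k) \<le> 2 powr (\<beta> / 2) * (1 + 2 / (\<beta> / 2 - 1))"
      unfolding \<theta>_def using \<beta> h by (intro sum_bridge_powr_le) auto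
    then have "2 * exp 1 * ?C * K * (\<Sum>k<n. h * \<theta> k) \<le> 2 * exp 1 * ?C * K * (2 powr (\<beta> / 2) * (1 + 2 / (\<beta> / 2 - 1)))"
      using C K by (intro mult_left_mono) auto
    also have "\<dots> = 2 * exp 1 * ?C * (2 powr (\<beta> / 2) * (1 + 2 / (\<beta> / 2 - 1))) * K" by (simp only: mult_ac)
    also have "\<dots> \<le> 1" by (rule K(3))
    finally show "ennreal (2 * exp 1 * ?C * K * (\<Sum>k<n. h * \<theta> k)) \<le> 1" by (simp add: ennreal_leI flip: ennreal_1)
  qed simp
  finally show ?case by (simp add: mult_2 add_left_mono)
qed

text \<open>
A faster decay may be replaced by a slower one, so the exponent can be taken as \<open>min \<alpha> (5/2)\<close>, which
lies strictly between \<open>2\<close> and the dimension.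
\<close>

lemma heat_kernel_le_twice_gauss:
  assumes d: "3 \<le> CARD('n::finite)" and \<alpha>: "2 < \<alpha>"
  shows "\<exists>K_up>0. \<forall>K1 K (P :: real ^ 'n \<Rightarrow> 'w measure) B V p t x y.
    brownian_family P B \<and> K \<le> K_up \<and> V \<in> borel_measurable borel \<and> potential_N \<alpha> K1 K V \<and> heat_kernel P B V p \<and> 0 < t
      \<longrightarrow> p t x y \<le> 2 * gauss t (y - x)"
proof -
  define \<beta> where "\<beta> = min \<alpha> (5 / 2)"
  have "(3::real) \<le> real CARD('n)" using d by simp
  then have \<beta>: "2 < \<beta>" "\<beta> < real CARD('n)" "\<beta> \<le> \<alpha>" using \<alpha> by (auto simp: \<beta>_def)
  let ?A = "2 * exp 1 * (1 + 1 / (1 - \<beta> / real CARD('n))) ^ CARD('n) * (2 powr (\<beta> / 2) * (1 + 2 / (\<beta> / 2 - 1)))"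
  have A: "0 < ?A" using \<beta> by (intro mult_pos_pos zero_less_power add_pos_nonneg) auto
  show ?thesis
  proof (intro exI[of _ "min 1 (1 / ?A)"] conjI allI impI)
    show "0 < min 1 (1 / ?A)" using A by simp
    fix K1 K and P :: "real ^ 'n \<Rightarrow> 'w measure" and B V p and t :: real and x y :: "real ^ 'n"
    assume "brownian_family P B \<and> K \<le> min 1 (1 / ?A) \<and> V \<in> borel_measurable borel \<and> potential_N \<alpha> K1 K V \<and> heat_kernel P B V p \<and> 0 < t"
    then have PB: "brownian_family P B" and K: "K \<le> 1" "K \<le> 1 / ?A" and V: "V \<in> borel_measurable borel"
      and N: "potential_N \<alpha> K1 K V" and p: "heat_kernel P B V p" and t: "0 < t" by auto
    note Nb = potential_N_bounds[OF N]
    have KA: "?A * K \<le> 1" using K(2) A by (simp only: pos_le_divide_eq[OF A] mult.commute[of K])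
    let ?g = "\<lambda>z :: real ^ 'n. K * decay \<alpha> z"
    have g: "continuous_on UNIV ?g" "\<And>z. ?g z \<le> K" "\<And>z. 0 \<le> ?g z"
      using Nb(1,3) decay_le_1[of \<alpha>] by (auto intro!: continuous_intros mult_left_le)
    have gb: "?g z \<le> K * decay \<beta> z" for z
      using Nb \<beta> unfolding decay_def by (intro mult_left_mono powr_mono) auto
    show "p t x y \<le> 2 * gauss t (y - x)"
    proof (rule heat_kernel_le[OF PB p V t Nb(7) g(1) Nb(5) g(2)])
      fix f :: "real ^ 'n \<Rightarrow> ennreal" assume [measurable]: "f \<in> borel_measurable borel"
      have "(fk_step (t / real n) ?g ^^ n) f x \<le> (\<integral>\<^sup>+y. ennreal (2 * gauss t (y - x)) * f y \<partial>lborel)"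
        if n: "max 1 (nat \<lceil>t\<rceil>) \<le> n" for n
      proof -
        \<comment> \<open>From \<open>n \<ge> t\<close> on, the step length is at most \<open>1\<close>.\<close>
        have n: "0 < n" "t \<le> real n" using n by linarith+
        have "(fk_step (t / real n) ?g ^^ n) f x \<le> 2 * heat (real n * (t / real n)) f x"
          using Nb K KA n t gb g(3) by (intro fk_iter_le_twice_heat[OF \<beta>(1,2)]) auto
        also have "\<dots> = ennreal 2 * heat t f x" using n by simp
        also have "\<dots> = (\<integral>\<^sup>+y. ennreal (2 * gauss t (y - x)) * f y \<partial>lborel)"
          using t by (intro heat_as_kernel) auto
        finally show ?thesis .
      qed
      then show "\<exists>\<^sub>F n in sequentially. (fk_step (t / real n) ?g ^^ n) f x
          \<le> (\<integral>\<^sup>+y. ennreal (2 * gauss t (y - x)) * f y \<partial>lborel)"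
        by (intro eventually_frequently eventually_mono[OF eventually_ge_at_top[of "max 1 (nat \<lceil>t\<rceil>)"]]) auto
    qed (auto intro!: continuous_intros)
  qed
qed

section \<open>The theorem\<close>

lemma two_sided_gaussianI:
  fixes p :: "real \<Rightarrow> real ^ 'n \<Rightarrow> real ^ 'n \<Rightarrow> real"
  assumes "\<And>x y t. 0 < t \<Longrightarrow> gauss t (y - x) \<le> p t x y" "\<And>x y t. 0 < t \<Longrightarrow> p t x y \<le> 2 * gauss t (y - x)"
  shows "two_sided_gaussian p"
  unfolding two_sided_gaussian_def
proof (intro exI conjI allI impI)
  fix x y :: "real ^ 'n" and t :: real assume t: "0 < t"
  show "(2 * pi) powr (- real CARD('n) / 2) * t powr (- real CARD('n) / 2) * exp (- (1 / 2 * (norm (x - y))\<^sup>2 / t)) \<le> p t x y"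
    using assms(1)[OF t, of y x] by (simp add: gauss_eq[OF t] norm_minus_commute)
  show "p t x y \<le> 2 * t powr (- real CARD('n) / 2) * exp (- (1 / 4 * (norm (x - y))\<^sup>2 / t))"
    using assms(2)[OF t, of x y] gauss_le[OF t, of t "y - x"] t by (simp add: norm_minus_commute)
qed auto

lemma estimate_EI:
  fixes P :: "real ^ 'n \<Rightarrow> 'w measure"
  assumes PB: "brownian_family P B" and p: "heat_kernel P B V p" and V: "V \<in> borel_measurable borel"
    and N: "potential_N \<alpha> K1 K V" and C3: "0 < C3"
    and lower: "\<And>x y t. 0 < t \<Longrightarrow> let m = 1 + min (norm x) (norm y) in
      lower_const TYPE('n) * t powr (- real CARD('n) / 2) * exp (- (6 * (norm (x - y))\<^sup>2 / t))
      * exp (max (C3 * t / m powr \<alpha>) (C3 * t - 9 * m\<^sup>2 / t)) \<le> p t x y"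
  shows "estimate_E \<alpha> p"
proof -
  let ?C5 = "(2 powr (real CARD('n) / 2) + 2 powr real CARD('n)) * exp (1 + K)"
  let ?C7 = "K * 2 powr \<alpha> + 2 * K"
  have K: "0 < K" using potential_N_bounds[OF N] by simp
  have main: "\<forall>x y. \<forall>t>0. let m = 1 + min (norm x) (norm y) in
    lower_const TYPE('n) * t powr (- real CARD('n) / 2) * exp (- (6 * (norm (x - y))\<^sup>2 / t))
      * exp (max (C3 * t / m powr \<alpha>) (C3 * t - 9 * m\<^sup>2 / t)) \<le> p t x y \<and>
    p t x y \<le> ?C5 * t powr (- real CARD('n) / 2) * exp (- (1 / 4 * (norm (x - y))\<^sup>2 / t))
      * exp (max (?C7 * t / m powr \<alpha>) (?C7 * t - 1 / 128 * m\<^sup>2 / t))"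
    using lower heat_kernel_upper_estimate[OF PB p V N] unfolding Let_def by blast
  have pos: "0 < ?C5" "0 < ?C7" using K by (auto intro!: mult_pos_pos add_pos_pos)
  show ?thesis
    unfolding estimate_E_def
  proof (intro exI conjI)
    show "\<forall>x y. \<forall>t>0. let m = 1 + min (norm x) (norm y) in
    lower_const TYPE('n) * t powr (- real CARD('n) / 2) * exp (- (6 * (norm (x - y))\<^sup>2 / t))
      * exp (max (C3 * t / m powr \<alpha>) (C3 * t - 9 * m\<^sup>2 / t)) \<le> p t x y \<and>
    p t x y \<le> ?C5 * t powr (- real CARD('n) / 2) * exp (- (1 / 4 * (norm (x - y))\<^sup>2 / t))
      * exp (max (?C7 * t / m powr \<alpha>) (?C7 * t - 1 / 128 * m\<^sup>2 / t))"
      by (rule main)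
  qed (rule lower_const_pos C3 pos | simp)+
qed

theorem theorem1p4:
  fixes P :: "real ^ 'n \<Rightarrow> 'w measure" and B :: "real \<Rightarrow> 'w \<Rightarrow> real ^ 'n"
  assumes "brownian_family P B"
  shows
    "(\<forall>\<alpha> K1 K2 V p.
        0 < \<alpha> \<and> \<alpha> < 2 \<and> admissible_potential V \<and> potential_N \<alpha> K1 K2 V \<and> heat_kernel P B V p
          \<longrightarrow> estimate_E \<alpha> p) \<and>
     (\<forall>\<alpha>\<ge>2. \<exists>K_low>0. \<forall>K1 K2 V p.
        K_low \<le> K1 \<and> admissible_potential V \<and> potential_N \<alpha> K1 K2 V \<and> heat_kernel P B V p
          \<longrightarrow> estimate_E \<alpha> p) \<and>
     (3 \<le> CARD('n) \<longrightarrow> (\<forall>\<alpha>>2. \<exists>K_up>0. \<forall>K1 K2 V p.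
        K2 \<le> K_up \<and> admissible_potential V \<and> potential_N \<alpha> K1 K2 V \<and> heat_kernel P B V p
          \<longrightarrow> two_sided_gaussian p))"
proof (intro conjI)
  show "\<forall>\<alpha> K1 K2 V p. 0 < \<alpha> \<and> \<alpha> < 2 \<and> admissible_potential V \<and> potential_N \<alpha> K1 K2 V \<and> heat_kernel P B V p
          \<longrightarrow> estimate_E \<alpha> p"
  proof (intro allI impI)
    fix \<alpha> K1 K2 V p
    assume A: "0 < \<alpha> \<and> \<alpha> < 2 \<and> admissible_potential V \<and> potential_N \<alpha> K1 K2 V \<and> heat_kernel P B V p"
    then have V: "V \<in> borel_measurable borel" by (simp add: admissible_potential_def)
    have "0 < K1" using A by (simp add: potential_N_def)
    with heat_kernel_lower_slow_decay[OF assms, of \<alpha> K1] A obtain C3 where C3: "C3 > 0"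
      "\<And>K V p x y t. heat_kernel P B V p \<and> V \<in> borel_measurable borel \<and> potential_N \<alpha> K1 K V \<and> 0 < t \<Longrightarrow>
        (let m = 1 + min (norm x) (norm y) in
        lower_const TYPE('n) * t powr (- real CARD('n) / 2) * exp (- (6 * (norm (x - y))\<^sup>2 / t))
        * exp (max (C3 * t / m powr \<alpha>) (C3 * t - 9 * m\<^sup>2 / t)) \<le> p t x y)"
      by blast
    show "estimate_E \<alpha> p"
      using A V by (intro estimate_EI[OF assms _ V _ C3(1)] C3(2)) auto
  qed
next
  show "\<forall>\<alpha>\<ge>2. \<exists>K_low>0. \<forall>K1 K2 V p.
        K_low \<le> K1 \<and> admissible_potential V \<and> potential_N \<alpha> K1 K2 V \<and> heat_kernel P B V p
          \<longrightarrow> estimate_E \<alpha> p"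
  proof (intro allI impI)
    fix \<alpha> :: real assume \<alpha>: "2 \<le> \<alpha>"
    let ?K = "3 * exp 1 / (return_mass TYPE('n))\<^sup>2 * 2 powr \<alpha>"
    show "\<exists>K_low>0. \<forall>K1 K2 V p.
        K_low \<le> K1 \<and> admissible_potential V \<and> potential_N \<alpha> K1 K2 V \<and> heat_kernel P B V p
          \<longrightarrow> estimate_E \<alpha> p"
    proof (intro exI[of _ ?K] conjI allI impI)
      show "0 < ?K" using return_mass_pos[where 'n='n] by simp
      fix K1 K2 V p
      assume A: "?K \<le> K1 \<and> admissible_potential V \<and> potential_N \<alpha> K1 K2 V \<and> heat_kernel P B V p"
      then have V: "V \<in> borel_measurable borel" by (simp add: admissible_potential_def)
      show "estimate_E \<alpha> p"
        by (rule estimate_EI[OF assms _ V _ _ heat_kernel_lower_large_coupling[OF assms \<alpha>]]) (use A V in auto)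
    qed
  qed
next
  show "3 \<le> CARD('n) \<longrightarrow> (\<forall>\<alpha>>2. \<exists>K_up>0. \<forall>K1 K2 V p.
        K2 \<le> K_up \<and> admissible_potential V \<and> potential_N \<alpha> K1 K2 V \<and> heat_kernel P B V p
          \<longrightarrow> two_sided_gaussian p)"
  proof (intro allI impI)
    fix \<alpha> :: real assume d: "3 \<le> CARD('n)" and \<alpha>: "2 < \<alpha>"
    from heat_kernel_le_twice_gauss[OF d \<alpha>] obtain K_up where K: "K_up > 0"
      "\<And>K1 K (P :: real ^ 'n \<Rightarrow> 'w measure) B V p t x y.
        brownian_family P B \<and> K \<le> K_up \<and> V \<in> borel_measurable borel \<and> potential_N \<alpha> K1 K V \<and> heat_kernel P B V p \<and> 0 < t
        \<Longrightarrow> p t x y \<le> 2 * gauss t (y - x)"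
      by blast
    show "\<exists>K_up>0. \<forall>K1 K2 V p.
        K2 \<le> K_up \<and> admissible_potential V \<and> potential_N \<alpha> K1 K2 V \<and> heat_kernel P B V p
          \<longrightarrow> two_sided_gaussian p"
    proof (intro exI[of _ K_up] conjI allI impI two_sided_gaussianI)
      show "0 < K_up" by fact
      fix K1 K2 V p and x y :: "real ^ 'n" and t :: real
      assume A: "K2 \<le> K_up \<and> admissible_potential V \<and> potential_N \<alpha> K1 K2 V \<and> heat_kernel P B V p" and t: "0 < t"
      then have V: "V \<in> borel_measurable borel" by (simp add: admissible_potential_def)
      show "gauss t (y - x) \<le> p t x y"
        using A by (intro heat_kernel_ge_gauss[OF assms _ V _ t]) auto
      show "p t x y \<le> 2 * gauss t (y - x)"
        using A V t assms by (intro K(2)) auto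
    qed
  qed
qed

end
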